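(* Let $n\ge 1$, $\alpha>0$, $p\ge 1$, and let $\mu$ be a positive regular radial Borel measure on $\mathbb{C}^n$ such that $\int_{\mathbb{C}^n}|K_{ph,\alpha}(z,w)|^2e^{-|w|^2/\alpha}\,d\mu(w)<\infty$ for every $z\in\mathbb{C}^n$. If for every $r>0$ the function $z\mapsto\mu(B(z,r))$ belongs to $L^p(\mathbb{C}^n,dA)$, then the Toeplitz operator $T_\mu$ on $\mathcal{PH}^2_\alpha(\mathbb{C}^n)$ belongs to the Schatten class $S_p$.
   Context: $dA$ is Lebesgue measure on $\mathbb{C}^n$, $B(z,r)$ is the Euclidean ball of center $z$ and radius $r$, and $z\bar w=\sum_{j=1}^n z_j\overline{w_j}$. A Borel measure $\mu$ on $\mathbb{C}^n$ is radial if $\mu(UE)=\mu(E)$ for every unitary $U$ on $\mathbb{C}^n$ and every Borel set $E$. A function $f:\mathbb{C}^n\to\mathbb{C}$ is pluriharmonic if $\partial^2 f/\partial z_j\partial\bar z_k=0$ for all $j,k$; equivalently $f=g+\bar h$ with $g,h$ entire. $\mathcal{PH}^2_\alpha(\mathbb{C}^n)$ is the Hilbert space of pluriharmonic functions $f$ with $\|f\|_{2,\alpha}^2=\frac{1}{(\alpha\pi)^n}\int_{\mathbb{C}^n}|f(z)|^2e^{-|z|^2/\alpha}\,dA(z)<\infty$, with inner product $\langle f,g\rangle=\frac{1}{(\alpha\pi)^n}\int f\bar g\,e^{-|z|^2/\alpha}\,dA$ and reproducing kernel $K_{ph,\alpha}(z,w)=e^{z\bar w/\alpha}+e^{\bar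 z w/\alpha}-1$. The Toeplitz operator with symbol $\mu$ is $T_\mu f(z)=\int_{\mathbb{C}^n}K_{ph,\alpha}(z,w)f(w)e^{-|w|^2/\alpha}\,d\mu(w)$, which is defined at least for $f$ in the linear span of the kernels $K_{ph,\alpha}(\cdot,w)$, $w\in\mathbb{C}^n$ (a dense subspace of $\mathcal{PH}^2_\alpha(\mathbb{C}^n)$). "$T_\mu\in S_p$" means that $T_\mu$ extends to a bounded operator on $\mathcal{PH}^2_\alpha(\mathbb{C}^n)$ which belongs to the Schatten class $S_p$ (singular values in $\ell^p$). *)

theory Defs
  imports "HOL-Analysis.Analysis"
begin

section \<open>Pluriharmonic functions on complex n-space\<close>

abbreviation partial_along :: "complex^'n \<Rightarrow> (complex^'n \<Rightarrow> complex) \<Rightarrow> complex^'n \<Rightarrow> complex" where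
  "partial_along v f \<equiv> (\<lambda>z. frechet_derivative f (at z) v)"

text \<open>Twice continuously differentiable in the real sense.\<close>

definition C2 :: "(complex^'n \<Rightarrow> complex) \<Rightarrow> bool" where
  "C2 f \<longleftrightarrow>
     (\<forall>z. f differentiable (at z)) \<and>
     (\<forall>v z. partial_along v f differentiable (at z)) \<and>
     (\<forall>u v. continuous_on UNIV (partial_along u (partial_along v f)))"

text \<open>The Wirtinger derivatives; \<open>axis j 1\<close> and \<open>axis j \<i>\<close> are the real and imaginary
  directions of the \<open>j\<close>-th coordinate.\<close>

definition wirtinger :: "'n \<Rightarrow> (complex^'n \<Rightarrow> complex) \<Rightarrow> complex^'n \<Rightarrow> complex" where
  "wirtinger j f z = (partial_along (axis j 1) f z - \<i> * partial_along (axis j \<i>) f z) / 2"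

definition wirtinger_bar :: "'n \<Rightarrow> (complex^'n \<Rightarrow> complex) \<Rightarrow> complex^'n \<Rightarrow> complex" where
  "wirtinger_bar k f z = (partial_along (axis k 1) f z + \<i> * partial_along (axis k \<i>) f z) / 2"

definition pluriharmonic :: "(complex^'n \<Rightarrow> complex) \<Rightarrow> bool" where
  "pluriharmonic f \<longleftrightarrow> C2 f \<and> (\<forall>j k z. wirtinger j (wirtinger_bar k f) z = 0)"

section \<open>The pluriharmonic Fock space\<close>

definition PH2 :: "real \<Rightarrow> (complex^'n \<Rightarrow> complex) set" where
  "PH2 \<alpha> = {f. pluriharmonic f \<and>
     integrable lborel (\<lambda>z. (cmod (f z))\<^sup>2 * exp (- (norm z)\<^sup>2 / \<alpha>))}"

definition ph_inner :: "real \<Rightarrow> (complex^'n \<Rightarrow> complex) \<Rightarrow> (complex^'n \<Rightarrow> complex) \<Rightarrow> complex" where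
  "ph_inner \<alpha> f g = complex_of_real (1 / (\<alpha> * pi) ^ CARD('n)) *
     (LINT z|lborel. f z * cnj (g z) * complex_of_real (exp (- (norm z)\<^sup>2 / \<alpha>)))"

definition hdot :: "complex^'n \<Rightarrow> complex^'n \<Rightarrow> complex" where
  "hdot z w = (\<Sum>j\<in>UNIV. z $ j * cnj (w $ j))"

definition ph_kernel :: "real \<Rightarrow> complex^'n \<Rightarrow> complex^'n \<Rightarrow> complex" where
  "ph_kernel \<alpha> z w = exp (hdot z w / complex_of_real \<alpha>) + exp (hdot w z / complex_of_real \<alpha>) - 1"

definition kernel_span :: "real \<Rightarrow> (complex^'n \<Rightarrow> complex) set" where
  "kernel_span \<alpha> = {(\<lambda>z. \<Sum>w\<in>A. c w * ph_kernel \<alpha> z w) | A c. finite A}"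

section \<open>Measures\<close>

definition unitary :: "complex^'n^'n \<Rightarrow> bool" where
  "unitary U \<longleftrightarrow>
     (\<chi> i j. cnj (U $ j $ i)) ** U = mat 1 \<and> U ** (\<chi> i j. cnj (U $ j $ i)) = mat 1"

definition radial_measure :: "(complex^'n) measure \<Rightarrow> bool" where
  "radial_measure \<mu> \<longleftrightarrow>
     (\<forall>U E. unitary U \<longrightarrow> E \<in> sets borel \<longrightarrow> emeasure \<mu> ((\<lambda>z. U *v z) ` E) = emeasure \<mu> E)"

definition regular_borel_measure :: "'a::topological_space measure \<Rightarrow> bool" where
  "regular_borel_measure \<mu> \<longleftrightarrow>
     sets \<mu> = sets borel \<and>
     (\<forall>K. compact K \<longrightarrow> K \<in> sets borel \<longrightarrow> emeasure \<mu> K < \<infinity>) \<and>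
     (\<forall>E\<in>sets borel.
        emeasure \<mu> E = (INF V\<in>{V. open V \<and> E \<subseteq> V}. emeasure \<mu> V) \<and>
        emeasure \<mu> E = (SUP K\<in>{K. compact K \<and> K \<in> sets borel \<and> K \<subseteq> E}. emeasure \<mu> K))"

section \<open>Schatten classes on a Hilbert space of functions\<close>

text \<open>A Hilbert space is given by its carrier \<open>H\<close>, a set of complex functions with the pointwise
  vector space operations, and its inner product \<open>ip\<close>.\<close>

definition ip_norm :: "(('a \<Rightarrow> complex) \<Rightarrow> ('a \<Rightarrow> complex) \<Rightarrow> complex) \<Rightarrow> ('a \<Rightarrow> complex) \<Rightarrow> real" where
  "ip_norm ip f = sqrt (Re (ip f f))"

definition bounded_operator_on ::
  "('a \<Rightarrow> complex) set \<Rightarrow> (('a \<Rightarrow> complex) \<Rightarrow> ('a \<Rightarrow> complex) \<Rightarrow> complex) \<Rightarrow>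
   (('a \<Rightarrow> complex) \<Rightarrow> 'a \<Rightarrow> complex) \<Rightarrow> bool" where
  "bounded_operator_on H ip S \<longleftrightarrow>
     (\<forall>f\<in>H. S f \<in> H) \<and>
     (\<forall>f\<in>H. \<forall>g\<in>H. \<forall>a b. S (\<lambda>z. a * f z + b * g z) = (\<lambda>z. a * S f z + b * S g z)) \<and>
     (\<exists>C. \<forall>f\<in>H. ip_norm ip (S f) \<le> C * ip_norm ip f)"

definition orthonormal_in ::
  "('a \<Rightarrow> complex) set \<Rightarrow> (('a \<Rightarrow> complex) \<Rightarrow> ('a \<Rightarrow> complex) \<Rightarrow> complex) \<Rightarrow>
   'i set \<Rightarrow> ('i \<Rightarrow> 'a \<Rightarrow> complex) \<Rightarrow> bool" where
  "orthonormal_in H ip I e \<longleftrightarrow>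
     (\<forall>i\<in>I. e i \<in> H) \<and> (\<forall>i\<in>I. \<forall>j\<in>I. ip (e i) (e j) = (if i = j then 1 else 0))"

text \<open>The canonical (Schmidt) form
  \<open>S x = (\<Sum>i\<in>I. s i * ip x (e i) * u i)\<close> of a compact operator, converging in norm.
  The \<open>s i\<close> are the nonzero singular values of \<open>S\<close>, repeated according to multiplicity;
  \<open>I\<close> may be finite.\<close>

definition singular_value_decomposition ::
  "('a \<Rightarrow> complex) set \<Rightarrow> (('a \<Rightarrow> complex) \<Rightarrow> ('a \<Rightarrow> complex) \<Rightarrow> complex) \<Rightarrow>
   (('a \<Rightarrow> complex) \<Rightarrow> 'a \<Rightarrow> complex) \<Rightarrow>
   nat set \<Rightarrow> (nat \<Rightarrow> real) \<Rightarrow> (nat \<Rightarrow> 'a \<Rightarrow> complex) \<Rightarrow> (nat \<Rightarrow> 'a \<Rightarrow> complex) \<Rightarrow> bool" where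
  "singular_value_decomposition H ip S I s e u \<longleftrightarrow>
     orthonormal_in H ip I e \<and> orthonormal_in H ip I u \<and> (\<forall>i\<in>I. s i > 0) \<and>
     (\<forall>x\<in>H. ((\<lambda>F. ip_norm ip (\<lambda>z. S x z - (\<Sum>i\<in>F. complex_of_real (s i) * ip x (e i) * u i z)))
               \<longlongrightarrow> 0) (finite_subsets_at_top I))"

text \<open>Summability of the \<open>p\<close>-th powers forces the singular values to tend to 0,
  so that such an \<open>S\<close> is compact.\<close>

definition schatten_class ::
  "('a \<Rightarrow> complex) set \<Rightarrow> (('a \<Rightarrow> complex) \<Rightarrow> ('a \<Rightarrow> complex) \<Rightarrow> complex) \<Rightarrow> real \<Rightarrow>
   (('a \<Rightarrow> complex) \<Rightarrow> 'a \<Rightarrow> complex) set" where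
  "schatten_class H ip p = {S. bounded_operator_on H ip S \<and>
     (\<exists>I s e u. singular_value_decomposition H ip S I s e u \<and> (\<lambda>i. s i powr p) summable_on I)}"

section \<open>Toeplitz operators\<close>

definition toeplitz :: "real \<Rightarrow> (complex^'n) measure \<Rightarrow> (complex^'n \<Rightarrow> complex) \<Rightarrow> complex^'n \<Rightarrow> complex" where
  "toeplitz \<alpha> \<mu> f z =
     (LINT w|\<mu>. ph_kernel \<alpha> z w * f w * complex_of_real (exp (- (norm w)\<^sup>2 / \<alpha>)))"

definition toeplitz_in_schatten :: "real \<Rightarrow> real \<Rightarrow> (complex^'n) measure \<Rightarrow> bool" where
  "toeplitz_in_schatten \<alpha> p \<mu> \<longleftrightarrow>
     (\<exists>S \<in> schatten_class (PH2 \<alpha>) (ph_inner \<alpha>) p. \<forall>f\<in>kernel_span \<alpha>. S f = toeplitz \<alpha> \<mu> f)"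

end

(* For a radial measure the monomials z^b and conj(z)^b are orthogonal in L^2(exp(-|z|^2/\<alpha>) d\<mu>) as well as
   in the Fock space, so expanding the kernel shows that the Toeplitz operator is diagonal in the orthonormal
   basis of normalised monomials e_m, with eigenvalues l_m = integral of |e_m|^2 exp(-|w|^2/\<alpha>) d\<mu>.
   The mean value property, applied to e_m(w + zeta) exp(-zeta conj(w)/\<alpha>) one coordinate at a time, bounds
   |e_m|^2 exp(-|.|^2/\<alpha>) at w by a constant times its integral over the ball B(w,n), whence by Fubini
   l_m <= C * integral of |e_m|^2 exp(-|z|^2/\<alpha>) \<mu>(B(z,n)) dA(z).  Jensen's inequality for the p-th power and
   sum_m |e_m|^2 exp(-|z|^2/\<alpha>) <= 2 then give sum_m l_m^p <= C' * integral of \<mu>(B(z,n))^p dA(z). *)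

theory Submission
  imports Defs "HOL-Probability.Distributions" "HOL-Complex_Analysis.Cauchy_Integral_Formula"
begin

section \<open>Lebesgue measure on the complex plane and on complex n-space\<close>

text \<open>The Toeplitz integral is prescribed on kernels only, so the Schatten operator is built
  independently, as the pointwise convergent series with coefficients l_m <f, e_m>, and afterwards
  compared with the Toeplitz integral on kernels. Every interchange of the kernel expansion with an
  integral rests on the absolute summability of e_m(z) at each point z, together with a bound for
  the l_m that is uniform in m. The factor exp(-zeta conj(w)/\<alpha>) removes the cross term of |w
  + zeta|^2; what is left over from the Gaussian is exp(|zeta|^2/\<alpha>), at most exp(1/\<alpha>)
  on the unit disc. As the disc has area pi, this gives C = (exp(1/\<alpha>)/pi)^n. The radius n
  appears because a product of n unit discs fits into that ball. A power of z and the same power of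
  conj(z) have equal modulus, so size estimates are made for powers of z alone. The sign of an
  exponent matters only for orthogonality, where rotating one coordinate multiplies e_m by a
  character, and for pluriharmonicity.\<close>

lemma lborel_complex_eq_distr:
  "(lborel :: complex measure) = distr lborel borel (\<lambda>x::real^2. Complex (x $ 1) (x $ 2))"
proof (rule lborel_eqI)
  fix l u :: complex assume le: "\<And>b. b \<in> Basis \<Longrightarrow> l \<bullet> b \<le> u \<bullet> b"
  have le': "Re l \<le> Re u" "Im l \<le> Im u" using le[of 1] le[of \<i>] by (auto simp: Basis_complex_def)
  have meas: "(\<lambda>x::real^2. Complex (x $ 1) (x $ 2)) \<in> borel \<rightarrow>\<^sub>M borel"
    by (intro borel_measurable_continuous_onI) (auto intro!: continuous_intros simp: Complex_eq)
  have pre: "(\<lambda>x::real^2. Complex (x $ 1) (x $ 2)) -` box l u = box (vector [Re l, Im l]) (vector [Re u, Im u])"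
    by (auto simp: box_def Basis_complex_def mem_box_cart forall_2 inner_axis Basis_vec_def UNIV_2)
  have B: "(Basis :: (real^2) set) = {axis 1 1, axis 2 1}" by (auto simp: Basis_vec_def UNIV_2)
  have ne: "axis (1::2) (1::real) \<noteq> axis 2 1" by (simp add: axis_eq_axis)
  show "emeasure (distr lborel borel (\<lambda>x::real^2. Complex (x $ 1) (x $ 2))) (box l u) = (\<Prod>b\<in>Basis. (u - l) \<bullet> b)"
    using meas le' ne
    by (subst emeasure_distr)
      (auto simp: pre emeasure_lborel_box_eq B inner_axis Basis_complex_def ennreal_mult)
qed simp

text \<open>Multiplication by \<open>cis \<theta>\<close> is an orthogonal map once the plane is
  identified with \<open>real^2\<close>, and orthogonal maps preserve Lebesgue measure there. Since
  an image measure is computed from preimages, the map \<open>R\<close> used in the proof is the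
  inverse rotation, by the angle -\<theta>.\<close>

lemma lborel_complex_rotate:
  "distr lborel borel (\<lambda>z::complex. cis \<theta> * z) = lborel"
proof (rule lborel_eqI[symmetric])
  fix l u :: complex assume le: "\<And>b. b \<in> Basis \<Longrightarrow> l \<bullet> b \<le> u \<bullet> b"
  define T where "T = (\<lambda>x::real^2. Complex (x $ 1) (x $ 2))"
  define R where "R = (\<lambda>x::real^2. vector [cos \<theta> * x$1 + sin \<theta> * x$2, cos \<theta> * x$2 - sin \<theta> * x$1] :: real^2)"
  have meas: "T \<in> borel \<rightarrow>\<^sub>M borel" unfolding T_def
    by (intro borel_measurable_continuous_onI) (auto intro!: continuous_intros simp: Complex_eq)
  \<comment> \<open>The identity sin^2 + cos^2 = 1 in multiplied-out form, oriented so that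
    rewriting eliminates the products with two sines.\<close>
  have sc: "sin \<theta> * (sin \<theta> * x) = x - cos \<theta> * (cos \<theta> * x)" for x
  proof -
    have "sin \<theta> * (sin \<theta> * x) + cos \<theta> * (cos \<theta> * x) = ((sin \<theta>)\<^sup>2 + (cos \<theta>)\<^sup>2) * x"
      unfolding power2_eq_square distrib_right mult.assoc ..
    then show ?thesis by simp
  qed
  have orth: "orthogonal_transformation R"
    unfolding orthogonal_transformation_def
  proof
    show "linear R" unfolding R_def by (intro linearI) (auto simp: vec_eq_iff forall_2 algebra_simps)
    show "\<forall>v w. R v \<bullet> R w = v \<bullet> w" by (auto simp: R_def inner_vec_def sum_2 algebra_simps sc)
  qed
  have inv: "cis \<theta> * T (R x) = T x" for x
    by (auto simp: T_def R_def complex_eq_iff algebra_simps sc)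
  have inv': "x = R (vector [Re (cis \<theta> * T x), Im (cis \<theta> * T x)])" for x
    by (auto simp: T_def R_def vec_eq_iff forall_2 algebra_simps sc)
  have meas_rot: "(\<lambda>z. cis \<theta> * z) \<in> borel_measurable borel" by simp
  have pre: "(\<lambda>x. cis \<theta> * T x) -` box l u = R ` (T -` box l u)"
  proof safe
    fix x assume "cis \<theta> * T x \<in> box l u"
    moreover have "T (vector [Re (cis \<theta> * T x), Im (cis \<theta> * T x)]) = cis \<theta> * T x"
      by (simp add: T_def complex_eq_iff)
    ultimately show "x \<in> R ` (T -` box l u)" using inv'[of x] by (metis imageI vimageI)
  qed (use inv in auto)
  have boxm: "box l u \<in> sets borel" by simp
  have Tb: "T -` box l u \<in> sets borel" using measurable_sets[OF meas boxm] by simp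
  have eT: "emeasure lborel (T -` box l u) = emeasure lborel (box l u)"
    using meas by (subst lborel_complex_eq_distr) (simp add: emeasure_distr T_def[symmetric])
  have fin: "emeasure lborel (T -` box l u) < \<infinity>" unfolding eT
    by (simp add: emeasure_lborel_box_eq)
  have lm: "T -` box l u \<in> lmeasurable"
    using Tb fin by (auto simp: fmeasurable_def emeasure_completion)
  have RTb: "R ` (T -` box l u) \<in> sets borel"
  proof -
    have "(\<lambda>x. cis \<theta> * T x) \<in> borel \<rightarrow>\<^sub>M borel" using meas by simp
    from measurable_sets[OF this boxm] show ?thesis by (simp add: pre)
  qed
  have lm2: "R ` (T -` box l u) \<in> lmeasurable" by (rule measurable_orthogonal_image[OF orth lm])
  have "emeasure (distr lborel borel (\<lambda>z. cis \<theta> * z)) (box l u)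
      = emeasure lborel ((\<lambda>z. cis \<theta> * z) -` box l u)"
    by (subst emeasure_distr) auto
  also have "\<dots> = emeasure lborel ((\<lambda>x. cis \<theta> * T x) -` box l u)"
    using meas measurable_sets[OF meas_rot boxm]
    by (subst lborel_complex_eq_distr) (simp add: emeasure_distr T_def[symmetric] vimage_def)
  also have "\<dots> = emeasure lebesgue (R ` (T -` box l u))"
    unfolding pre using RTb by (simp add: emeasure_completion)
  also have "\<dots> = measure lebesgue (R ` (T -` box l u))"
    using lm2 by (simp add: emeasure_eq_measure2)
  also have "\<dots> = measure lebesgue (T -` box l u)"
    by (simp add: measure_orthogonal_image[OF orth lm])
  also have "\<dots> = emeasure lborel (T -` box l u)"
    using fin Tb by (simp add: emeasure_eq_ennreal_measure less_top[symmetric])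
  also have "\<dots> = (\<Prod>b\<in>Basis. (u - l) \<bullet> b)" using le
    by (simp add: eT emeasure_lborel_box_eq)
  finally show "emeasure (distr lborel borel (\<lambda>z. cis \<theta> * z)) (box l u) = (\<Prod>b\<in>Basis. (u - l) \<bullet> b)" .
qed simp

text \<open>A disc of radius sqrt a has area pi * a, so |z|^2 has constant density pi on the half
  line. This takes the place of polar coordinates. Both measures are compared on the half lines
  \<open>{..a}\<close>, which are stable under intersection and generate the Borel sets.\<close>

lemma distr_lborel_norm_square:
  "distr lborel borel (\<lambda>z::complex. (norm z)\<^sup>2) = density lborel (\<lambda>t::real. ennreal pi * indicator {0..} t)"
proof (rule measure_eqI_generator_eq[where E="range (\<lambda>a::real. {..a})" and \<Omega>=UNIV and A="\<lambda>i. {..real i}"])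
  show "Int_stable (range (\<lambda>a::real. {..a}))" by (auto simp: Int_stable_def)
  show "sets (distr lborel borel (\<lambda>z::complex. (norm z)\<^sup>2)) = sigma_sets UNIV (range (\<lambda>a::real. {..a}))"
    by (simp add: borel_eq_atMost)
  show "sets (density lborel (\<lambda>t::real. ennreal pi * indicator {0..} t)) = sigma_sets UNIV (range (\<lambda>a::real. {..a}))"
    by (simp add: borel_eq_atMost)
  show "(\<Union>i. {..real i}) = UNIV" using real_arch_simple by auto
  have eq1: "emeasure (distr lborel borel (\<lambda>z::complex. (norm z)\<^sup>2)) {..a} = ennreal (pi * max 0 a)" for a
  proof -
    have "(\<lambda>z::complex. (norm z)\<^sup>2) -` {..a} = (if a < 0 then {} else cball 0 (sqrt a))"
    proof (cases "a < 0")
      case True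
      then show ?thesis by (auto simp: not_le) (smt (verit) zero_le_power2)
    next
      case False
      then show ?thesis by (auto simp: real_le_rsqrt sqrt_ge_absD)
    qed
    then show ?thesis using unit_ball_vol_even[of 1]
      by (subst emeasure_distr) (auto simp: emeasure_cball max_def)
  qed
  have eq2: "emeasure (density lborel (\<lambda>t::real. ennreal pi * indicator {0..} t)) {..a} = ennreal (pi * max 0 a)" for a
  proof -
    have "{0..} \<inter> {..a} = {0..a}" by auto
    then have "(\<integral>\<^sup>+ t. ennreal pi * indicator {0..} t * indicator {..a} t \<partial>lborel) = ennreal pi * emeasure lborel {0..a}"
      by (simp add: mult.assoc nn_integral_cmult indicator_inter_arith[symmetric])
    then show ?thesis by (auto simp: emeasure_density emeasure_lborel_Icc_eq max_def ennreal_mult'[symmetric])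
  qed
  show "emeasure (distr lborel borel (\<lambda>z::complex. (norm z)\<^sup>2)) X =
     emeasure (density lborel (\<lambda>t::real. ennreal pi * indicator {0..} t)) X" if "X \<in> range (\<lambda>a::real. {..a})" for X
    using that eq1 eq2 by auto
  show "emeasure (distr lborel borel (\<lambda>z::complex. (norm z)\<^sup>2)) {..real i} \<noteq> \<infinity>" for i
    using eq1 by simp
qed auto

text \<open>With t = |z|^2 this is pi times a Gamma integral, which the substitution of \<alpha> t
  for t brings to standard form. The value is grouped so that \<open>fact k * \<alpha> ^ k\<close>
  is the squared normalising constant of \<open>fock_factor\<close>.\<close>

lemma nn_integral_complex_gaussian_moment:
  assumes "\<alpha> > 0"
  shows "(\<integral>\<^sup>+ z. ennreal ((norm (z::complex)) ^ (2 * k) * exp (- (norm z)\<^sup>2 / \<alpha>)) \<partial>lborel)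
    = ennreal (pi * \<alpha> * (fact k * \<alpha> ^ k))"
proof -
  have "(\<integral>\<^sup>+ z. ennreal ((norm (z::complex)) ^ (2 * k) * exp (- (norm z)\<^sup>2 / \<alpha>)) \<partial>lborel)
     = (\<integral>\<^sup>+ t. ennreal (t ^ k * exp (- t / \<alpha>)) \<partial>distr lborel borel (\<lambda>z::complex. (norm z)\<^sup>2))"
    by (subst nn_integral_distr) (simp_all add: power_mult)
  also have "\<dots> = (\<integral>\<^sup>+ t. ennreal pi * (ennreal (t ^ k * exp (- t / \<alpha>)) * indicator {0..} t) \<partial>lborel)"
    by (subst distr_lborel_norm_square, subst nn_integral_density) (auto intro!: nn_integral_cong simp: ac_simps)
  also have "\<dots> = ennreal pi * (\<integral>\<^sup>+ t. ennreal (t ^ k * exp (- t / \<alpha>)) * indicator {0..} t \<partial>lborel)"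
    by (subst nn_integral_cmult) auto
  also have "(\<integral>\<^sup>+ t. ennreal (t ^ k * exp (- t / \<alpha>)) * indicator {0..} t \<partial>lborel)
     = ennreal \<bar>\<alpha>\<bar> * (\<integral>\<^sup>+ t. ennreal ((0 + \<alpha> * t) ^ k * exp (- (0 + \<alpha> * t) / \<alpha>)) * indicator {0..} (0 + \<alpha> * t) \<partial>lborel)"
    by (rule nn_integral_real_affine) (use assms in auto)
  also have "(\<integral>\<^sup>+ t. ennreal ((0 + \<alpha> * t) ^ k * exp (- (0 + \<alpha> * t) / \<alpha>)) * indicator {0..} (0 + \<alpha> * t) \<partial>lborel)
     = (\<integral>\<^sup>+ t. ennreal (\<alpha> ^ k) * (ennreal (t ^ k * exp (- t)) * indicator {0..} t) \<partial>lborel)"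
    using assms by (intro nn_integral_cong)
      (auto simp: indicator_def power_mult_distrib ennreal_mult'[symmetric] mult_ac zero_le_mult_iff)
  also have "\<dots> = ennreal (\<alpha> ^ k) * real_of_nat (fact k)"
    by (subst nn_integral_cmult) (auto simp: nn_intergal_power_times_exp_Ici)
  finally show ?thesis using assms by (simp add: ennreal_mult'[symmetric] ennreal_mult''[symmetric] mult_ac)
qed

section \<open>Lebesgue measure on vectors as a product measure\<close>

lemma measurable_vec_lambda_PiM:
  "(\<lambda>f. \<chi> i. f i) \<in> (\<Pi>\<^sub>M i\<in>(UNIV::'n::finite set). (lborel :: 'a::euclidean_space measure)) \<rightarrow>\<^sub>M borel"
proof (rule iffD2[OF borel_measurable_euclidean_space], rule ballI)
  fix b :: "'a^'n" assume "b \<in> Basis"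
  then obtain i u where b: "b = axis i u" by (auto simp: Basis_vec_def)
  have "(\<lambda>f. f i \<bullet> u) \<in> borel_measurable (\<Pi>\<^sub>M i\<in>(UNIV::'n set). (lborel :: 'a measure))"
    by measurable
  then show "(\<lambda>f. (\<chi> i. f i) \<bullet> b) \<in> borel_measurable (\<Pi>\<^sub>M i\<in>(UNIV::'n set). (lborel :: 'a measure))"
    by (simp add: b inner_axis)
qed

interpretation lborel_product: product_sigma_finite "\<lambda>_. lborel" ..

text \<open>Volumes of boxes multiply over the coordinates. The identification lets integrals of
  products of one-coordinate functions factor.\<close>

lemma lborel_vec_eq_distr:
  "(lborel :: ('a::euclidean_space^'n::finite) measure) = distr (\<Pi>\<^sub>M i\<in>UNIV. lborel) borel (\<lambda>f. \<chi> i. f i)"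
proof (rule lborel_eqI)
  fix l u :: "'a^'n" assume le: "\<And>b. b \<in> Basis \<Longrightarrow> l \<bullet> b \<le> u \<bullet> b"
  have le': "l$i \<bullet> b \<le> u$i \<bullet> b" if "b \<in> Basis" for i b
    using le[of "axis i b"] that by (simp add: axis_in_Basis_iff inner_axis)
  have pre: "(\<lambda>f. \<chi> i. f i) -` box l u = (\<Pi>\<^sub>E i\<in>UNIV. box (l$i) (u$i))"
    unfolding box_def Basis_vec_def by (auto simp: inner_axis PiE_def)
  have BV: "(Basis :: ('a^'n) set) = (\<lambda>(i,b). axis i b) ` (UNIV \<times> Basis)"
    by (auto simp: Basis_vec_def)
  have inj: "inj_on (\<lambda>(i,b). axis i b :: 'a^'n) (UNIV \<times> Basis)"
    by (auto simp: inj_on_def axis_eq_axis nonzero_Basis)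
  have "emeasure (distr (\<Pi>\<^sub>M i\<in>UNIV. lborel) borel (\<lambda>f. (\<chi> i. f i) :: 'a^'n)) (box l u)
    = (\<Prod>i\<in>UNIV. emeasure lborel (box (l$i) (u$i)))"
    using measurable_vec_lambda_PiM
    by (subst emeasure_distr) (auto simp: pre space_PiM intro!: lborel_product.emeasure_PiM)
  also have "\<dots> = (\<Prod>i\<in>UNIV. ennreal (\<Prod>b\<in>Basis. (u$i - l$i) \<bullet> b))"
    using le' by (simp add: emeasure_lborel_box_eq)
  also have "\<dots> = ennreal (\<Prod>i\<in>UNIV. \<Prod>b\<in>Basis. (u$i - l$i) \<bullet> b)"
    using le' by (intro prod_ennreal prod_nonneg) (auto simp: inner_diff_left)
  also have "(\<Prod>i\<in>UNIV. \<Prod>b\<in>Basis. (u$i - l$i) \<bullet> b) = (\<Prod>b\<in>Basis. (u - l) \<bullet> b)"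
    unfolding BV prod.reindex[OF inj] prod.cartesian_product
    by (rule prod.cong) (auto simp: inner_axis)
  finally show "emeasure (distr (\<Pi>\<^sub>M i\<in>UNIV. lborel) borel (\<lambda>f. (\<chi> i. f i) :: 'a^'n)) (box l u)
    = (\<Prod>b\<in>Basis. (u - l) \<bullet> b)" .
qed simp

lemma nn_integral_lborel_vec_prod:
  fixes f :: "'n::finite \<Rightarrow> 'a::euclidean_space \<Rightarrow> ennreal"
  assumes [measurable]: "\<And>i. f i \<in> borel_measurable borel"
  shows "(\<integral>\<^sup>+ z. (\<Prod>i\<in>UNIV. f i (z $ i)) \<partial>lborel) = (\<Prod>i\<in>UNIV. \<integral>\<^sup>+ x. f i x \<partial>lborel)"
proof -
  have [measurable]: "(\<lambda>z::'a^'n. z $ i) \<in> borel_measurable borel" for i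
    by (intro borel_measurable_continuous_onI continuous_intros)
  show ?thesis
    using measurable_vec_lambda_PiM
    by (subst lborel_vec_eq_distr, subst nn_integral_distr)
      (auto intro!: lborel_product.product_nn_integral_prod)
qed

lemma integral_lborel_vec_prod:
  fixes f :: "'n::finite \<Rightarrow> 'a::euclidean_space \<Rightarrow> complex"
  assumes int: "\<And>i. integrable lborel (f i)"
  shows "(LINT z|lborel. (\<Prod>i\<in>UNIV. f i (z $ i))) = (\<Prod>i\<in>UNIV. LINT x|lborel. f i x)"
    and "integrable lborel (\<lambda>z. \<Prod>i\<in>UNIV. f i (z $ i))"
proof -
  have [measurable]: "f i \<in> borel_measurable borel" for i using int[of i] by auto
  have [measurable]: "(\<lambda>z::'a^'n. z $ i) \<in> borel_measurable borel" for i
    by (intro borel_measurable_continuous_onI continuous_intros)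
  show "(LINT z|lborel. (\<Prod>i\<in>UNIV. f i (z $ i))) = (\<Prod>i\<in>UNIV. LINT x|lborel. f i x)"
    using measurable_vec_lambda_PiM
    by (subst lborel_vec_eq_distr, subst integral_distr)
      (auto intro!: lborel_product.product_integral_prod int)
  show "integrable lborel (\<lambda>z. \<Prod>i\<in>UNIV. f i (z $ i))"
    using measurable_vec_lambda_PiM
    by (subst lborel_vec_eq_distr, subst integrable_distr_eq)
      (auto intro!: lborel_product.product_integrable_prod int)
qed

section \<open>Mean value inequality for entire functions of one variable\<close>

lemma integral_complex_rotate:
  fixes f :: "complex \<Rightarrow> complex"
  assumes [measurable]: "f \<in> borel_measurable borel"
  shows "(LINT z|lborel. f (cis \<theta> * z)) = (LINT z|lborel. f z)"
  using integral_distr[of "\<lambda>z. cis \<theta> * z" lborel borel f]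
  by (simp add: lborel_complex_rotate)

text \<open>The Taylor series is integrated termwise. For n > 0 the rotation by pi/n preserves the
  disc and changes the sign of z^n, so the integral of z^n equals its own negative; only the
  constant term survives.\<close>

lemma integral_ball_holomorphic:
  assumes hol: "f holomorphic_on UNIV"
  shows "integrable lborel (\<lambda>z. indicator (ball 0 1) z *\<^sub>R f z)"
    and "(LINT z|lborel. indicator (ball 0 1) z *\<^sub>R f z) = of_real pi * f 0"
proof -
  have area: "emeasure lborel (ball (0::complex) 1) = ennreal pi"
    using unit_ball_vol_even[of 1] by (simp add: emeasure_ball)
  have area': "measure lborel (ball (0::complex) 1) = pi" by (simp add: measure_def area)
  define a where "a = (\<lambda>n. (deriv ^^ n) f 0 / fact n)"
  have sums: "(\<lambda>n. a n * z ^ n) sums f z" for z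
    using holomorphic_power_series[of f 0 "norm z + 1" z] holomorphic_on_subset[OF hol] by (auto simp: a_def)
  \<comment> \<open>Convergence at the point 2 forces absolute convergence at 1, which dominates the
    whole series on the unit disc.\<close>
  have suma: "summable (\<lambda>n. norm (a n))"
    using powser_insidea[of a 2 1] sums[of 2] by (auto simp: sums_iff)
  define F where "F = (\<lambda>n z. indicator (ball (0::complex) 1) z *\<^sub>R (a n * z ^ n))"
  have Fm[measurable]: "F n \<in> borel_measurable borel" for n unfolding F_def
    by (intro borel_measurable_scaleR borel_measurable_indicator borel_measurable_continuous_onI continuous_intros) auto
  have Fb: "norm (F n z) \<le> indicator (ball 0 1) z * norm (a n)" for n z
    by (auto simp: F_def indicator_def norm_mult norm_power intro!: mult_left_le power_le_one)
  have indi: "integrable lborel (\<lambda>z::complex. indicator (ball 0 1) z * c)" for c :: real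
    by (intro integrable_mult_left) (auto simp: area)
  have Fi: "integrable lborel (F n)" for n
    by (rule Bochner_Integration.integrable_bound[OF indi[of "norm (a n)"]]) (use Fb in auto)
  have Fint: "(LINT z|lborel. norm (F n z)) \<le> pi * norm (a n)" for n
  proof -
    have "(LINT z|lborel. norm (F n z)) \<le> (LINT z|lborel. indicator (ball (0::complex) 1) z * norm (a n))"
      by (rule integral_mono[OF integrable_norm[OF Fi] indi]) (rule Fb)
    then show ?thesis using area' by simp
  qed
  have Fsumi: "summable (\<lambda>n. LINT z|lborel. norm (F n z))"
    by (rule summable_comparison_test[OF _ summable_mult[OF suma, of pi]])
      (use Fint in \<open>auto intro!: exI[of _ 0] simp: abs_of_nonneg integral_nonneg_AE\<close>)
  have Fs: "summable (\<lambda>n. norm (F n z))" for z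
  proof (rule summable_comparison_test[OF _ suma], intro exI[of _ 0] allI impI)
    fix n
    have "norm (F n z) \<le> 1 * norm (a n)"
      by (rule order_trans[OF Fb mult_right_mono]) (auto simp: indicator_def)
    then show "norm (norm (F n z)) \<le> norm (a n)" by simp
  qed
  have eq: "(\<Sum>n. F n z) = indicator (ball 0 1) z *\<^sub>R f z" for z
    using sums[of z] by (auto simp: F_def indicator_def sums_iff)
  have Fz: "(LINT z|lborel. F n z) = 0" if "n \<noteq> 0" for n
  proof -
    have "cis (pi / real n) ^ n = - 1" using that Complex.DeMoivre[of "pi / real n" n] by simp
    then have "F n (cis (pi / real n) * z) = - F n z" for z
      by (auto simp: F_def indicator_def power_mult_distrib norm_mult)
    then have "(LINT z|lborel. - F n z) = (LINT z|lborel. F n z)"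
      using integral_complex_rotate[of "F n" "pi / real n"] by simp
    then show ?thesis by simp
  qed
  have F0: "(LINT z|lborel. F 0 z) = of_real pi * f 0"
    using area' by (simp add: F_def a_def scaleR_conv_of_real)
  show "integrable lborel (\<lambda>z. indicator (ball 0 1) z *\<^sub>R f z)"
    using integrable_suminf[OF Fi _ Fsumi] Fs by (simp add: eq)
  have "(LINT z|lborel. indicator (ball 0 1) z *\<^sub>R f z) = (\<Sum>n. LINT z|lborel. F n z)"
    using integral_suminf[OF Fi _ Fsumi] Fs by (simp add: eq)
  also have "\<dots> = (LINT z|lborel. F 0 z)"
    using suminf_finite[of "{0}" "\<lambda>n. LINT z|lborel. F n z"] Fz by simp
  finally show "(LINT z|lborel. indicator (ball 0 1) z *\<^sub>R f z) = of_real pi * f 0" by (simp add: F0)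
qed

text \<open>In place of the Cauchy-Schwarz inequality, 2 |f(0)| |f(z)| \<le> |f(0)|^2 + |f(z)|^2 is
  integrated over the disc. The left side is at least 2 pi |f(0)|^2 by the mean value property, and
  pi |f(0)|^2 is subtracted from both sides.\<close>

lemma norm_square_le_integral_ball:
  assumes hol: "f holomorphic_on UNIV"
  shows "ennreal (pi * (norm (f 0))\<^sup>2) \<le> (\<integral>\<^sup>+ z. indicator (ball 0 1) z * ennreal ((norm (f z))\<^sup>2) \<partial>lborel)"
proof -
  let ?D = "ball (0::complex) 1"
  have area: "emeasure lborel ?D = ennreal pi"
    using unit_ball_vol_even[of 1] by (simp add: emeasure_ball)
  have area': "measure lborel ?D = pi" by (simp add: measure_def area)
  have [measurable]: "ball (c::complex) 1 \<in> sets borel" for c by simp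
  have [measurable]: "f \<in> borel_measurable borel"
    using hol by (intro borel_measurable_continuous_onI holomorphic_on_imp_continuous_on)
  \<comment> \<open>The square of f is again entire, so the preceding lemma also yields
    integrability of |f|^2.\<close>
  have int2: "integrable lborel (\<lambda>z. indicator ?D z *\<^sub>R (f z)\<^sup>2)"
    by (rule integral_ball_holomorphic) (intro holomorphic_intros hol)
  from integrable_norm[OF this]
  have I2: "integrable lborel (\<lambda>z. indicator ?D z * (norm (f z))\<^sup>2)"
    by (simp add: norm_power)
  note I1 = integrable_norm[OF integral_ball_holomorphic(1)[OF hol], simplified]
  have indi: "integrable lborel (\<lambda>z. indicator ?D z * c)" for c :: real
    by (intro integrable_mult_left) (auto simp: area)
  note add = Bochner_Integration.integrable_add[OF indi[of "(norm (f 0))\<^sup>2"] I2]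
  have "pi * norm (f 0) = norm (LINT z|lborel. indicator ?D z *\<^sub>R f z)"
    by (simp add: integral_ball_holomorphic[OF hol] norm_mult)
  also have "\<dots> \<le> (LINT z|lborel. indicator ?D z * norm (f z))"
    using integral_norm_bound[of lborel "\<lambda>z. indicator ?D z *\<^sub>R f z"] by simp
  finally have "2 * norm (f 0) * (pi * norm (f 0)) \<le> 2 * norm (f 0) * (LINT z|lborel. indicator ?D z * norm (f z))"
    by (intro mult_left_mono) auto
  also have "\<dots> = (LINT z|lborel. 2 * norm (f 0) * (indicator ?D z * norm (f z)))" by simp
  also have "\<dots> \<le> (LINT z|lborel. indicator ?D z * (norm (f 0))\<^sup>2 + indicator ?D z * (norm (f z))\<^sup>2)"
  proof (rule integral_mono)
    fix z
    show "2 * norm (f 0) * (indicator ?D z * norm (f z)) \<le> indicator ?D z * (norm (f 0))\<^sup>2 + indicator ?D z * (norm (f z))\<^sup>2"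
      using sum_squares_bound[of "norm (f 0)" "norm (f z)"] by (auto simp: indicator_def)
  qed (use I1 add in auto)
  also have "\<dots> = pi * (norm (f 0))\<^sup>2 + (LINT z|lborel. indicator ?D z * (norm (f z))\<^sup>2)"
    using area' by (subst Bochner_Integration.integral_add[OF indi I2]) simp
  finally have "pi * (norm (f 0))\<^sup>2 \<le> (LINT z|lborel. indicator ?D z * (norm (f z))\<^sup>2)"
    by (simp add: power2_eq_square algebra_simps)
  then have "ennreal (pi * (norm (f 0))\<^sup>2) \<le> ennreal (LINT z|lborel. indicator ?D z * (norm (f z))\<^sup>2)"
    by (rule ennreal_leI)
  also have "\<dots> = (\<integral>\<^sup>+ z. ennreal (indicator ?D z * (norm (f z))\<^sup>2) \<partial>lborel)"
    using I2 by (subst nn_integral_eq_integral) auto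
  also have "\<dots> = (\<integral>\<^sup>+ z. indicator ?D z * ennreal ((norm (f z))\<^sup>2) \<partial>lborel)"
    by (intro nn_integral_cong) (auto simp: indicator_def)
  finally show ?thesis .
qed

text \<open>Applies the mean value inequality to \<open>f\<close>, whose exponential factor is
  chosen so that |f(zeta)|^2 exp(-|w|^2/\<alpha>) is the weighted power at w + zeta times
  exp(|zeta|^2/\<alpha>). A direct application to the power alone would leave a factor depending on
  w.\<close>

lemma gaussian_power_le_integral_ball:
  fixes w :: complex
  assumes "\<alpha> > 0"
  shows "ennreal (norm w ^ (2 * m) * exp (- (norm w)\<^sup>2 / \<alpha>))
    \<le> ennreal (exp (1 / \<alpha>) / pi) * (\<integral>\<^sup>+ z. indicator (ball w 1) z * ennreal (norm z ^ (2 * m) * exp (- (norm z)\<^sup>2 / \<alpha>)) \<partial>lborel)"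
proof -
  define f where "f = (\<lambda>\<zeta>. (w + \<zeta>) ^ m * exp (- (\<zeta> * cnj w / of_real \<alpha>)))"
  have hol: "f holomorphic_on UNIV" unfolding f_def by (intro holomorphic_intros) (use assms in auto)
  have fn: "(norm (f z))\<^sup>2 * exp (- (norm w)\<^sup>2 / \<alpha>)
     = norm (w + z) ^ (2 * m) * exp (- (norm (w + z))\<^sup>2 / \<alpha>) * exp ((norm z)\<^sup>2 / \<alpha>)" for z
  proof -
    have e: "(norm (w + z))\<^sup>2 = (norm w)\<^sup>2 + (norm z)\<^sup>2 + 2 * Re (z * cnj w)"
      unfolding cmod_power2 by (simp add: power2_eq_square algebra_simps)
    have "(norm (f z))\<^sup>2 = norm (w + z) ^ (2 * m) * exp (- 2 * Re (z * cnj w) / \<alpha>)"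
      by (simp add: f_def norm_mult norm_power power_mult_distrib norm_exp_eq_Re exp_double[symmetric]
          power_mult[symmetric] mult.commute Re_divide_of_real del: cnj.sel times_complex.sel)
    then show ?thesis
      unfolding e by (simp add: exp_add[symmetric] add_divide_distrib diff_divide_distrib del: times_complex.sel cnj.sel)
  qed
  have le: "indicator (ball 0 1) z * ennreal ((norm (f z))\<^sup>2) * ennreal (exp (- (norm w)\<^sup>2 / \<alpha>))
     \<le> ennreal (exp (1 / \<alpha>)) * (indicator (ball w 1) (w + z) *
         ennreal (norm (w + z) ^ (2 * m) * exp (- (norm (w + z))\<^sup>2 / \<alpha>)))" for z
  proof (cases "z \<in> ball 0 1")
    case True
    have "(norm z)\<^sup>2 \<le> 1" using True by (simp add: power_le_one)
    then have "exp ((norm z)\<^sup>2 / \<alpha>) \<le> exp (1 / \<alpha>)" using assms by (simp add: divide_right_mono)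
    then have "(norm (f z))\<^sup>2 * exp (- (norm w)\<^sup>2 / \<alpha>) \<le>
      exp (1 / \<alpha>) * (norm (w + z) ^ (2 * m) * exp (- (norm (w + z))\<^sup>2 / \<alpha>))"
      unfolding fn by (subst mult.commute) (intro mult_right_mono, auto)
    then show ?thesis using True
      by (auto simp: dist_norm ennreal_mult''[symmetric] ennreal_mult'[symmetric] intro!: ennreal_leI)
  qed auto
  have [measurable]: "ball (c::complex) 1 \<in> sets borel" for c by simp
  have [measurable]: "f \<in> borel_measurable borel"
    using hol by (intro borel_measurable_continuous_onI holomorphic_on_imp_continuous_on)
  have "ennreal (pi * (norm (f 0))\<^sup>2) * ennreal (exp (- (norm w)\<^sup>2 / \<alpha>))
    \<le> (\<integral>\<^sup>+ z. indicator (ball 0 1) z * ennreal ((norm (f z))\<^sup>2) \<partial>lborel) * ennreal (exp (- (norm w)\<^sup>2 / \<alpha>))"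
    by (intro mult_right_mono norm_square_le_integral_ball hol) auto
  also have "\<dots> = (\<integral>\<^sup>+ z. indicator (ball 0 1) z * ennreal ((norm (f z))\<^sup>2) * ennreal (exp (- (norm w)\<^sup>2 / \<alpha>)) \<partial>lborel)"
    by (subst nn_integral_multc) auto
  also have "\<dots> \<le> (\<integral>\<^sup>+ z. ennreal (exp (1 / \<alpha>)) * (indicator (ball w 1) (w + z) *
         ennreal (norm (w + z) ^ (2 * m) * exp (- (norm (w + z))\<^sup>2 / \<alpha>))) \<partial>lborel)"
    by (intro nn_integral_mono le)
  also have "\<dots> = ennreal (exp (1 / \<alpha>)) * (\<integral>\<^sup>+ z. (indicator (ball w 1) (w + z) *
         ennreal (norm (w + z) ^ (2 * m) * exp (- (norm (w + z))\<^sup>2 / \<alpha>))) \<partial>lborel)"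
    by (intro nn_integral_cmult) measurable
  also have "(\<integral>\<^sup>+ z. (indicator (ball w 1) (w + z) *
         ennreal (norm (w + z) ^ (2 * m) * exp (- (norm (w + z))\<^sup>2 / \<alpha>))) \<partial>lborel)
     = (\<integral>\<^sup>+ z. indicator (ball w 1) z * ennreal (norm z ^ (2 * m) * exp (- (norm z)\<^sup>2 / \<alpha>)) \<partial>distr lborel borel ((+) w))"
    by (subst nn_integral_distr) auto
  finally have *: "ennreal (pi * (norm (f 0))\<^sup>2) * ennreal (exp (- (norm w)\<^sup>2 / \<alpha>)) \<le>
     ennreal (exp (1 / \<alpha>)) * (\<integral>\<^sup>+ z. indicator (ball w 1) z * ennreal (norm z ^ (2 * m) * exp (- (norm z)\<^sup>2 / \<alpha>)) \<partial>lborel)"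
    (is "_ \<le> _ * ?J") by (simp add: lborel_distr_plus)
  have f0: "(norm (f 0))\<^sup>2 = norm w ^ (2 * m)" by (simp add: f_def norm_power power_mult mult.commute flip: power_mult)
  have "ennreal (norm w ^ (2 * m) * exp (- (norm w)\<^sup>2 / \<alpha>))
    = ennreal (1 / pi) * (ennreal (pi * (norm (f 0))\<^sup>2) * ennreal (exp (- (norm w)\<^sup>2 / \<alpha>)))"
    by (simp add: f0 ennreal_mult''[symmetric] ennreal_mult'[symmetric])
  also have "\<dots> \<le> ennreal (1 / pi) * (ennreal (exp (1 / \<alpha>)) * ?J)" by (intro mult_left_mono *) auto
  also have "\<dots> = ennreal (exp (1 / \<alpha>) / pi) * ?J"
    by (simp add: mult.assoc[symmetric] ennreal_mult''[symmetric] ennreal_mult'[symmetric])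
  finally show ?thesis .
qed

section \<open>Orthonormal monomials\<close>

text \<open>A negative exponent \<open>k\<close> stands for the power \<open>- k\<close> of the conjugate variable.\<close>

definition fock_factor :: "real \<Rightarrow> int \<Rightarrow> complex \<Rightarrow> complex" where
  "fock_factor \<alpha> k z = (if k \<ge> 0 then z ^ nat k else cnj z ^ nat (- k)) /
     of_real (sqrt (fact (nat \<bar>k\<bar>) * \<alpha> ^ nat \<bar>k\<bar>))"

definition fock_monomial :: "real \<Rightarrow> ('n \<Rightarrow> int) \<Rightarrow> complex^'n \<Rightarrow> complex" where
  "fock_monomial \<alpha> d z = (\<Prod>j\<in>UNIV. fock_factor \<alpha> (d j) (z $ j))"

text \<open>Its Lebesgue integral is \<open>(\<alpha> * pi) ^ CARD('n)\<close>, because the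
  normalising constant of the inner product is left out. Its integral against \<mu> is the
  eigenvalue belonging to the exponent \<open>d\<close>.\<close>

definition fock_weight :: "real \<Rightarrow> ('n \<Rightarrow> int) \<Rightarrow> complex^'n \<Rightarrow> real" where
  "fock_weight \<alpha> d z = (norm (fock_monomial \<alpha> d z))\<^sup>2 * exp (- (norm z)\<^sup>2 / \<alpha>)"

lemma borel_measurable_cnj [measurable]: "cnj \<in> borel_measurable borel"
  by (intro borel_measurable_continuous_onI continuous_intros)

lemma borel_measurable_complex_of_real [measurable]: "complex_of_real \<in> borel_measurable borel"
  by (intro borel_measurable_continuous_onI continuous_intros)

lemma norm_fock_factor_square:
  assumes "\<alpha> > 0"
  shows "(norm (fock_factor \<alpha> k z))\<^sup>2 = norm z ^ (2 * nat \<bar>k\<bar>) / (fact (nat \<bar>k\<bar>) * \<alpha> ^ nat \<bar>k\<bar>)"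
proof -
  have "norm (fock_factor \<alpha> k z) = norm z ^ nat \<bar>k\<bar> / sqrt (fact (nat \<bar>k\<bar>) * \<alpha> ^ nat \<bar>k\<bar>)"
    using assms by (auto simp: fock_factor_def norm_divide norm_power)
  then show ?thesis using assms by (simp add: power_divide power_mult[symmetric] mult.commute)
qed

text \<open>Conjugate powers rotate in the opposite direction, so the signed exponent is exactly the
  character by which a rotation acts. This lets all orthogonality relations be proved in the same
  way, whatever the signs.\<close>

lemma fock_factor_rotate: "fock_factor \<alpha> k (cis \<theta> * z) = cis (of_int k * \<theta>) * fock_factor \<alpha> k z"
  by (auto simp: fock_factor_def power_mult_distrib cis_cnj Complex.DeMoivre)

lemma continuous_on_fock_factor [continuous_intros]:
  "continuous_on S f \<Longrightarrow> continuous_on S (\<lambda>x. fock_factor \<alpha> k (f x))"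
  unfolding fock_factor_def by (cases "k \<ge> 0") (auto simp: divide_inverse intro!: continuous_intros)

lemma borel_measurable_fock_factor [measurable]: "fock_factor \<alpha> k \<in> borel_measurable borel"
  using continuous_on_fock_factor[OF continuous_on_id] by (rule borel_measurable_continuous_onI)

lemma continuous_on_fock_monomial: "continuous_on S (fock_monomial \<alpha> d)"
  unfolding fock_monomial_def by (intro continuous_intros)

lemma borel_measurable_fock_monomial [measurable]: "fock_monomial \<alpha> d \<in> borel_measurable borel"
  using continuous_on_fock_monomial by (rule borel_measurable_continuous_onI)

lemma borel_measurable_fock_weight [measurable]: "fock_weight \<alpha> d \<in> borel_measurable borel"
  unfolding fock_weight_def by measurable

lemma fock_weight_nonneg [simp]: "fock_weight \<alpha> d z \<ge> 0"
  by (simp add: fock_weight_def)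

lemma norm_square_vec: "(norm (z::complex^'n))\<^sup>2 = (\<Sum>j\<in>UNIV. (norm (z $ j))\<^sup>2)"
  by (simp add: norm_vec_def L2_set_def sum_nonneg)

lemma exp_norm_square_vec:
  "exp (- (norm (z::complex^'n))\<^sup>2 / \<alpha>) = (\<Prod>j\<in>UNIV. exp (- (norm (z $ j))\<^sup>2 / \<alpha>))"
  by (simp add: norm_square_vec exp_sum[symmetric] sum_negf sum_divide_distrib)

lemma fock_weight_eq_prod:
  "fock_weight \<alpha> d z = (\<Prod>j\<in>UNIV. (norm (fock_factor \<alpha> (d j) (z $ j)))\<^sup>2 * exp (- (norm (z $ j))\<^sup>2 / \<alpha>))"
  by (simp add: fock_weight_def fock_monomial_def exp_norm_square_vec prod.distrib
      prod_norm[symmetric] prod_power_distrib del: divide_minus_left)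

lemma nn_integral_fock_factor:
  assumes "\<alpha> > 0"
  shows "(\<integral>\<^sup>+ z. ennreal ((norm (fock_factor \<alpha> k z))\<^sup>2 * exp (- (norm z)\<^sup>2 / \<alpha>)) \<partial>lborel) = ennreal (\<alpha> * pi)"
proof -
  let ?c = "fact (nat \<bar>k\<bar>) * \<alpha> ^ nat \<bar>k\<bar>"
  have c: "?c > 0" using assms by simp
  have "(\<integral>\<^sup>+ z. ennreal ((norm (fock_factor \<alpha> k z))\<^sup>2 * exp (- (norm z)\<^sup>2 / \<alpha>)) \<partial>lborel)
    = (\<integral>\<^sup>+ z. ennreal (1 / ?c) * ennreal ((norm (z::complex)) ^ (2 * nat \<bar>k\<bar>) * exp (- (norm z)\<^sup>2 / \<alpha>)) \<partial>lborel)"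
    using c by (intro nn_integral_cong)
      (simp add: norm_fock_factor_square[OF assms] ennreal_mult'[symmetric] del: mult_eq_0_iff)
  also have "\<dots> = ennreal (1 / ?c) * ennreal (pi * \<alpha> * ?c)"
    by (subst nn_integral_cmult) (auto simp: nn_integral_complex_gaussian_moment[OF assms] simp del: divide_minus_left)
  also have "\<dots> = ennreal (\<alpha> * pi)"
    using assms by (simp add: ennreal_mult'[symmetric] field_simps)
  finally show ?thesis .
qed

lemma nn_integral_fock_weight:
  fixes d :: "'n::finite \<Rightarrow> int"
  assumes "\<alpha> > 0"
  shows "(\<integral>\<^sup>+ z. ennreal (fock_weight \<alpha> d z) \<partial>lborel) = ennreal ((\<alpha> * pi) ^ CARD('n))"
proof -
  have "(\<integral>\<^sup>+ z. ennreal (fock_weight \<alpha> d z) \<partial>lborel)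
     = (\<integral>\<^sup>+ z. (\<Prod>j\<in>UNIV. ennreal ((norm (fock_factor \<alpha> (d j) (z $ j)))\<^sup>2 * exp (- (norm (z $ j))\<^sup>2 / \<alpha>))) \<partial>lborel)"
    by (simp add: fock_weight_eq_prod prod_ennreal)
  also have "\<dots> = (\<Prod>j\<in>(UNIV::'n set). ennreal (\<alpha> * pi))"
    by (subst nn_integral_lborel_vec_prod[where f="\<lambda>j z. ennreal ((norm (fock_factor \<alpha> (d j) z))\<^sup>2 * exp (- (norm z)\<^sup>2 / \<alpha>))"])
       (simp_all add: nn_integral_fock_factor[OF assms] del: divide_minus_left)
  also have "\<dots> = ennreal ((\<alpha> * pi) ^ CARD('n))" using assms by (simp add: ennreal_power)
  finally show ?thesis .
qed

lemma integrable_fock_weight: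
  assumes "\<alpha> > 0"
  shows "integrable lborel (fock_weight \<alpha> d)"
  using nn_integral_fock_weight[OF assms, of d]
  by (intro integrableI_bounded) auto

text \<open>The weight factors over the coordinates, so the one-variable bounds multiply and produce
  an integral over a product of unit discs. That product lies in the ball of radius
  \<open>CARD('n)\<close>, because the Euclidean norm is at most the sum of the n coordinate norms,
  each less than 1.\<close>

lemma fock_weight_le_integral_ball:
  fixes d :: "'n::finite \<Rightarrow> int"
  assumes "\<alpha> > 0"
  shows "ennreal (fock_weight \<alpha> d w) \<le> ennreal ((exp (1 / \<alpha>) / pi) ^ CARD('n)) *
    (\<integral>\<^sup>+ z. indicator (ball w CARD('n)) z * ennreal (fock_weight \<alpha> d z) \<partial>lborel)"
proof -
  define g where "g = (\<lambda>k z. (norm (fock_factor \<alpha> k z))\<^sup>2 * exp (- (norm z)\<^sup>2 / \<alpha>))"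
  have g0: "g k z \<ge> 0" for k z by (simp add: g_def)
  have [measurable]: "g k \<in> borel_measurable borel" for k unfolding g_def by measurable
  have [measurable]: "ball (c::complex) 1 \<in> sets borel" for c by simp
  have [measurable]: "ball (c::complex^'n) r \<in> sets borel" for c r by simp
  have one: "ennreal (g k u) \<le> ennreal (exp (1 / \<alpha>) / pi) * (\<integral>\<^sup>+ z. indicator (ball u 1) z * ennreal (g k z) \<partial>lborel)" for k u
  proof -
    let ?c = "fact (nat \<bar>k\<bar>) * \<alpha> ^ nat \<bar>k\<bar>"
    have c: "?c > 0" using assms by simp
    have ge: "ennreal (g k z) = ennreal (1 / ?c) * ennreal (norm z ^ (2 * nat \<bar>k\<bar>) * exp (- (norm z)\<^sup>2 / \<alpha>))" for z
      using c by (simp add: g_def norm_fock_factor_square[OF assms] ennreal_mult'[symmetric] del: mult_eq_0_iff)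
    have "ennreal (g k u) \<le> ennreal (1 / ?c) * (ennreal (exp (1 / \<alpha>) / pi) * (\<integral>\<^sup>+ z. indicator (ball u 1) z * ennreal (norm z ^ (2 * nat \<bar>k\<bar>) * exp (- (norm z)\<^sup>2 / \<alpha>)) \<partial>lborel))"
      unfolding ge by (intro mult_left_mono gaussian_power_le_integral_ball assms) auto
    also have "\<dots> = ennreal (exp (1 / \<alpha>) / pi) * (ennreal (1 / ?c) * (\<integral>\<^sup>+ z. indicator (ball u 1) z * ennreal (norm z ^ (2 * nat \<bar>k\<bar>) * exp (- (norm z)\<^sup>2 / \<alpha>)) \<partial>lborel))"
      by (simp add: ac_simps)
    also have "ennreal (1 / ?c) * (\<integral>\<^sup>+ z. indicator (ball u 1) z * ennreal (norm z ^ (2 * nat \<bar>k\<bar>) * exp (- (norm z)\<^sup>2 / \<alpha>)) \<partial>lborel)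
      = (\<integral>\<^sup>+ z. indicator (ball u 1) z * ennreal (g k z) \<partial>lborel)"
      unfolding ge by (subst nn_integral_cmult[symmetric]) (auto simp: ac_simps)
    finally show ?thesis .
  qed
  have "ennreal (fock_weight \<alpha> d w) = (\<Prod>j\<in>UNIV. ennreal (g (d j) (w $ j)))"
    by (simp add: fock_weight_eq_prod prod_ennreal g_def)
  also have "\<dots> \<le> (\<Prod>j\<in>UNIV. ennreal (exp (1 / \<alpha>) / pi) * (\<integral>\<^sup>+ z. indicator (ball (w $ j) 1) z * ennreal (g (d j) z) \<partial>lborel))"
    by (intro prod_mono_ennreal one)
  also have "\<dots> = ennreal ((exp (1 / \<alpha>) / pi) ^ CARD('n)) *
      (\<Prod>j\<in>UNIV. \<integral>\<^sup>+ z. indicator (ball (w $ j) 1) z * ennreal (g (d j) z) \<partial>lborel)"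
    by (simp add: prod.distrib ennreal_power)
  also have "(\<Prod>j\<in>UNIV. \<integral>\<^sup>+ z. indicator (ball (w $ j) 1) z * ennreal (g (d j) z) \<partial>lborel)
     = (\<integral>\<^sup>+ z. (\<Prod>j\<in>UNIV. indicator (ball (w $ j) 1) (z $ j) * ennreal (g (d j) (z $ j))) \<partial>lborel)"
    by (subst nn_integral_lborel_vec_prod[where f="\<lambda>j z. indicator (ball (w $ j) 1) z * ennreal (g (d j) z)"]) auto
  also have "\<dots> \<le> (\<integral>\<^sup>+ z. indicator (ball w CARD('n)) z * ennreal (fock_weight \<alpha> d z) \<partial>lborel)"
  proof (rule nn_integral_mono)
    fix z :: "complex^'n"
    show "(\<Prod>j\<in>UNIV. indicator (ball (w $ j) 1) (z $ j) * ennreal (g (d j) (z $ j)))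
      \<le> indicator (ball w CARD('n)) z * ennreal (fock_weight \<alpha> d z)"
    proof (cases "\<forall>j. z $ j \<in> ball (w $ j) 1")
      case True
      have "norm (w - z) \<le> (\<Sum>j\<in>UNIV. norm ((w - z) $ j))"
        unfolding norm_vec_def by (rule L2_set_le_sum) auto
      also have "\<dots> < (\<Sum>j\<in>(UNIV::'n set). 1)"
        using True by (intro sum_strict_mono) (auto simp: dist_norm)
      finally have "z \<in> ball w CARD('n)" by (simp add: dist_norm)
      then show ?thesis using True
        by (simp add: fock_weight_eq_prod prod_ennreal g_def)
    next
      case False
      then obtain j where "z $ j \<notin> ball (w $ j) 1" by auto
      then have "(\<Prod>j\<in>UNIV. indicator (ball (w $ j) 1) (z $ j) * ennreal (g (d j) (z $ j))) = 0"
        by (intro prod_zero bexI[of _ j]) simp_all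
      then show ?thesis by (simp only: zero_le)
    qed
  qed
  finally show ?thesis by (simp add: mult_left_mono)
qed

section \<open>Orthogonality by rotation\<close>

lemma fock_factor_orthogonal:
  assumes "\<alpha> > 0"
  shows "integrable lborel (\<lambda>z. fock_factor \<alpha> k z * cnj (fock_factor \<alpha> l z) * of_real (exp (- (norm z)\<^sup>2 / \<alpha>)))"
    and "k \<noteq> l \<Longrightarrow> (LINT z|lborel. fock_factor \<alpha> k z * cnj (fock_factor \<alpha> l z) * of_real (exp (- (norm z)\<^sup>2 / \<alpha>))) = 0"
proof -
  define f where "f = (\<lambda>z. fock_factor \<alpha> k z * cnj (fock_factor \<alpha> l z) * of_real (exp (- (norm z)\<^sup>2 / \<alpha>)))"
  define g where "g = (\<lambda>k z. (norm (fock_factor \<alpha> k z))\<^sup>2 * exp (- (norm z)\<^sup>2 / \<alpha>))"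
  have [measurable]: "f \<in> borel_measurable borel" unfolding f_def by measurable
  have gi: "integrable lborel (g k)" for k
    using nn_integral_fock_factor[OF assms, of k] unfolding g_def by (intro integrableI_bounded) auto
  have bd: "norm (f z) \<le> g k z + g l z" for z
  proof -
    have "norm (fock_factor \<alpha> k z) * norm (fock_factor \<alpha> l z)
      \<le> (norm (fock_factor \<alpha> k z))\<^sup>2 + (norm (fock_factor \<alpha> l z))\<^sup>2"
      using sum_squares_bound[of "norm (fock_factor \<alpha> k z)" "norm (fock_factor \<alpha> l z)"]
        mult_nonneg_nonneg[OF norm_ge_zero norm_ge_zero, of "fock_factor \<alpha> k z" "fock_factor \<alpha> l z"] by linarith
    then show ?thesis
      by (simp add: f_def g_def norm_mult distrib_right[symmetric] mult_right_mono)
  qed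
  show "integrable lborel f"
    by (rule Bochner_Integration.integrable_bound[OF Bochner_Integration.integrable_add[OF gi[of k] gi[of l]]])
      (auto intro!: AE_I2 order_trans[OF bd] simp: g_def)
  show "(LINT z|lborel. f z) = 0" if "k \<noteq> l"
  proof -
    \<comment> \<open>The integrand is multiplied by cis((k - l) \<theta>) under rotation by
      \<theta>; this angle makes the factor -1.\<close>
    define \<theta> where "\<theta> = pi / of_int (k - l)"
    have "cis (of_int k * \<theta>) * cis (- (of_int l * \<theta>)) = cis ((of_int k - of_int l) * \<theta>)"
      by (simp add: cis_mult algebra_simps)
    also have "(of_int k - of_int l) * \<theta> = pi" using that by (simp add: \<theta>_def)
    finally have c: "cis (of_int k * \<theta>) * cis (- (of_int l * \<theta>)) = -1" by simp
    have "f (cis \<theta> * z) = (cis (of_int k * \<theta>) * cis (- (of_int l * \<theta>))) * f z" for z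
      by (simp add: f_def fock_factor_rotate cis_cnj norm_mult)
    then have "(LINT z|lborel. - f z) = (LINT z|lborel. f z)"
      using integral_complex_rotate[of f \<theta>] c by simp
    then show ?thesis by simp
  qed
qed

lemma fock_monomial_orthogonal_lborel:
  fixes d d' :: "'n::finite \<Rightarrow> int"
  assumes "\<alpha> > 0"
  shows "(LINT z|lborel. fock_monomial \<alpha> d z * cnj (fock_monomial \<alpha> d' z) * of_real (exp (- (norm z)\<^sup>2 / \<alpha>)))
    = (if d = d' then of_real ((\<alpha> * pi) ^ CARD('n)) else 0)"
proof (cases "d = d'")
  case True
  have "(LINT z|lborel. fock_monomial \<alpha> d z * cnj (fock_monomial \<alpha> d' z) * of_real (exp (- (norm z)\<^sup>2 / \<alpha>)))
    = (LINT z|lborel. complex_of_real (fock_weight \<alpha> d z))"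
    by (simp add: True fock_weight_def complex_norm_square del: of_real_power)
  also have "\<dots> = of_real ((\<alpha> * pi) ^ CARD('n))"
    using nn_integral_fock_weight[OF assms, of d] assms
    by (simp add: integral_eq_nn_integral)
  finally show ?thesis using True by simp
next
  case False
  then obtain j where j: "d j \<noteq> d' j" by auto
  have "(LINT z|lborel. fock_monomial \<alpha> d z * cnj (fock_monomial \<alpha> d' z) * of_real (exp (- (norm z)\<^sup>2 / \<alpha>)))
   = (LINT z|lborel. (\<Prod>j\<in>UNIV. fock_factor \<alpha> (d j) (z $ j) * cnj (fock_factor \<alpha> (d' j) (z $ j)) * of_real (exp (- (norm (z $ j))\<^sup>2 / \<alpha>))))"
    by (simp add: fock_monomial_def exp_norm_square_vec prod.distrib del: divide_minus_left)
  also have "\<dots> = (\<Prod>j\<in>UNIV. LINT x|lborel. fock_factor \<alpha> (d j) x * cnj (fock_factor \<alpha> (d' j) x) * of_real (exp (- (norm x)\<^sup>2 / \<alpha>)))"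
    by (rule integral_lborel_vec_prod(1)) (rule fock_factor_orthogonal(1)[OF assms])
  also have "\<dots> = 0"
    using fock_factor_orthogonal(2)[OF assms j] by (intro prod_zero) auto
  finally show ?thesis using False by simp
qed

text \<open>Radiality speaks of images while \<open>distr\<close> takes preimages; hence the unitary
  matrix \<open>U\<close> is diagonal with the inverse rotation \<open>cis (-\<theta>)\<close> in
  place j.\<close>

lemma distr_radial_coordinate_rotation:
  fixes \<mu> :: "(complex^'n) measure"
  assumes "radial_measure \<mu>" and s: "sets \<mu> = sets borel"
  shows "distr \<mu> borel (\<lambda>z. \<chi> i. (if i = j then cis \<theta> else 1) * z $ i) = \<mu>"
proof (rule measure_eqI)
  show "sets (distr \<mu> borel (\<lambda>z. \<chi> i. (if i = j then cis \<theta> else 1) * z $ i)) = sets \<mu>" using s by simp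
  fix E assume "E \<in> sets (distr \<mu> borel (\<lambda>z. \<chi> i. (if i = j then cis \<theta> else 1) * z $ i))"
  then have E: "E \<in> sets borel" by simp
  define U :: "complex^'n^'n" where "U = (\<chi> i k. if i = k then (if i = j then cis (-\<theta>) else 1) else 0)"
  have U: "U *v z = (\<chi> i. (if i = j then cis (-\<theta>) else 1) * z $ i)" for z
    by (simp add: U_def matrix_vector_mult_def vec_eq_iff if_distrib[of "\<lambda>x. x * _"] sum.delta cong: if_cong)
  have un: "unitary U"
    by (auto simp: unitary_def U_def matrix_matrix_mult_def vec_eq_iff mat_def cis_cnj cis_mult
        if_distrib[of "\<lambda>x. x * _"] if_distrib[of cnj] if_distrib[of "\<lambda>x. _ * x"] sum.delta cong: if_cong)
  have pre: "(\<lambda>z. \<chi> i. (if i = j then cis \<theta> else 1) * z $ i) -` E = (\<lambda>z. U *v z) ` E"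
  proof safe
    fix z :: "complex^'n" assume a: "(\<chi> i. (if i = j then cis \<theta> else 1) * z $ i) \<in> E"
    have "z = U *v (\<chi> i. (if i = j then cis \<theta> else 1) * z $ i)"
      by (simp add: U vec_eq_iff mult.assoc[symmetric] cis_mult)
    then show "z \<in> (\<lambda>z. U *v z) ` E" using a by blast
  next
    fix z assume "z \<in> E"
    moreover have "(\<chi> i. (if i = j then cis \<theta> else 1) * (U *v z) $ i) = z"
      by (simp add: U vec_eq_iff mult.assoc[symmetric] cis_mult)
    ultimately show "U *v z \<in> (\<lambda>z. \<chi> i. (if i = j then cis \<theta> else 1) * z $ i) -` E" by simp
  qed
  have m: "(\<lambda>z::complex^'n. \<chi> i. (if i = j then cis \<theta> else 1) * z $ i) \<in> borel_measurable borel"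
    by (intro borel_measurable_continuous_onI continuous_intros)
  have "emeasure (distr \<mu> borel (\<lambda>z. \<chi> i. (if i = j then cis \<theta> else 1) * z $ i)) E = emeasure \<mu> ((\<lambda>z. U *v z) ` E)"
    using E m s by (subst emeasure_distr) (auto simp: pre measurable_def space_borel sets_eq_imp_space_eq[OF s])
  also have "\<dots> = emeasure \<mu> E" using assms(1) un E unfolding radial_measure_def by blast
  finally show "emeasure (distr \<mu> borel (\<lambda>z. \<chi> i. (if i = j then cis \<theta> else 1) * z $ i)) E = emeasure \<mu> E" .
qed

text \<open>A radial measure is in general not a product, so the integral cannot be split by
  coordinates as for Lebesgue measure. Instead one coordinate in which the exponents differ is
  rotated: this preserves \<mu> and the Gaussian and changes the sign of the integrand.\<close>

lemma fock_monomial_orthogonal_radial: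
  fixes \<mu> :: "(complex^'n) measure"
  assumes "radial_measure \<mu>" and s: "sets \<mu> = sets borel" and "d \<noteq> d'"
  shows "(LINT z|\<mu>. fock_monomial \<alpha> d z * cnj (fock_monomial \<alpha> d' z) * of_real (exp (- (norm z)\<^sup>2 / \<alpha>))) = 0"
proof -
  obtain j where j: "d j \<noteq> d' j" using assms by auto
  define f where "f = (\<lambda>z. fock_monomial \<alpha> d z * cnj (fock_monomial \<alpha> d' z) * of_real (exp (- (norm z)\<^sup>2 / \<alpha>)))"
  define \<theta> where "\<theta> = pi / of_int (d j - d' j)"
  define R where "R = (\<lambda>z::complex^'n. (\<chi> i. (if i = j then cis \<theta> else 1) * z $ i) :: complex^'n)"
  have [measurable]: "f \<in> borel_measurable borel" unfolding f_def by measurable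
  have Rm: "R \<in> measurable \<mu> borel" unfolding R_def measurable_cong_sets[OF s refl]
    by (intro borel_measurable_continuous_onI continuous_intros)
  have "cis (of_int (d j) * \<theta>) * cis (- (of_int (d' j) * \<theta>)) = cis ((of_int (d j) - of_int (d' j)) * \<theta>)"
    by (simp add: cis_mult algebra_simps)
  also have "(of_int (d j) - of_int (d' j)) * \<theta> = pi" using j by (simp add: \<theta>_def)
  finally have c: "cis (of_int (d j) * \<theta>) * cis (- (of_int (d' j) * \<theta>)) = -1" by simp
  have fR: "fock_monomial \<alpha> e (R z) = cis (of_int (e j) * \<theta>) * fock_monomial \<alpha> e z" for e z
  proof -
    have "fock_monomial \<alpha> e (R z) = (\<Prod>i\<in>UNIV. (if i = j then cis (of_int (e j) * \<theta>) else 1) * fock_factor \<alpha> (e i) (z $ i))"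
      unfolding fock_monomial_def by (intro prod.cong) (auto simp: R_def fock_factor_rotate)
    then show ?thesis by (simp add: prod.distrib fock_monomial_def)
  qed
  have nR: "norm (R z) = norm z" for z
    unfolding norm_vec_def by (rule arg_cong2[where f=L2_set]) (auto simp: R_def norm_mult)
  have "f (R z) = (cis (of_int (d j) * \<theta>) * cis (- (of_int (d' j) * \<theta>))) * f z" for z
    by (simp add: f_def fR nR cis_cnj mult_ac)
  then have "f (R z) = - f z" for z using c by simp
  moreover have "(LINT z|\<mu>. f z) = (LINT z|\<mu>. f (R z))"
    using integral_distr[OF Rm, of f] distr_radial_coordinate_rotation[OF assms(1) s, of j \<theta>] by (simp add: R_def)
  ultimately have "(LINT z|\<mu>. f z) = 0" by simp
  then show ?thesis unfolding f_def .
qed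

section \<open>Expansion of the kernel\<close>

text \<open>Finitely many functions on a finite set take values in a finite set \<open>B\<close>, so
  a finite partial sum is bounded by the sum over all functions into \<open>B\<close>. That sum
  factors into finite sums, each bounded by the corresponding infinite sum.\<close>

lemma abs_summable_on_prod_fun:
  fixes f :: "'n::finite \<Rightarrow> 'b \<Rightarrow> complex"
  assumes f: "\<And>j. (\<lambda>k. norm (f j k)) summable_on UNIV"
  shows "(\<lambda>d. norm (\<Prod>j\<in>UNIV. f j (d j))) summable_on UNIV"
proof (rule nonneg_bdd_above_summable_on)
  show "bdd_above (sum (\<lambda>d. norm (\<Prod>j\<in>UNIV. f j (d j))) ` {F. F \<subseteq> UNIV \<and> finite F})"
  proof (rule bdd_aboveI2)
    fix F :: "('n \<Rightarrow> 'b) set" assume "F \<in> {F. F \<subseteq> UNIV \<and> finite F}"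
    then have F: "finite F" by simp
    define B where "B = (\<Union>d\<in>F. range d)"
    have B: "finite B" using F by (auto simp: B_def)
    have sub: "F \<subseteq> PiE UNIV (\<lambda>_. B)" by (auto simp: B_def)
    have "(\<Sum>d\<in>F. norm (\<Prod>j\<in>UNIV. f j (d j))) \<le> (\<Sum>d\<in>PiE UNIV (\<lambda>_. B). norm (\<Prod>j\<in>UNIV. f j (d j)))"
      by (rule sum_mono2) (use B sub in \<open>auto intro!: finite_PiE\<close>)
    also have "\<dots> = (\<Prod>j\<in>UNIV. \<Sum>k\<in>B. norm (f j k))"
      using B by (simp add: prod_sum_PiE prod_norm)
    also have "\<dots> \<le> (\<Prod>j\<in>UNIV. infsum (\<lambda>k. norm (f j k)) UNIV)"
      by (intro prod_mono conjI sum_nonneg finite_sum_le_infsum f B) auto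
    finally show "(\<Sum>d\<in>F. norm (\<Prod>j\<in>UNIV. f j (d j))) \<le> (\<Prod>j\<in>UNIV. infsum (\<lambda>k. norm (f j k)) UNIV)" .
  qed
qed auto

lemma has_sum_prod_fun:
  fixes f :: "'n::finite \<Rightarrow> 'b \<Rightarrow> complex"
  assumes f: "\<And>j. (\<lambda>k. norm (f j k)) summable_on UNIV" and s: "\<And>j. (f j has_sum s j) UNIV"
  shows "((\<lambda>d. \<Prod>j\<in>UNIV. f j (d j)) has_sum (\<Prod>j\<in>UNIV. s j)) UNIV"
proof -
  have "infsum (\<lambda>d. \<Prod>j\<in>UNIV. f j (d j)) (PiE UNIV (\<lambda>_. UNIV)) = (\<Prod>j\<in>UNIV. infsum (f j) UNIV)"
    by (rule infsum_prod_PiE_abs) (use f in auto)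
  then have "infsum (\<lambda>d. \<Prod>j\<in>UNIV. f j (d j)) UNIV = (\<Prod>j\<in>UNIV. s j)"
    using infsumI[OF s] by simp
  moreover have "(\<lambda>d. \<Prod>j\<in>UNIV. f j (d j)) summable_on UNIV"
    by (rule abs_summable_summable[OF abs_summable_on_prod_fun]) (rule f)
  ultimately show ?thesis by (metis has_sum_infsum)
qed

text \<open>The factors have the square root of a factorial in the denominator, so they are not
  terms of an exponential series. Writing x as (2^m x) (1/2)^m and using 2ab \<le> a^2 + b^2 bounds
  them by an exponential series in 4 |z|^2/\<alpha> plus a geometric series of ratio 1/4.\<close>

lemma abs_summable_on_fock_factor:
  assumes "\<alpha> > 0"
  shows "(\<lambda>k. norm (fock_factor \<alpha> k z)) summable_on UNIV"
proof -
  define h :: "nat \<Rightarrow> real" where "h = (\<lambda>m. (4 * (norm z)\<^sup>2 / \<alpha>) ^ m / fact m + (1 / 4) ^ m)"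
  have h0: "h m \<ge> 0" for m using assms by (simp add: h_def)
  have "summable (\<lambda>m. (4 * (norm z)\<^sup>2 / \<alpha>) ^ m / fact m)"
    using summable_exp[of "4 * (norm z)\<^sup>2 / \<alpha>"] unfolding divide_inverse by (simp only: mult.commute)
  then have "summable h" unfolding h_def by (rule summable_add) (rule summable_geometric, simp)
  then have hs: "h summable_on UNIV" using h0 by (simp add: summable_on_UNIV_nonneg_real_iff)
  have bd: "norm (fock_factor \<alpha> k z) \<le> h (nat \<bar>k\<bar>)" for k
  proof -
    define m where "m = nat \<bar>k\<bar>"
    have n2: "(norm (fock_factor \<alpha> k z))\<^sup>2 = ((norm z)\<^sup>2 / \<alpha>) ^ m / fact m"
      by (simp add: norm_fock_factor_square[OF assms] m_def power_divide power_mult[symmetric])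
    have "(2 ^ m * norm (fock_factor \<alpha> k z))\<^sup>2 = 4 ^ m * (norm (fock_factor \<alpha> k z))\<^sup>2"
      by (simp add: power_mult_distrib) (simp add: power2_eq_square flip: power_mult_distrib)
    also have "\<dots> = (4 * (norm z)\<^sup>2 / \<alpha>) ^ m / fact m"
      by (simp add: n2 power_mult_distrib power_divide)
    finally have a: "(2 ^ m * norm (fock_factor \<alpha> k z))\<^sup>2 = (4 * (norm z)\<^sup>2 / \<alpha>) ^ m / fact m" .
    have b: "((1 / 2 :: real) ^ m)\<^sup>2 = (1 / 4) ^ m"
      by (simp add: power2_eq_square flip: power_mult_distrib)
    have c: "2 ^ m * norm (fock_factor \<alpha> k z) * (1 / 2) ^ m = norm (fock_factor \<alpha> k z)"
      by (simp add: power_divide)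
    have "norm (fock_factor \<alpha> k z) \<le> 2 * norm (fock_factor \<alpha> k z)" by simp
    also have "\<dots> \<le> h m"
      using sum_squares_bound[of "2 ^ m * norm (fock_factor \<alpha> k z)" "(1 / 2) ^ m"]
      unfolding a b h_def mult.assoc[of 2] c by simp
    finally show ?thesis by (simp add: m_def)
  qed
  \<comment> \<open>The integers are covered by two copies of the naturals. The overlap at 0 is
    harmless, as only summability is claimed.\<close>
  have "(\<lambda>k. h (nat \<bar>k\<bar>)) summable_on range int"
    using hs by (subst summable_on_reindex) (auto simp: o_def inj_on_def)
  moreover have "(\<lambda>k. h (nat \<bar>k\<bar>)) summable_on range (\<lambda>m. - int m)"
    using hs by (subst summable_on_reindex) (auto simp: o_def inj_on_def)
  ultimately have "(\<lambda>k. h (nat \<bar>k\<bar>)) summable_on (range int \<union> range (\<lambda>m. - int m))"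
    by (rule summable_on_union)
  also have "range int \<union> range (\<lambda>m. - int m) = UNIV"
    by (auto intro: int_cases2)
  finally show ?thesis
    by (rule Infinite_Sum.abs_summable_on_comparison_test') (rule bd)
qed

lemma abs_summable_on_fock_monomial:
  fixes z :: "complex^'n"
  assumes "\<alpha> > 0"
  shows "(\<lambda>d. norm (fock_monomial \<alpha> d z)) summable_on UNIV"
  unfolding fock_monomial_def
  by (rule abs_summable_on_prod_fun[where f="\<lambda>j k. fock_factor \<alpha> k (z $ j)"])
    (rule abs_summable_on_fock_factor[OF assms])

text \<open>The exponential of a sum over coordinates is a product of exponential series, and
  multiplying these out indexes the terms by exponent vectors. For nonpositive exponents the
  monomials are conjugated, which exchanges the roles of z and w.\<close>

lemma exp_hdot_has_sum:
  fixes z w :: "complex^'n"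
  assumes "\<alpha> > 0"
  shows "((\<lambda>d. fock_monomial \<alpha> d z * cnj (fock_monomial \<alpha> d w)) has_sum exp (hdot z w / of_real \<alpha>)) {d. \<forall>j. d j \<ge> 0}"
    and "((\<lambda>d. fock_monomial \<alpha> d z * cnj (fock_monomial \<alpha> d w)) has_sum exp (hdot w z / of_real \<alpha>)) {d. \<forall>j. d j \<le> 0}"
proof -
  have sq: "complex_of_real (sqrt x) * complex_of_real (sqrt x) = of_real x" if "x \<ge> 0" for x
    using that by (simp flip: of_real_mult)
  have main: "((\<lambda>\<beta>::'n \<Rightarrow> nat. \<Prod>j\<in>UNIV. x j ^ \<beta> j / of_real (fact (\<beta> j) * \<alpha> ^ \<beta> j)) has_sum exp ((\<Sum>j\<in>UNIV. x j) / of_real \<alpha>)) UNIV" for x :: "'n \<Rightarrow> complex"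
  proof -
    have e: "x ^ m / of_real (fact m * \<alpha> ^ m) = (x / of_real \<alpha>) ^ m /\<^sub>R fact m" for x :: complex and m
      by (simp add: power_divide scaleR_conv_of_real field_simps)
    have a: "(\<lambda>m. norm (x ^ m / of_real (fact m * \<alpha> ^ m))) summable_on UNIV" for x :: complex
      unfolding e using summable_norm_exp[of "x / of_real \<alpha>"] by (simp add: summable_on_UNIV_nonneg_real_iff)
    have b: "((\<lambda>m. x ^ m / of_real (fact m * \<alpha> ^ m)) has_sum exp (x / of_real \<alpha>)) UNIV" for x :: complex
      unfolding e by (rule norm_summable_imp_has_sum[OF summable_norm_exp exp_converges])
    show ?thesis
      using has_sum_prod_fun[of "\<lambda>j m. x j ^ m / of_real (fact m * \<alpha> ^ m)", OF a b]
      by (simp add: exp_sum sum_divide_distrib)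
  qed
  have "((\<lambda>\<beta>::'n \<Rightarrow> nat. fock_monomial \<alpha> (\<lambda>j. int (\<beta> j)) z * cnj (fock_monomial \<alpha> (\<lambda>j. int (\<beta> j)) w))
    has_sum exp (hdot z w / of_real \<alpha>)) UNIV"
    using main[of "\<lambda>j. z $ j * cnj (w $ j)"] assms
    by (simp add: fock_monomial_def fock_factor_def prod.distrib[symmetric] hdot_def power_mult_distrib sq)
  then show "((\<lambda>d. fock_monomial \<alpha> d z * cnj (fock_monomial \<alpha> d w)) has_sum exp (hdot z w / of_real \<alpha>)) {d. \<forall>j. d j \<ge> 0}"
    by (subst has_sum_reindex_bij_betw[symmetric, where A=UNIV and g="\<lambda>\<beta> j. int (\<beta> j)"])
      (auto intro: bij_betw_byWitness[where f'="\<lambda>d j. nat (d j)"])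
  have fm: "fock_factor \<alpha> (- int m) u = cnj u ^ m / of_real (sqrt (fact m * \<alpha> ^ m))" for m u
    by (simp add: fock_factor_def)
  have "((\<lambda>\<beta>::'n \<Rightarrow> nat. fock_monomial \<alpha> (\<lambda>j. - int (\<beta> j)) z * cnj (fock_monomial \<alpha> (\<lambda>j. - int (\<beta> j)) w))
    has_sum exp (hdot w z / of_real \<alpha>)) UNIV"
    using main[of "\<lambda>j. w $ j * cnj (z $ j)"] assms
    by (simp add: fock_monomial_def fm prod.distrib[symmetric] hdot_def power_mult_distrib sq mult.commute)
  then show "((\<lambda>d. fock_monomial \<alpha> d z * cnj (fock_monomial \<alpha> d w)) has_sum exp (hdot w z / of_real \<alpha>)) {d. \<forall>j. d j \<le> 0}"
    by (subst has_sum_reindex_bij_betw[symmetric, where A=UNIV and g="\<lambda>\<beta> j. - int (\<beta> j)"])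
      (auto intro: bij_betw_byWitness[where f'="\<lambda>d j. nat (- d j)"])
qed

text \<open>Monomials whose exponents have mixed signs are orthonormal as well, but not pluriharmonic.\<close>

definition fock_exponents :: "('n \<Rightarrow> int) set" where
  "fock_exponents = {d. (\<forall>j. d j \<ge> 0) \<or> (\<forall>j. d j \<le> 0)}"

text \<open>Convergence by \<open>sums\<close> and the Schmidt form are indexed by natural numbers,
  so the countably infinite set of admissible exponents is enumerated in an arbitrary order.\<close>

definition fock_index :: "nat \<Rightarrow> 'n::finite \<Rightarrow> int" where
  "fock_index = from_nat_into fock_exponents"

definition fock_basis :: "real \<Rightarrow> nat \<Rightarrow> complex^'n \<Rightarrow> complex" where
  "fock_basis \<alpha> m = fock_monomial \<alpha> (fock_index m)"

lemma bij_betw_fock_index: "bij_betw fock_index UNIV (fock_exponents :: ('n::finite \<Rightarrow> int) set)"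
  unfolding fock_index_def
proof (rule bij_betw_from_nat_into)
  have "inj (\<lambda>m j. int m :: int)" by (auto simp: inj_on_def fun_eq_iff)
  then have "infinite (range (\<lambda>m (j::'n). int m))" by (rule range_inj_infinite)
  moreover have "range (\<lambda>m (j::'n). int m) \<subseteq> fock_exponents" by (auto simp: fock_exponents_def)
  ultimately show "infinite (fock_exponents :: ('n \<Rightarrow> int) set)" by (metis finite_subset)
qed (rule countableI_type)

lemma fock_index_eq_iff [simp]: "fock_index i = (fock_index j :: 'n::finite \<Rightarrow> int) \<longleftrightarrow> i = j"
  using bij_betw_fock_index[where 'n='n] by (auto simp: bij_betw_def inj_on_def)

text \<open>The nonnegative and the nonpositive exponents share only the zero vector, whose term is
  1. Counting it once accounts for the -1 in the kernel.\<close>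

lemma ph_kernel_sums:
  fixes z w :: "complex^'n"
  assumes "\<alpha> > 0"
  shows "(\<lambda>m. fock_basis \<alpha> m z * cnj (fock_basis \<alpha> m w)) sums ph_kernel \<alpha> z w"
proof -
  define F where "F = (\<lambda>d. fock_monomial \<alpha> d z * cnj (fock_monomial \<alpha> d w))"
  have "(F has_sum 1) {\<lambda>_. 0}"
    by (rule has_sum_finiteI) (auto simp: F_def fock_monomial_def fock_factor_def)
  then have "(F has_sum (exp (hdot w z / of_real \<alpha>) - 1)) ({d. \<forall>j. d j \<le> 0} - {\<lambda>_. 0})"
    using exp_hdot_has_sum(2)[OF assms, of z w] unfolding F_def by (intro has_sum_Diff) auto
  then have "(F has_sum (exp (hdot z w / of_real \<alpha>) + (exp (hdot w z / of_real \<alpha>) - 1)))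
      ({d. \<forall>j. d j \<ge> 0} \<union> ({d. \<forall>j. d j \<le> 0} - {\<lambda>_. 0}))"
    using exp_hdot_has_sum(1)[OF assms, of z w] unfolding F_def
    by (intro has_sum_Un_disjoint) (auto simp: fun_eq_iff intro: antisym)
  also have "{d. \<forall>j. d j \<ge> 0} \<union> ({d. \<forall>j. d j \<le> 0} - {\<lambda>_. 0}) = (fock_exponents :: ('n \<Rightarrow> int) set)"
    by (auto simp: fock_exponents_def)
  finally have "((\<lambda>m. F (fock_index m)) has_sum ph_kernel \<alpha> z w) UNIV"
    unfolding has_sum_reindex_bij_betw[OF bij_betw_fock_index] by (simp add: ph_kernel_def add_diff_eq)
  then show ?thesis using has_sum_imp_sums by (force simp: F_def fock_basis_def)
qed

lemma summable_norm_fock_basis: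
  fixes z :: "complex^'n"
  assumes "\<alpha> > 0"
  shows "summable (\<lambda>m. norm (fock_basis \<alpha> m z))"
proof -
  have "(\<lambda>d. norm (fock_monomial \<alpha> d z)) summable_on fock_exponents"
    using abs_summable_on_fock_monomial[OF assms] by (rule summable_on_subset) simp
  then have "(\<lambda>m. norm (fock_basis \<alpha> m z)) summable_on UNIV"
    unfolding fock_basis_def using summable_on_reindex_bij_betw[OF bij_betw_fock_index, of "\<lambda>d. norm (fock_monomial \<alpha> d z)"] by simp
  then show ?thesis by (rule summable_on_imp_summable)
qed

text \<open>On the diagonal the kernel is 2 exp(|z|^2/\<alpha>) - 1, so the weights sum to 2 -
  exp(-|z|^2/\<alpha>).\<close>

lemma suminf_fock_weight_le:
  fixes z :: "complex^'n"
  assumes "\<alpha> > 0"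
  shows "(\<Sum>m. ennreal (fock_weight \<alpha> (fock_index m) z)) \<le> 2"
proof -
  have h: "hdot z z = of_real ((norm z)\<^sup>2)"
    by (simp add: hdot_def norm_square_vec complex_norm_square del: of_real_power)
  have "ph_kernel \<alpha> z z = of_real (2 * exp ((norm z)\<^sup>2 / \<alpha>) - 1)"
    unfolding ph_kernel_def h of_real_divide[symmetric] exp_of_real by simp
  then have "(\<lambda>m. complex_of_real ((norm (fock_basis \<alpha> m z))\<^sup>2)) sums of_real (2 * exp ((norm z)\<^sup>2 / \<alpha>) - 1)"
    using ph_kernel_sums[OF assms, of z z] by (simp add: complex_norm_square del: of_real_power)
  then have "(\<lambda>m. (norm (fock_basis \<alpha> m z))\<^sup>2) sums (2 * exp ((norm z)\<^sup>2 / \<alpha>) - 1)"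
    by (simp only: sums_of_real_iff)
  from sums_mult2[OF this, of "exp (- (norm z)\<^sup>2 / \<alpha>)"]
  have "(\<lambda>m. fock_weight \<alpha> (fock_index m) z) sums ((2 * exp ((norm z)\<^sup>2 / \<alpha>) - 1) * exp (- (norm z)\<^sup>2 / \<alpha>))"
    by (simp add: fock_weight_def fock_basis_def)
  then have "(\<Sum>m. ennreal (fock_weight \<alpha> (fock_index m) z)) = ennreal ((2 * exp ((norm z)\<^sup>2 / \<alpha>) - 1) * exp (- (norm z)\<^sup>2 / \<alpha>))"
    by (intro suminf_ennreal_eq) auto
  also have "\<dots> \<le> ennreal 2"
    by (intro ennreal_leI) (simp add: exp_minus field_simps)
  finally show ?thesis by simp
qed

section \<open>Summability of the eigenvalues\<close>

text \<open>A convex function lies above its tangents. At x = 0, treated apart, the tangent has the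
  value (1 - p) L^p, which is not positive.\<close>

lemma powr_ge_tangent:
  fixes x L p :: real
  assumes "x \<ge> 0" "L > 0" "p \<ge> 1"
  shows "x powr p \<ge> L powr p + p * L powr (p - 1) * (x - L)"
proof (cases "x = 0")
  case True
  have "L powr (p - 1) * L = L powr p" using assms powr_mult_base[of L "p - 1"] by (simp add: mult.commute)
  then have "L powr p + p * L powr (p - 1) * (x - L) = (1 - p) * L powr p"
    using True by (simp add: algebra_simps)
  also have "\<dots> \<le> 0" using assms by (simp add: mult_nonpos_nonneg)
  finally show ?thesis using True by simp
next
  case False
  then have x: "x > 0" using assms by simp
  have "x powr p - L powr p \<ge> p * L powr (p - 1) * (x - L)"
    using powr_convex[OF assms(3)]
    by (rule convex_on_imp_above_tangent)
      (use assms x in \<open>auto simp: connected_iff_interval interior_open intro!: derivative_eq_intros\<close>)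
  then show ?thesis by simp
qed

lemma fock_weight_sum_le:
  fixes z :: "complex^'n"
  assumes "\<alpha> > 0"
  shows "(\<Sum>m<k. fock_weight \<alpha> (fock_index m) z) \<le> 2"
proof -
  have "ennreal (\<Sum>m<k. fock_weight \<alpha> (fock_index m) z) = (\<Sum>m<k. ennreal (fock_weight \<alpha> (fock_index m) z))"
    by (simp add: sum_ennreal)
  also have "\<dots> \<le> (\<Sum>m. ennreal (fock_weight \<alpha> (fock_index m) z))"
    by (rule sum_le_suminf) auto
  also have "\<dots> \<le> ennreal 2" using suminf_fock_weight_le[OF assms] by simp
  finally show ?thesis by (subst (asm) ennreal_le_iff) auto
qed

lemma fock_weight_le:
  fixes z :: "complex^'n"
  assumes "\<alpha> > 0"
  shows "fock_weight \<alpha> (fock_index m) z \<le> 2"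
proof -
  have "fock_weight \<alpha> (fock_index m) z \<le> (\<Sum>k<Suc m. fock_weight \<alpha> (fock_index k) z)"
    by (simp add: sum_nonneg)
  then show ?thesis using fock_weight_sum_le[OF assms, where k="Suc m" and z=z] by linarith
qed

lemma sigma_finite_measure_if_finite_on_balls:
  fixes \<mu> :: "'a::real_normed_vector measure"
  assumes s: "sets \<mu> = sets borel" and fin: "\<And>r. emeasure \<mu> (ball 0 r) < \<infinity>"
  shows "sigma_finite_measure \<mu>"
proof
  show "\<exists>A. countable A \<and> A \<subseteq> sets \<mu> \<and> \<Union>A = space \<mu> \<and> (\<forall>a\<in>A. emeasure \<mu> a \<noteq> \<infinity>)"
  proof (intro exI[of _ "range (\<lambda>n::nat. ball 0 (real n))"] conjI ballI)
    show "\<Union>(range (\<lambda>n::nat. ball (0::'a) (real n))) = space \<mu>"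
      using sets_eq_imp_space_eq[OF s] by (auto simp: reals_Archimedean2)
    fix a assume "a \<in> range (\<lambda>n::nat. ball (0::'a) (real n))"
    then show "emeasure \<mu> a \<noteq> \<infinity>" using fin by (auto simp: less_top)
  qed (simp_all add: s image_subset_iff)
qed

lemma nn_integral_fock_weight_le:
  fixes \<mu> :: "(complex^'n) measure"
  assumes \<alpha>: "\<alpha> > 0" and s[measurable_cong]: "sets \<mu> = sets borel"
    and fin: "\<And>z r. emeasure \<mu> (ball z r) < \<infinity>"
  shows "(\<integral>\<^sup>+ w. ennreal (fock_weight \<alpha> d w) \<partial>\<mu>) \<le> ennreal ((exp (1 / \<alpha>) / pi) ^ CARD('n)) *
    (\<integral>\<^sup>+ z. ennreal (fock_weight \<alpha> d z * measure \<mu> (ball z CARD('n))) \<partial>lborel)"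
proof -
  let ?c = "ennreal ((exp (1 / \<alpha>) / pi) ^ CARD('n))" and ?r = "real CARD('n)"
  interpret sigma_finite_measure \<mu> by (rule sigma_finite_measure_if_finite_on_balls[OF s fin])
  interpret P: pair_sigma_finite "lborel :: (complex^'n) measure" \<mu> ..
  \<comment> \<open>Written with \<open>dist\<close>, the indicator is visibly jointly measurable in
    w and z, as needed for Fubini, and symmetric in them.\<close>
  have ind: "indicator (ball w ?r) z = (if dist w z < ?r then 1 else 0 :: ennreal)" for w z :: "complex^'n"
    by (simp add: indicator_def)
  have m[measurable]: "(\<lambda>(z, w). indicator (ball w ?r) z * ennreal (fock_weight \<alpha> d z)) \<in> borel_measurable (lborel \<Otimes>\<^sub>M \<mu>)"
    unfolding ind by measurable
  have "(\<integral>\<^sup>+ w. ennreal (fock_weight \<alpha> d w) \<partial>\<mu>)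
    \<le> (\<integral>\<^sup>+ w. ?c * (\<integral>\<^sup>+ z. indicator (ball w ?r) z * ennreal (fock_weight \<alpha> d z) \<partial>lborel) \<partial>\<mu>)"
    by (intro nn_integral_mono fock_weight_le_integral_ball[OF \<alpha>])
  also have "\<dots> = ?c * (\<integral>\<^sup>+ w. (\<integral>\<^sup>+ z. indicator (ball w ?r) z * ennreal (fock_weight \<alpha> d z) \<partial>lborel) \<partial>\<mu>)"
    by (rule nn_integral_cmult) (unfold ind, measurable)
  also have "(\<integral>\<^sup>+ w. (\<integral>\<^sup>+ z. indicator (ball w ?r) z * ennreal (fock_weight \<alpha> d z) \<partial>lborel) \<partial>\<mu>)
    = (\<integral>\<^sup>+ z. (\<integral>\<^sup>+ w. indicator (ball w ?r) z * ennreal (fock_weight \<alpha> d z) \<partial>\<mu>) \<partial>lborel)"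
    using P.Fubini'[OF m] by simp
  also have "\<dots> = (\<integral>\<^sup>+ z. ennreal (fock_weight \<alpha> d z * measure \<mu> (ball z ?r)) \<partial>lborel)"
  proof (rule nn_integral_cong)
    fix z :: "complex^'n"
    have "(\<integral>\<^sup>+ w. indicator (ball w ?r) z * ennreal (fock_weight \<alpha> d z) \<partial>\<mu>)
      = (\<integral>\<^sup>+ w. indicator (ball z ?r) w \<partial>\<mu>) * ennreal (fock_weight \<alpha> d z)"
      by (subst nn_integral_multc[symmetric]) (auto simp: indicator_def dist_commute s intro!: nn_integral_cong borel_measurable_indicator)
    also have "(\<integral>\<^sup>+ w. indicator (ball z ?r) w \<partial>\<mu>) = ennreal (measure \<mu> (ball z ?r))"
      using fin[of z ?r] s by (simp add: emeasure_eq_ennreal_measure less_top[symmetric])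
    finally show "(\<integral>\<^sup>+ w. indicator (ball w ?r) z * ennreal (fock_weight \<alpha> d z) \<partial>\<mu>)
      = ennreal (fock_weight \<alpha> d z * measure \<mu> (ball z ?r))"
      by (simp add: ennreal_mult mult.commute)
  qed
  finally show ?thesis .
qed

lemma fock_weight_integrable_powr_summable:
  fixes \<mu> :: "(complex^'n) measure"
  assumes \<alpha>: "\<alpha> > 0" and p: "p \<ge> 1" and s[measurable_cong]: "sets \<mu> = sets borel"
    and fin: "\<And>z r. emeasure \<mu> (ball z r) < \<infinity>"
    and int: "integrable lborel (\<lambda>z. measure \<mu> (ball z CARD('n)) powr p)"
  shows "integrable \<mu> (fock_weight \<alpha> (fock_index m))"
    and "summable (\<lambda>m. (LINT w|\<mu>. fock_weight \<alpha> (fock_index m) w) powr p)"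
proof -
  define M where "M = (\<lambda>z. measure \<mu> (ball z CARD('n)))"
  define N where "N = (\<alpha> * pi) ^ CARD('n)"
  define c where "c = (exp (1 / \<alpha>) / pi) ^ CARD('n)"
  \<comment> \<open>\<open>B m / N\<close> and \<open>Q m / N\<close> are the means of M and of its
    p-th power for the probability density given by the weight divided by its total mass
    \<open>N\<close>. The eigenvalue will be at most \<open>c * B m\<close>, that is,
    \<open>c * N\<close> times the mean of M.\<close>
  define B where "B = (\<lambda>m. LINT z|lborel. fock_weight \<alpha> (fock_index m) z * M z)"
  define Q where "Q = (\<lambda>m. LINT z|lborel. fock_weight \<alpha> (fock_index m) z * M z powr p)"
  have M0: "M z \<ge> 0" for z by (simp add: M_def)
  have N0: "N > 0" using \<alpha> by (simp add: N_def)
  have c0: "c > 0" by (simp add: c_def)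
  have intM: "integrable lborel (\<lambda>z. M z powr p)" using int by (simp add: M_def)
  \<comment> \<open>Only the p-th power of M is known to be measurable; taking the p-th root
    transfers this to M itself.\<close>
  have "M z = (M z powr p) powr (1 / p)" for z using M0[of z] p by (simp add: powr_powr)
  then have "M = (\<lambda>z. (M z powr p) powr (1 / p))" by auto
  moreover have "(\<lambda>z. (M z powr p) powr (1 / p)) \<in> borel_measurable borel"
    using borel_measurable_integrable[OF intM] by simp
  ultimately have Mm[measurable]: "M \<in> borel_measurable borel" by simp
  have Wi: "integrable lborel (fock_weight \<alpha> (fock_index m :: 'n \<Rightarrow> int))" for m
    by (rule integrable_fock_weight[OF \<alpha>])
  have WN: "(LINT z|lborel. fock_weight \<alpha> (fock_index m :: 'n \<Rightarrow> int) z) = N" for m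
    using nn_integral_fock_weight[OF \<alpha>, of "fock_index m :: 'n \<Rightarrow> int"] N0
    by (simp add: integral_eq_nn_integral N_def)
  have WP: "integrable lborel (\<lambda>z. fock_weight \<alpha> (fock_index m) z * M z powr p)" for m
  proof (rule Bochner_Integration.integrable_bound[OF integrable_mult_right[OF intM, of 2]])
    show "AE z in lborel. norm (fock_weight \<alpha> (fock_index m) z * M z powr p) \<le> norm (2 * M z powr p)"
      by (intro AE_I2) (simp add: abs_mult mult_right_mono fock_weight_le[OF \<alpha>])
  qed measurable
  \<comment> \<open>Since the weight is integrable as well as its product with M^p, this bound makes
    the product with M integrable.\<close>
  have Mle: "M z \<le> 1 + M z powr p" for z
  proof (cases "M z \<le> 1")
    case False
    then have "M z powr 1 \<le> M z powr p" using p by (intro powr_mono) auto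
    then show ?thesis using False by simp
  qed (simp add: add_increasing2)
  have WM: "integrable lborel (\<lambda>z. fock_weight \<alpha> (fock_index m) z * M z)" for m
  proof (rule Bochner_Integration.integrable_bound[OF Bochner_Integration.integrable_add[OF Wi[of m] WP[of m]]])
    have "fock_weight \<alpha> (fock_index m) z * M z \<le> fock_weight \<alpha> (fock_index m) z + fock_weight \<alpha> (fock_index m) z * M z powr p" for z
      using mult_left_mono[OF Mle[of z] fock_weight_nonneg[of \<alpha> "fock_index m" z]] by (simp add: distrib_left)
    then show "AE z in lborel. norm (fock_weight \<alpha> (fock_index m) z * M z)
      \<le> norm (fock_weight \<alpha> (fock_index m) z + fock_weight \<alpha> (fock_index m) z * M z powr p)"
      by (intro AE_I2) (simp add: abs_mult M0 abs_of_nonneg)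
  qed measurable
  have nn: "(\<integral>\<^sup>+ w. ennreal (fock_weight \<alpha> (fock_index m) w) \<partial>\<mu>) \<le> ennreal (c * B m)" for m
  proof -
    have "(\<integral>\<^sup>+ z. ennreal (fock_weight \<alpha> (fock_index m) z * M z) \<partial>lborel) = ennreal (B m)"
      unfolding B_def by (rule nn_integral_eq_integral[OF WM]) (simp add: M0)
    then have "(\<integral>\<^sup>+ w. ennreal (fock_weight \<alpha> (fock_index m) w) \<partial>\<mu>) \<le> ennreal c * ennreal (B m)"
      using nn_integral_fock_weight_le[OF \<alpha> s fin, of "fock_index m"] by (simp add: M_def c_def)
    then show ?thesis using c0 by (simp add: ennreal_mult'[symmetric])
  qed
  show Wmu: "integrable \<mu> (fock_weight \<alpha> (fock_index m))" for m
    using nn[of m] by (intro integrableI_bounded) (auto simp: le_less_trans)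
  have B0: "B m \<ge> 0" for m unfolding B_def by (intro integral_nonneg_AE AE_I2) (simp add: M0)
  have L0: "(LINT w|\<mu>. fock_weight \<alpha> (fock_index m) w) \<ge> 0" for m
    by (intro integral_nonneg_AE AE_I2) simp
  have Lle: "(LINT w|\<mu>. fock_weight \<alpha> (fock_index m) w) \<le> c * B m" for m
    using nn[of m] c0 B0[of m] by (subst (asm) nn_integral_eq_integral[OF Wmu]) (auto simp: ennreal_le_iff)
  text \<open>Jensen's inequality for the probability density \<open>fock_weight / N\<close>, via the tangent line at the mean.\<close>
  have jensen: "N * (B m / N) powr p \<le> Q m" for m
  proof (cases "B m = 0")
    case True
    then show ?thesis unfolding Q_def by (auto intro!: integral_nonneg_AE AE_I2)
  next
    case False
    define L where "L = B m / N"
    have L: "L > 0" using False B0[of m] N0 by (simp add: L_def)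
    let ?k = "p * L powr (p - 1)"
    have "N * L powr p = (L powr p - ?k * L) * N + ?k * B m"
      using N0 by (simp add: L_def field_simps)
    also have "\<dots> = (LINT z|lborel. (L powr p - ?k * L) * fock_weight \<alpha> (fock_index m) z + ?k * (fock_weight \<alpha> (fock_index m) z * M z))"
      using Wi WM by (subst Bochner_Integration.integral_add) (auto simp: WN B_def)
    also have "\<dots> \<le> Q m" unfolding Q_def
    proof (rule integral_mono)
      fix z
      have "fock_weight \<alpha> (fock_index m) z * (L powr p + ?k * (M z - L)) \<le> fock_weight \<alpha> (fock_index m) z * M z powr p"
        using powr_ge_tangent[OF M0 L p, of z] by (intro mult_left_mono) auto
      then show "(L powr p - ?k * L) * fock_weight \<alpha> (fock_index m) z + ?k * (fock_weight \<alpha> (fock_index m) z * M z)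
        \<le> fock_weight \<alpha> (fock_index m) z * M z powr p"
        by (simp add: algebra_simps)
    qed (use WM Wi WP in auto)
    finally show ?thesis by (simp add: L_def)
  qed
  have bd: "(LINT w|\<mu>. fock_weight \<alpha> (fock_index m) w) powr p \<le> (c * N) powr p / N * Q m" for m
  proof -
    have "(LINT w|\<mu>. fock_weight \<alpha> (fock_index m) w) powr p \<le> (c * B m) powr p"
      using Lle L0 p by (intro powr_mono2) auto
    also have "\<dots> = (c * N) powr p * (B m / N) powr p"
      using c0 N0 B0[of m] by (simp flip: powr_mult)
    also have "\<dots> \<le> (c * N) powr p * (Q m / N)"
      using jensen[of m] N0 by (intro mult_left_mono) (simp_all add: field_simps)
    finally show ?thesis by simp
  qed
  have Q0: "Q m \<ge> 0" for m unfolding Q_def by (auto intro!: integral_nonneg_AE AE_I2)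
  have "summable Q"
  proof (rule summableI_nonneg_bounded[OF Q0])
    fix k
    have "(\<Sum>m<k. Q m) = (LINT z|lborel. (\<Sum>m<k. fock_weight \<alpha> (fock_index m) z * M z powr p))"
      unfolding Q_def by (rule Bochner_Integration.integral_sum[symmetric]) (rule WP)
    also have "\<dots> \<le> (LINT z|lborel. 2 * M z powr p)"
    proof (rule integral_mono)
      show "(\<Sum>m<k. fock_weight \<alpha> (fock_index m) z * M z powr p) \<le> 2 * M z powr p" for z
        unfolding sum_distrib_right[symmetric] by (intro mult_right_mono fock_weight_sum_le[OF \<alpha>]) auto
    qed (use WP intM in auto)
    finally show "(\<Sum>m<k. Q m) \<le> (LINT z|lborel. 2 * M z powr p)" .
  qed
  from summable_mult[OF this, of "(c * N) powr p / N"]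
  show "summable (\<lambda>m. (LINT w|\<mu>. fock_weight \<alpha> (fock_index m) w) powr p)"
    by (rule summable_comparison_test[rotated]) (use bd in auto)
qed

section \<open>Pluriharmonicity of power series\<close>

definition multi_power :: "('n::finite \<Rightarrow> nat) \<Rightarrow> complex^'n \<Rightarrow> complex" where
  "multi_power \<beta> z = (\<Prod>j\<in>UNIV. z $ j ^ \<beta> j)"

text \<open>The exponents \<open>\<beta> n\<close> may repeat: termwise differentiation then keeps the index set.\<close>

definition power_series :: "(nat \<Rightarrow> complex) \<Rightarrow> (nat \<Rightarrow> 'n::finite \<Rightarrow> nat) \<Rightarrow> complex^'n \<Rightarrow> complex" where
  "power_series c \<beta> z = (\<Sum>n. c n * multi_power (\<beta> n) z)"

text \<open>Absolute convergence with a uniform majorant on every polydisc centred at 0. Only the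
  total degree enters, which keeps the condition easy to pass on to derivatives.\<close>

definition entire_coeffs :: "(nat \<Rightarrow> complex) \<Rightarrow> (nat \<Rightarrow> 'n::finite \<Rightarrow> nat) \<Rightarrow> bool" where
  "entire_coeffs c \<beta> \<longleftrightarrow> (\<forall>R\<ge>0. summable (\<lambda>n. norm (c n) * R ^ (\<Sum>j\<in>UNIV. \<beta> n j)))"

abbreviation deriv_coeffs :: "'n::finite \<Rightarrow> (nat \<Rightarrow> complex) \<Rightarrow> (nat \<Rightarrow> 'n \<Rightarrow> nat) \<Rightarrow> nat \<Rightarrow> complex" where
  "deriv_coeffs i c \<beta> \<equiv> (\<lambda>n. c n * of_nat (\<beta> n i))"

text \<open>The subtraction is truncated: where the exponent is already 0 it stays 0, and the
  matching coefficient in \<open>deriv_coeffs\<close> vanishes.\<close>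

abbreviation deriv_exps :: "'n::finite \<Rightarrow> (nat \<Rightarrow> 'n \<Rightarrow> nat) \<Rightarrow> nat \<Rightarrow> 'n \<Rightarrow> nat" where
  "deriv_exps i \<beta> \<equiv> (\<lambda>n. (\<beta> n)(i := \<beta> n i - 1))"

lemma has_derivative_multi_power:
  "(multi_power \<beta> has_derivative (\<lambda>v. \<Sum>i\<in>UNIV. v $ i * (of_nat (\<beta> i) * multi_power (\<beta>(i := \<beta> i - 1)) z))) (at z)"
proof -
  have p: "multi_power (\<beta>(i := \<beta> i - 1)) z = z $ i ^ (\<beta> i - 1) * (\<Prod>j\<in>UNIV - {i}. z $ j ^ \<beta> j)" for i
    unfolding multi_power_def by (subst prod.remove[of UNIV i]) (auto intro!: prod.cong)
  have nth: "((\<lambda>z::complex^'a. z $ i) has_derivative (\<lambda>v. v $ i)) (at z)" for i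
    by (rule bounded_linear_imp_has_derivative[OF bounded_linear_vec_nth])
  have "((\<lambda>z. \<Prod>j\<in>UNIV. z $ j ^ \<beta> j) has_derivative
     (\<lambda>v. \<Sum>i\<in>UNIV. (of_nat (\<beta> i) * v $ i * z $ i ^ (\<beta> i - 1)) * (\<Prod>j\<in>UNIV - {i}. z $ j ^ \<beta> j))) (at z)"
    by (intro has_derivative_prod has_derivative_power nth)
  then show ?thesis unfolding p unfolding multi_power_def[abs_def] by (simp add: mult_ac)
qed

lemma norm_multi_power_le:
  assumes "norm z \<le> R"
  shows "norm (multi_power \<beta> z) \<le> R ^ (\<Sum>j\<in>UNIV. \<beta> j)"
proof -
  have "norm (z $ j) \<le> R" for j using assms Finite_Cartesian_Product.norm_nth_le[of z j] by linarith
  then show ?thesis unfolding multi_power_def power_sum prod_norm[symmetric] norm_power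
    by (intro prod_mono conjI power_mono) auto
qed

lemma entire_coeffs_sums:
  assumes "entire_coeffs c \<beta>"
  shows "summable (\<lambda>n. norm (c n * multi_power (\<beta> n) z))"
    and "(\<lambda>n. c n * multi_power (\<beta> n) z) sums power_series c \<beta> z"
proof -
  have "summable (\<lambda>n. norm (c n) * norm z ^ (\<Sum>j\<in>UNIV. \<beta> n j))"
    using assms by (simp add: entire_coeffs_def)
  then show *: "summable (\<lambda>n. norm (c n * multi_power (\<beta> n) z))"
    by (rule summable_comparison_test[rotated])
      (auto simp: norm_mult intro!: mult_left_mono norm_multi_power_le)
  show "(\<lambda>n. c n * multi_power (\<beta> n) z) sums power_series c \<beta> z"
    unfolding power_series_def by (rule summable_sums[OF summable_norm_cancel[OF *]])
qed

text \<open>The factor \<open>\<beta> n i\<close> produced by differentiation is at most 2 to the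
  total degree, so it is absorbed by doubling the radius.\<close>

lemma entire_coeffs_deriv:
  assumes "entire_coeffs c \<beta>"
  shows "entire_coeffs (deriv_coeffs i c \<beta>) (deriv_exps i \<beta>)"
  unfolding entire_coeffs_def
proof safe
  fix R :: real assume R: "R \<ge> 0"
  \<comment> \<open>With a base of at least 1, powers increase with the exponent, so the lowered
    degree can be replaced by the original one.\<close>
  define Q where "Q = max 1 R"
  have Q: "Q \<ge> 1" "R \<le> Q" by (auto simp: Q_def)
  have bd: "norm (deriv_coeffs i c \<beta> n) * R ^ (\<Sum>j\<in>UNIV. deriv_exps i \<beta> n j)
    \<le> norm (c n) * (2 * Q) ^ (\<Sum>j\<in>UNIV. \<beta> n j)" for n
  proof -
    have le: "(\<Sum>j\<in>UNIV. deriv_exps i \<beta> n j) \<le> (\<Sum>j\<in>UNIV. \<beta> n j)" by (intro sum_mono) auto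
    have "R ^ (\<Sum>j\<in>UNIV. deriv_exps i \<beta> n j) \<le> Q ^ (\<Sum>j\<in>UNIV. deriv_exps i \<beta> n j)"
      using R Q by (intro power_mono)
    also have "\<dots> \<le> Q ^ (\<Sum>j\<in>UNIV. \<beta> n j)" using Q le by (intro power_increasing)
    finally have a: "R ^ (\<Sum>j\<in>UNIV. deriv_exps i \<beta> n j) \<le> Q ^ (\<Sum>j\<in>UNIV. \<beta> n j)" .
    have "\<beta> n i \<le> (\<Sum>j\<in>UNIV. \<beta> n j)" by (rule member_le_sum) auto
    also have "(\<Sum>j\<in>UNIV. \<beta> n j) \<le> 2 ^ (\<Sum>j\<in>UNIV. \<beta> n j)" by (simp add: less_imp_le)
    finally have "real (\<beta> n i) \<le> 2 ^ (\<Sum>j\<in>UNIV. \<beta> n j)"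
      by (metis of_nat_le_iff of_nat_numeral of_nat_power)
    then have "real (\<beta> n i) * R ^ (\<Sum>j\<in>UNIV. deriv_exps i \<beta> n j) \<le> 2 ^ (\<Sum>j\<in>UNIV. \<beta> n j) * Q ^ (\<Sum>j\<in>UNIV. \<beta> n j)"
      using a R by (intro mult_mono) auto
    then show ?thesis
      by (simp add: norm_mult power_mult_distrib mult.assoc mult_left_mono)
  qed
  have "summable (\<lambda>n. norm (c n) * (2 * Q) ^ (\<Sum>j\<in>UNIV. \<beta> n j))"
    using assms[unfolded entire_coeffs_def, rule_format, of "2 * Q"] Q by simp
  then show "summable (\<lambda>n. norm (deriv_coeffs i c \<beta> n) * R ^ (\<Sum>j\<in>UNIV. deriv_exps i \<beta> n j))"
    by (rule summable_comparison_test[rotated])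
      (use bd R in \<open>auto intro!: exI[of _ 0] simp: abs_mult\<close>)
qed

text \<open>Termwise differentiation on the ball of radius |z| + 1. There the n-th derivative, as a
  linear map, has norm at most \<open>a n\<close> with \<open>a\<close> summable, so the derivatives
  of the partial sums converge uniformly.\<close>

lemma has_derivative_power_series:
  fixes z :: "complex^'n"
  assumes e: "entire_coeffs c \<beta>"
  shows "(power_series c \<beta> has_derivative
    (\<lambda>v. \<Sum>i\<in>UNIV. v $ i * power_series (deriv_coeffs i c \<beta>) (deriv_exps i \<beta>) z)) (at z)"
proof -
  define R where "R = norm z + 1"
  have R: "R \<ge> 0" by (simp add: R_def add_increasing2)
  define f' where "f' = (\<lambda>n z v. \<Sum>i\<in>UNIV. (v::complex^'n) $ i * (deriv_coeffs i c \<beta> n * multi_power (deriv_exps i \<beta> n) z))"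
  define g' where "g' = (\<lambda>z v. \<Sum>i\<in>UNIV. (v::complex^'n) $ i * power_series (deriv_coeffs i c \<beta>) (deriv_exps i \<beta>) z)"
  define a where "a = (\<lambda>n. \<Sum>i\<in>UNIV. norm (deriv_coeffs i c \<beta> n) * R ^ (\<Sum>j\<in>UNIV. deriv_exps i \<beta> n j))"
  have suma: "summable a" unfolding a_def
    using entire_coeffs_deriv[OF e] R by (intro summable_sum) (auto simp: entire_coeffs_def)
  have f'sums: "(\<lambda>n. f' n x v) sums g' x v" for x v unfolding f'_def g'_def
    by (intro sums_sum sums_mult entire_coeffs_sums(2) entire_coeffs_deriv e)
  have f'bd: "norm (f' n x v) \<le> a n * norm v" if "norm x \<le> R" for n x v
  proof -
    have "norm (f' n x v) \<le> (\<Sum>i\<in>UNIV. norm v * (norm (deriv_coeffs i c \<beta> n) * R ^ (\<Sum>j\<in>UNIV. deriv_exps i \<beta> n j)))"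
      unfolding f'_def
    proof (rule sum_norm_le)
      fix i
      show "norm (v $ i * (deriv_coeffs i c \<beta> n * multi_power (deriv_exps i \<beta> n) x))
        \<le> norm v * (norm (deriv_coeffs i c \<beta> n) * R ^ (\<Sum>j\<in>UNIV. deriv_exps i \<beta> n j))"
        unfolding norm_mult[of "v $ i"] norm_mult[of "deriv_coeffs i c \<beta> n"]
        by (intro mult_mono Finite_Cartesian_Product.norm_nth_le norm_multi_power_le that mult_nonneg_nonneg order_refl) auto
    qed
    then show ?thesis by (simp add: a_def sum_distrib_left[symmetric] mult.commute)
  qed
  have "\<exists>g. \<forall>x\<in>ball 0 R. (\<lambda>n. c n * multi_power (\<beta> n) x) sums g x \<and> (g has_derivative g' x) (at x within ball 0 R)"
  proof (rule has_derivative_series)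
    show "convex (ball (0::complex^'n) R)" by (rule convex_ball)
    show "(0::complex^'n) \<in> ball 0 R" by (simp add: R_def add_nonneg_pos)
    show "(\<lambda>n. c n * multi_power (\<beta> n) 0) sums power_series c \<beta> 0" by (rule entire_coeffs_sums(2)[OF e])
    show "((\<lambda>x. c n * multi_power (\<beta> n) x) has_derivative f' n x) (at x within ball 0 R)" for n x
    proof -
      have "((\<lambda>x. c n * multi_power (\<beta> n) x) has_derivative
        (\<lambda>v. c n * (\<Sum>i\<in>UNIV. v $ i * (of_nat (\<beta> n i) * multi_power ((\<beta> n)(i := \<beta> n i - 1)) x)))) (at x within ball 0 R)"
        by (rule has_derivative_mult_right[OF has_derivative_at_withinI[OF has_derivative_multi_power]])
      then show ?thesis by (simp add: f'_def[abs_def] sum_distrib_left mult_ac)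
    qed
    fix \<epsilon> :: real assume "\<epsilon> > 0"
    then obtain N where N: "\<And>n. n \<ge> N \<Longrightarrow> norm (\<Sum>k. a (k + n)) < \<epsilon>"
      using suminf_exist_split[OF _ suma] by blast
    show "\<forall>\<^sub>F n in sequentially. \<forall>x\<in>ball 0 R. \<forall>h. norm ((\<Sum>i<n. f' i x h) - g' x h) \<le> \<epsilon> * norm h"
      unfolding eventually_sequentially
    proof (intro exI[of _ N] allI impI ballI)
      fix n x h assume n: "n \<ge> N" and x: "x \<in> ball (0::complex^'n) R"
      have tail: "(\<lambda>k. f' (k + n) x h) sums (g' x h - (\<Sum>i<n. f' i x h))"
        by (rule sums_split_initial_segment[OF f'sums])
      have sa: "summable (\<lambda>k. a (k + n) * norm h)"
        using suma by (intro summable_mult2) (simp add: summable_iff_shift)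
      have "norm ((\<Sum>i<n. f' i x h) - g' x h) = norm (\<Sum>k. f' (k + n) x h)"
        using tail by (simp add: sums_iff norm_minus_commute)
      also have "\<dots> \<le> (\<Sum>k. a (k + n) * norm h)"
        by (rule norm_suminf_le[OF _ sa]) (use f'bd x in auto)
      also have "\<dots> = (\<Sum>k. a (k + n)) * norm h"
        using suma by (intro suminf_mult2[symmetric]) (simp add: summable_iff_shift)
      also have "\<dots> \<le> \<epsilon> * norm h" using N[OF n] by (intro mult_right_mono) auto
      finally show "norm ((\<Sum>i<n. f' i x h) - g' x h) \<le> \<epsilon> * norm h" .
    qed
  qed
  then obtain g where g: "\<And>x. x \<in> ball 0 R \<Longrightarrow> (\<lambda>n. c n * multi_power (\<beta> n) x) sums g x"
    "\<And>x. x \<in> ball 0 R \<Longrightarrow> (g has_derivative g' x) (at x within ball 0 R)" by blast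
  have z: "z \<in> ball 0 R" by (simp add: R_def)
  have eq: "g x = power_series c \<beta> x" if "x \<in> ball 0 R" for x
    using sums_unique2[OF g(1)[OF that] entire_coeffs_sums(2)[OF e]] .
  have "(g has_derivative g' z) (at z)" using g(2)[OF z] at_within_open[OF z] by simp
  then have "(power_series c \<beta> has_derivative g' z) (at z)"
    by (rule has_derivative_transform_within_open[OF _ open_ball z eq])
  then show ?thesis by (simp add: g'_def)
qed

text \<open>A class of differentiable functions closed under directional derivatives:
  differentiating a series in direction v gives a finite linear combination of series of the same
  kind. The second-order regularity in \<open>C2\<close> then follows by applying closure
  repeatedly.\<close>

inductive ph_series :: "(complex^'n \<Rightarrow> complex) \<Rightarrow> bool" where
  series: "entire_coeffs c \<beta> \<Longrightarrow> ph_series (power_series c \<beta>)"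
| series_cnj: "entire_coeffs c \<beta> \<Longrightarrow> ph_series (\<lambda>z. cnj (power_series c \<beta> z))"
| add: "ph_series f \<Longrightarrow> ph_series g \<Longrightarrow> ph_series (\<lambda>z. f z + g z)"
| cmult: "ph_series f \<Longrightarrow> ph_series (\<lambda>z. a * f z)"

lemma ph_series_sum:
  assumes "finite A" "\<And>i. i \<in> A \<Longrightarrow> ph_series (f i)"
  shows "ph_series (\<lambda>z. \<Sum>i\<in>A. f i z)"
  using assms
proof (induction A)
  case empty
  have "entire_coeffs (\<lambda>_. 0) (\<lambda>_ _. 0)" by (simp add: entire_coeffs_def)
  from ph_series.cmult[OF ph_series.series[OF this], of 0] show ?case by simp
next
  case (insert x F)
  then show ?case by (simp add: ph_series.add)
qed

lemma partial_along_eqI: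
  assumes "\<And>z. (f has_derivative f' z) (at z)"
  shows "partial_along v f = (\<lambda>z. f' z v)"
  using frechet_derivative_at[OF assms] by simp

lemma has_derivative_cnj_power_series:
  assumes "entire_coeffs c \<beta>"
  shows "((\<lambda>z. cnj (power_series c \<beta> z)) has_derivative
    (\<lambda>v. cnj (\<Sum>i\<in>UNIV. v $ i * power_series (deriv_coeffs i c \<beta>) (deriv_exps i \<beta>) z))) (at z)"
  by (rule bounded_linear.has_derivative[OF bounded_linear_cnj has_derivative_power_series[OF assms]])

lemma ph_series_differentiable:
  assumes "ph_series f"
  shows "f differentiable (at z)" and "ph_series (partial_along v f)"
proof -
  have "(\<forall>z. f differentiable (at z)) \<and> ph_series (partial_along v f)"
    using assms
  proof induction
    case (series c \<beta>)
    note d = has_derivative_power_series[OF series]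
    have "ph_series (\<lambda>z. \<Sum>i\<in>UNIV. v $ i * power_series (deriv_coeffs i c \<beta>) (deriv_exps i \<beta>) z)"
      by (intro ph_series_sum ph_series.cmult ph_series.series entire_coeffs_deriv series) auto
    then show ?case using d by (auto simp: partial_along_eqI[OF d] differentiable_def)
  next
    case (series_cnj c \<beta>)
    note d = has_derivative_cnj_power_series[OF series_cnj]
    have "ph_series (\<lambda>z. \<Sum>i\<in>UNIV. cnj (v $ i) * cnj (power_series (deriv_coeffs i c \<beta>) (deriv_exps i \<beta>) z))"
      by (intro ph_series_sum ph_series.cmult ph_series.series_cnj entire_coeffs_deriv series_cnj) auto
    then show ?case using d by (auto simp: partial_along_eqI[OF d] differentiable_def)
  next
    case (add f g)
    then have d: "((\<lambda>z. f z + g z) has_derivative (\<lambda>v. frechet_derivative f (at z) v + frechet_derivative g (at z) v)) (at z)" for z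
      by (intro has_derivative_add) (auto simp: frechet_derivative_works[symmetric])
    then show ?case using add ph_series.add[of "partial_along v f" "partial_along v g"]
      by (auto simp: partial_along_eqI[OF d] differentiable_def)
  next
    case (cmult f a)
    then have d: "((\<lambda>z. a * f z) has_derivative (\<lambda>v. a * frechet_derivative f (at z) v)) (at z)" for z
      by (intro has_derivative_mult_right) (auto simp: frechet_derivative_works[symmetric])
    then show ?case using cmult ph_series.cmult[of "partial_along v f" a]
      by (auto simp: partial_along_eqI[OF d] differentiable_def)
  qed
  then show "f differentiable (at z)" and "ph_series (partial_along v f)" by auto
qed

lemma ph_series_C2: "ph_series f \<Longrightarrow> C2 f"
  unfolding C2_def
  by (auto intro!: ph_series_differentiable continuous_at_imp_continuous_on differentiable_imp_continuous_within)

text \<open>The barred Wirtinger derivative kills the holomorphic summand and turns the conjugated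
  one into the conjugate of a derivative series; the unbarred one kills that in turn.\<close>

lemma pluriharmonic_power_series:
  fixes \<beta> \<gamma> :: "nat \<Rightarrow> 'n::finite \<Rightarrow> nat"
  assumes F: "entire_coeffs c \<beta>" and G: "entire_coeffs d \<gamma>"
  shows "pluriharmonic (\<lambda>z. power_series c \<beta> z + cnj (power_series d \<gamma> z))"
  unfolding pluriharmonic_def
proof (intro conjI allI)
  show "C2 (\<lambda>z. power_series c \<beta> z + cnj (power_series d \<gamma> z))"
    by (intro ph_series_C2 ph_series.add ph_series.series ph_series.series_cnj F G)
  \<comment> \<open>The derivative in a coordinate direction keeps a single summand. For the
    directions 1 and \<i> this leaves only the sign cancellation i * i = -1.\<close>
  have ax: "(\<Sum>i\<in>UNIV. axis k x $ i * h i) = x * h k" for k :: 'n and x :: complex and h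
    by (simp add: axis_def if_distrib[of "\<lambda>x. x * _"] sum.delta cong: if_cong)
  fix j k :: 'n and z :: "complex^'n"
  have d: "((\<lambda>z. power_series c \<beta> z + cnj (power_series d \<gamma> z)) has_derivative
    (\<lambda>v. (\<Sum>i\<in>UNIV. v $ i * power_series (deriv_coeffs i c \<beta>) (deriv_exps i \<beta>) z) +
      cnj (\<Sum>i\<in>UNIV. v $ i * power_series (deriv_coeffs i d \<gamma>) (deriv_exps i \<gamma>) z))) (at z)" for z
    by (intro has_derivative_add has_derivative_power_series has_derivative_cnj_power_series F G)
  have bar: "wirtinger_bar k (\<lambda>z. power_series c \<beta> z + cnj (power_series d \<gamma> z)) =
    (\<lambda>z. cnj (power_series (deriv_coeffs k d \<gamma>) (deriv_exps k \<gamma>) z))"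
    by (rule ext) (simp only: wirtinger_bar_def frechet_derivative_at[OF d, symmetric] ax, simp add: algebra_simps)
  have e: "entire_coeffs (deriv_coeffs k d \<gamma>) (deriv_exps k \<gamma>)" by (rule entire_coeffs_deriv[OF G])
  show "wirtinger j (wirtinger_bar k (\<lambda>z. power_series c \<beta> z + cnj (power_series d \<gamma> z))) z = 0"
    unfolding bar
    by (simp only: wirtinger_def frechet_derivative_at[OF has_derivative_cnj_power_series[OF e], symmetric] ax) simp
qed

text \<open>Bounded coefficients suffice, since the normalised monomials are absolutely summable at
  every point. The series is split by the sign of the exponents into a holomorphic series with
  coefficients \<open>c\<close> and the conjugate of one with coefficients \<open>d\<close>, both
  using the absolute exponents \<open>\<beta>\<close>.\<close>

lemma pluriharmonic_fock_series:
  fixes b :: "nat \<Rightarrow> complex"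
  assumes \<alpha>: "\<alpha> > 0" and b: "\<And>m. norm (b m) \<le> B"
  shows "pluriharmonic (\<lambda>z::complex^'n. \<Sum>m. b m * fock_basis \<alpha> m z)"
    and "\<And>z::complex^'n. summable (\<lambda>m. norm (b m * fock_basis \<alpha> m z))"
proof -
  define ix :: "nat \<Rightarrow> 'n \<Rightarrow> int" where "ix = fock_index"
  define \<beta> where "\<beta> = (\<lambda>m j. nat \<bar>ix m j\<bar>)"
  define s where "s = (\<lambda>m. \<Prod>j\<in>UNIV. complex_of_real (sqrt (fact (\<beta> m j) * \<alpha> ^ \<beta> m j)))"
  \<comment> \<open>The constant monomial counts as holomorphic, so exactly one of
    \<open>c m\<close> and \<open>d m\<close> carries each term.\<close>
  define pos where "pos = (\<lambda>m. \<forall>j. ix m j \<ge> 0)"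
  define c where "c = (\<lambda>m. if pos m then b m / s m else 0)"
  define d where "d = (\<lambda>m. if pos m then 0 else cnj (b m) / s m)"
  have neg: "\<forall>j. ix m j \<le> 0" if "\<not> pos m" for m
    using that bij_betw_fock_index[where 'n='n] unfolding pos_def ix_def
    by (force simp: bij_betw_def fock_exponents_def)
  have eq: "fock_basis \<alpha> m z = (if pos m then multi_power (\<beta> m) z / s m else cnj (multi_power (\<beta> m) z / s m))" for m and z :: "complex^'n"
  proof (cases "pos m")
    case True
    then show ?thesis
      by (simp add: fock_basis_def fock_monomial_def fock_factor_def prod_dividef multi_power_def s_def \<beta>_def pos_def ix_def)
  next
    case False
    have "fock_factor \<alpha> (ix m j) u = cnj (u ^ \<beta> m j) / complex_of_real (sqrt (fact (\<beta> m j) * \<alpha> ^ \<beta> m j))" for j u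
      using neg[OF False, rule_format, of j] by (cases "ix m j = 0") (auto simp: fock_factor_def \<beta>_def)
    then show ?thesis using False
      by (simp add: fock_basis_def fock_monomial_def prod_dividef multi_power_def s_def flip: ix_def)
  qed
  \<comment> \<open>At the vector with all entries R, the modulus of a basis function is exactly the
    majorant in \<open>entire_coeffs\<close>; pointwise summability there thus controls the whole
    polydisc.\<close>
  have nr: "norm (fock_basis \<alpha> m (\<chi> i::'n. complex_of_real R)) = R ^ (\<Sum>j\<in>UNIV. \<beta> m j) / norm (s m)" if "R \<ge> 0" for R m
    using that by (simp add: eq norm_divide multi_power_def prod_norm[symmetric] norm_power power_sum)
  have B: "B \<ge> 0" using order_trans[OF norm_ge_zero b[of 0]] .
  have sumR: "summable (\<lambda>m. B * (R ^ (\<Sum>j\<in>UNIV. \<beta> m j) / norm (s m)))" if "R \<ge> 0" for R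
    using summable_norm_fock_basis[OF \<alpha>, of "\<chi> i::'n. complex_of_real R"] nr[OF that]
    by (intro summable_mult) simp
  have cle: "norm (c m) \<le> B / norm (s m)" "norm (d m) \<le> B / norm (s m)" for m
    using b[of m] B by (auto simp: c_def d_def norm_divide divide_right_mono)
  have ec: "entire_coeffs c \<beta>" "entire_coeffs d \<beta>"
  proof -
    have "entire_coeffs x \<beta>" if x: "\<And>m. norm (x m) \<le> B / norm (s m)" for x
      unfolding entire_coeffs_def
    proof safe
      fix R :: real assume R: "R \<ge> 0"
      have "norm (x m) * R ^ (\<Sum>j\<in>UNIV. \<beta> m j) \<le> B * (R ^ (\<Sum>j\<in>UNIV. \<beta> m j) / norm (s m))" for m
        using mult_right_mono[OF x[of m], of "R ^ (\<Sum>j\<in>UNIV. \<beta> m j)"] R by simp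
      then show "summable (\<lambda>m. norm (x m) * R ^ (\<Sum>j\<in>UNIV. \<beta> m j))"
        using R by (intro summable_comparison_test[OF _ sumR[OF R]]) (auto simp: abs_mult)
    qed
    from this[OF cle(1)] this[OF cle(2)] show "entire_coeffs c \<beta>" "entire_coeffs d \<beta>" .
  qed
  have term_eq: "b m * fock_basis \<alpha> m z = c m * multi_power (\<beta> m) z + cnj (d m * multi_power (\<beta> m) z)" for m and z :: "complex^'n"
    by (simp add: eq c_def d_def)
  have sums: "(\<lambda>m. b m * fock_basis \<alpha> m z) sums (power_series c \<beta> z + cnj (power_series d \<beta> z))" for z :: "complex^'n"
    unfolding term_eq
    by (intro sums_add entire_coeffs_sums ec) (simp only: sums_cnj entire_coeffs_sums ec)
  have "(\<lambda>z::complex^'n. \<Sum>m. b m * fock_basis \<alpha> m z) = (\<lambda>z. power_series c \<beta> z + cnj (power_series d \<beta> z))"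
    using sums by (auto simp: sums_iff)
  then show "pluriharmonic (\<lambda>z::complex^'n. \<Sum>m. b m * fock_basis \<alpha> m z)"
    using pluriharmonic_power_series[OF ec] by simp
  show "summable (\<lambda>m. norm (b m * fock_basis \<alpha> m z))" for z :: "complex^'n"
    by (rule summable_comparison_test[OF _ summable_mult[OF summable_norm_fock_basis[OF \<alpha>, of z], of B]])
      (auto intro!: exI[of _ 0] mult_right_mono b simp: norm_mult)
qed

section \<open>The inner product space\<close>

definition gaussian :: "real \<Rightarrow> complex^'n \<Rightarrow> real" where
  "gaussian \<alpha> z = exp (- (norm z)\<^sup>2 / \<alpha>)"

lemma gaussian_pos [simp]: "gaussian \<alpha> z > 0"
  by (simp add: gaussian_def)

lemma gaussian_nonneg [simp]: "gaussian \<alpha> z \<ge> 0"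
  by (simp add: less_imp_le)

lemma borel_measurable_gaussian [measurable]: "gaussian \<alpha> \<in> borel_measurable borel"
  unfolding gaussian_def by measurable

lemma borel_measurable_fock_basis [measurable]: "fock_basis \<alpha> m \<in> borel_measurable borel"
  unfolding fock_basis_def by measurable

lemma fock_weight_basis: "fock_weight \<alpha> (fock_index m) z = (norm (fock_basis \<alpha> m z))\<^sup>2 * gaussian \<alpha> z"
  by (simp add: fock_weight_def fock_basis_def gaussian_def)

text \<open>Inner products are computed in this larger class, which is closed under finite sums;
  pluriharmonicity is checked only where membership in \<open>PH2\<close> is claimed.\<close>

definition fock_L2 :: "real \<Rightarrow> (complex^'n \<Rightarrow> complex) \<Rightarrow> bool" where
  "fock_L2 \<alpha> f \<longleftrightarrow> f \<in> borel_measurable borel \<and> integrable lborel (\<lambda>z. (norm (f z))\<^sup>2 * gaussian \<alpha> z)"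

lemma ph_inner_gaussian:
  "ph_inner \<alpha> f g = of_real (1 / (\<alpha> * pi) ^ CARD('n)) * (LINT z|lborel. f z * cnj (g z) * of_real (gaussian \<alpha> z))"
  for f g :: "complex^'n \<Rightarrow> complex"
  by (simp add: ph_inner_def gaussian_def)

lemma fock_L2_basis:
  assumes "\<alpha> > 0"
  shows "fock_L2 \<alpha> (fock_basis \<alpha> m)"
  using integrable_fock_weight[OF assms, of "fock_index m"] by (simp add: fock_L2_def fock_weight_basis[abs_def])

lemma PH2_imp_fock_L2: "f \<in> PH2 \<alpha> \<Longrightarrow> fock_L2 \<alpha> f"
  by (auto simp: PH2_def fock_L2_def gaussian_def pluriharmonic_def C2_def
      intro!: borel_measurable_continuous_onI continuous_at_imp_continuous_on differentiable_imp_continuous_within)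

lemma norm_mult_le_squares: "norm (a * cnj b) \<le> (norm a)\<^sup>2 + (norm b)\<^sup>2"
proof -
  have "norm a * norm b \<ge> 0" by simp
  then show ?thesis using sum_squares_bound[of "norm a" "norm b"] unfolding norm_mult complex_mod_cnj by linarith
qed

lemma fock_L2_integrable_mult:
  assumes "fock_L2 \<alpha> f" "fock_L2 \<alpha> g"
  shows "integrable lborel (\<lambda>z. f z * cnj (g z) * of_real (gaussian \<alpha> z))"
proof (rule Bochner_Integration.integrable_bound)
  show "integrable lborel (\<lambda>z. (norm (f z))\<^sup>2 * gaussian \<alpha> z + (norm (g z))\<^sup>2 * gaussian \<alpha> z)"
    using assms by (auto simp: fock_L2_def)
  have [measurable]: "f \<in> borel_measurable borel" "g \<in> borel_measurable borel"
    using assms by (auto simp: fock_L2_def)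
  show "(\<lambda>z. f z * cnj (g z) * of_real (gaussian \<alpha> z)) \<in> borel_measurable lborel" by measurable
  show "AE z in lborel. norm (f z * cnj (g z) * of_real (gaussian \<alpha> z))
      \<le> norm ((norm (f z))\<^sup>2 * gaussian \<alpha> z + (norm (g z))\<^sup>2 * gaussian \<alpha> z)"
  proof (rule AE_I2)
    fix z
    have "norm (f z * cnj (g z) * of_real (gaussian \<alpha> z)) \<le> ((norm (f z))\<^sup>2 + (norm (g z))\<^sup>2) * gaussian \<alpha> z"
      unfolding norm_mult[of "f z * _"] by (simp add: norm_mult_le_squares mult_right_mono del: norm_mult complex_mod_mult_cnj)
    then show "norm (f z * cnj (g z) * of_real (gaussian \<alpha> z))
      \<le> norm ((norm (f z))\<^sup>2 * gaussian \<alpha> z + (norm (g z))\<^sup>2 * gaussian \<alpha> z)"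
      by (simp add: distrib_right)
  qed
qed

lemma fock_L2_cmult:
  assumes "fock_L2 \<alpha> f"
  shows "fock_L2 \<alpha> (\<lambda>z. a * f z)"
proof -
  have "(\<lambda>z. (norm (a * f z))\<^sup>2 * gaussian \<alpha> z) = (\<lambda>z. (norm a)\<^sup>2 * ((norm (f z))\<^sup>2 * gaussian \<alpha> z))"
    by (simp add: norm_mult power_mult_distrib mult.assoc)
  moreover have "f \<in> borel_measurable borel" using assms by (simp add: fock_L2_def)
  then have "(\<lambda>z. a * f z) \<in> borel_measurable borel" by measurable
  ultimately show ?thesis using assms by (simp add: fock_L2_def)
qed

lemma fock_L2_add:
  assumes "fock_L2 \<alpha> f" "fock_L2 \<alpha> g"
  shows "fock_L2 \<alpha> (\<lambda>z. f z + g z)"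
proof -
  have [measurable]: "f \<in> borel_measurable borel" "g \<in> borel_measurable borel"
    using assms by (auto simp: fock_L2_def)
  have le: "(norm (a + b))\<^sup>2 \<le> 2 * (norm a)\<^sup>2 + 2 * (norm b)\<^sup>2" for a b :: complex
  proof -
    have "(norm (a + b))\<^sup>2 \<le> (norm a + norm b)\<^sup>2" by (intro power_mono norm_triangle_ineq) auto
    also have "\<dots> \<le> 2 * (norm a)\<^sup>2 + 2 * (norm b)\<^sup>2"
      using sum_squares_bound[of "norm a" "norm b"] by (simp add: power2_sum)
    finally show ?thesis .
  qed
  have "integrable lborel (\<lambda>z. (norm (f z + g z))\<^sup>2 * gaussian \<alpha> z)"
  proof (rule Bochner_Integration.integrable_bound)
    show "integrable lborel (\<lambda>z. 2 * ((norm (f z))\<^sup>2 * gaussian \<alpha> z) + 2 * ((norm (g z))\<^sup>2 * gaussian \<alpha> z))"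
      using assms by (auto simp: fock_L2_def)
    show "AE z in lborel. norm ((norm (f z + g z))\<^sup>2 * gaussian \<alpha> z)
      \<le> norm (2 * ((norm (f z))\<^sup>2 * gaussian \<alpha> z) + 2 * ((norm (g z))\<^sup>2 * gaussian \<alpha> z))"
    proof (rule AE_I2)
      fix z
      show "norm ((norm (f z + g z))\<^sup>2 * gaussian \<alpha> z)
        \<le> norm (2 * ((norm (f z))\<^sup>2 * gaussian \<alpha> z) + 2 * ((norm (g z))\<^sup>2 * gaussian \<alpha> z))"
        using mult_right_mono[OF le[of "f z" "g z"] gaussian_nonneg[of \<alpha> z]]
        by (simp add: distrib_right mult.assoc)
    qed
  qed measurable
  then show ?thesis by (simp add: fock_L2_def)
qed

lemma fock_L2_sum:
  assumes "finite A" "\<And>i. i \<in> A \<Longrightarrow> fock_L2 \<alpha> (f i)"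
  shows "fock_L2 \<alpha> (\<lambda>z. \<Sum>i\<in>A. f i z)"
  using assms
proof (induction A)
  case empty
  show ?case by (simp add: fock_L2_def)
next
  case (insert x F)
  then show ?case by (simp add: fock_L2_add)
qed

section \<open>Inner products, Bessel's inequality and norms of series\<close>

lemma ph_inner_add:
  assumes "fock_L2 \<alpha> f" "fock_L2 \<alpha> g" "fock_L2 \<alpha> h"
  shows "ph_inner \<alpha> (\<lambda>z. a * f z + b * g z) h = a * ph_inner \<alpha> f h + b * ph_inner \<alpha> g h"
proof -
  have "(LINT z|lborel. (a * f z + b * g z) * cnj (h z) * of_real (gaussian \<alpha> z))
    = (LINT z|lborel. a * (f z * cnj (h z) * of_real (gaussian \<alpha> z)) + b * (g z * cnj (h z) * of_real (gaussian \<alpha> z)))"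
    by (simp add: algebra_simps)
  also have "\<dots> = a * (LINT z|lborel. f z * cnj (h z) * of_real (gaussian \<alpha> z)) + b * (LINT z|lborel. g z * cnj (h z) * of_real (gaussian \<alpha> z))"
    using fock_L2_integrable_mult[OF assms(1,3)] fock_L2_integrable_mult[OF assms(2,3)] by simp
  finally show ?thesis by (simp add: ph_inner_gaussian algebra_simps)
qed

lemma ph_inner_sum:
  assumes "finite A" "\<And>i. i \<in> A \<Longrightarrow> fock_L2 \<alpha> (f i)" "fock_L2 \<alpha> h"
  shows "ph_inner \<alpha> (\<lambda>z. \<Sum>i\<in>A. c i * f i z) h = (\<Sum>i\<in>A. c i * ph_inner \<alpha> (f i) h)"
  using assms(1,2)
proof (induction A)
  case empty
  then show ?case by (simp add: ph_inner_def)
next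
  case (insert i A)
  have "fock_L2 \<alpha> (\<lambda>z. \<Sum>i\<in>A. c i * f i z)"
    using insert by (intro fock_L2_sum fock_L2_cmult) auto
  from ph_inner_add[OF _ this assms(3), of "f i" "c i" 1] insert show ?case by simp
qed

lemma ph_inner_cnj: "ph_inner \<alpha> g f = cnj (ph_inner \<alpha> f g)"
proof -
  have "(LINT z|lborel. g z * cnj (f z) * of_real (gaussian \<alpha> z))
    = (LINT z|lborel. cnj (f z * cnj (g z) * of_real (gaussian \<alpha> z)))"
    by (simp add: mult_ac)
  also have "\<dots> = cnj (LINT z|lborel. f z * cnj (g z) * of_real (gaussian \<alpha> z))"
    by (rule Bochner_Integration.integral_cnj)
  finally show ?thesis by (simp add: ph_inner_gaussian)
qed

lemma ph_inner_self:
  fixes f :: "complex^'n \<Rightarrow> complex"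
  shows "ph_inner \<alpha> f f = of_real ((LINT z|lborel. (norm (f z))\<^sup>2 * gaussian \<alpha> z) / (\<alpha> * pi) ^ CARD('n))"
proof -
  have "(LINT z|lborel. f z * cnj (f z) * of_real (gaussian \<alpha> z))
    = (LINT z|lborel. complex_of_real ((norm (f z))\<^sup>2 * gaussian \<alpha> z))"
    by (simp add: complex_norm_square del: of_real_power)
  also have "\<dots> = of_real (LINT z|lborel. (norm (f z))\<^sup>2 * gaussian \<alpha> z)"
    by (rule integral_complex_of_real)
  finally show ?thesis by (simp add: ph_inner_gaussian)
qed

lemma ip_norm_ph_square:
  fixes f :: "complex^'n \<Rightarrow> complex"
  assumes "\<alpha> > 0"
  shows "(ip_norm (ph_inner \<alpha>) f)\<^sup>2 = (LINT z|lborel. (norm (f z))\<^sup>2 * gaussian \<alpha> z) / (\<alpha> * pi) ^ CARD('n)"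
    and "ip_norm (ph_inner \<alpha>) f \<ge> 0"
    and "(ip_norm (ph_inner \<alpha>) f)\<^sup>2 = Re (ph_inner \<alpha> f f)"
proof -
  have "(LINT z|lborel. (norm (f z))\<^sup>2 * gaussian \<alpha> z) / (\<alpha> * pi) ^ CARD('n) \<ge> 0"
    using assms by (intro divide_nonneg_nonneg integral_nonneg_AE AE_I2) auto
  then show "(ip_norm (ph_inner \<alpha>) f)\<^sup>2 = (LINT z|lborel. (norm (f z))\<^sup>2 * gaussian \<alpha> z) / (\<alpha> * pi) ^ CARD('n)"
    and "ip_norm (ph_inner \<alpha>) f \<ge> 0" and "(ip_norm (ph_inner \<alpha>) f)\<^sup>2 = Re (ph_inner \<alpha> f f)"
    by (simp_all add: ip_norm_def ph_inner_self)
qed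

lemma ph_inner_fock_basis:
  assumes "\<alpha> > 0"
  shows "ph_inner \<alpha> (fock_basis \<alpha> m) (fock_basis \<alpha> k :: complex^'n \<Rightarrow> complex) = (if m = k then 1 else 0)"
  using fock_monomial_orthogonal_lborel[OF assms, of "fock_index m :: 'n \<Rightarrow> int" "fock_index k"] assms
  by (simp add: ph_inner_def fock_basis_def)

text \<open>The difference D of x and its projection P onto the span of the chosen basis functions
  is orthogonal to P, so the squared norm of D is that of x minus the sum of squared
  coefficients.\<close>

lemma ph_bessel:
  fixes x :: "complex^'n \<Rightarrow> complex"
  assumes \<alpha>: "\<alpha> > 0" and x: "fock_L2 \<alpha> x" and F: "finite F"
  shows "(\<Sum>m\<in>F. (norm (ph_inner \<alpha> x (fock_basis \<alpha> m)))\<^sup>2) \<le> (ip_norm (ph_inner \<alpha>) x)\<^sup>2"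
proof -
  have e: "fock_L2 \<alpha> (fock_basis \<alpha> m :: complex^'n \<Rightarrow> complex)" for m by (rule fock_L2_basis[OF \<alpha>])
  define a where "a = (\<lambda>m. ph_inner \<alpha> x (fock_basis \<alpha> m))"
  define P :: "complex^'n \<Rightarrow> complex" where "P = (\<lambda>z. \<Sum>m\<in>F. a m * fock_basis \<alpha> m z)"
  \<comment> \<open>The difference is written as a linear combination so that
    \<open>ph_inner_add\<close> applies as it stands.\<close>
  define D where "D = (\<lambda>z. 1 * x z + (- 1) * P z)"
  have P: "fock_L2 \<alpha> P" unfolding P_def by (intro fock_L2_sum fock_L2_cmult e F)
  have D: "fock_L2 \<alpha> D" unfolding D_def by (intro fock_L2_add fock_L2_cmult x P)
  have iD: "ph_inner \<alpha> D h = ph_inner \<alpha> x h - ph_inner \<alpha> P h" if "fock_L2 \<alpha> h" for h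
    unfolding D_def by (subst ph_inner_add[OF x P that]) simp
  have iP: "ph_inner \<alpha> P h = (\<Sum>m\<in>F. a m * ph_inner \<alpha> (fock_basis \<alpha> m) h)" if "fock_L2 \<alpha> h" for h
    unfolding P_def by (rule ph_inner_sum[OF F e that])
  have "ph_inner \<alpha> D (fock_basis \<alpha> m) = 0" if "m \<in> F" for m
  proof -
    have "ph_inner \<alpha> P (fock_basis \<alpha> m) = (\<Sum>k\<in>F. if k = m then a k else 0)"
      unfolding iP[OF e] by (intro sum.cong) (auto simp: ph_inner_fock_basis[OF \<alpha>])
    also have "\<dots> = a m" using that F by simp
    finally show ?thesis by (simp add: iD[OF e] a_def)
  qed
  then have "ph_inner \<alpha> (fock_basis \<alpha> m) D = 0" if "m \<in> F" for m
    using that by (simp add: ph_inner_cnj[of \<alpha> "fock_basis \<alpha> m" D])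
  then have "ph_inner \<alpha> P D = 0" by (simp add: iP[OF D])
  then have "ph_inner \<alpha> D D = ph_inner \<alpha> x D" by (simp add: iD[OF D])
  also have "\<dots> = cnj (ph_inner \<alpha> x x - ph_inner \<alpha> P x)" by (simp add: ph_inner_cnj[of \<alpha> x D] iD[OF x])
  also have "ph_inner \<alpha> P x = (\<Sum>m\<in>F. a m * cnj (a m))"
    unfolding iP[OF x] by (simp add: a_def ph_inner_cnj[of \<alpha> "fock_basis \<alpha> _" x])
  also have "\<dots> = of_real (\<Sum>m\<in>F. (norm (a m))\<^sup>2)"
    by (simp add: complex_norm_square del: of_real_power)
  finally have "Re (ph_inner \<alpha> D D) = Re (ph_inner \<alpha> x x) - (\<Sum>m\<in>F. (norm (a m))\<^sup>2)" by simp
  moreover have "Re (ph_inner \<alpha> D D) \<ge> 0"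
    using ip_norm_ph_square(3)[OF \<alpha>, of D] zero_le_power2 by metis
  ultimately show ?thesis by (simp add: ip_norm_ph_square(3)[OF \<alpha>] a_def)
qed

lemma ph_norm_finite_sum:
  fixes b :: "nat \<Rightarrow> complex"
  assumes \<alpha>: "\<alpha> > 0" and F: "finite F"
  shows "(LINT z|lborel. (norm (\<Sum>m\<in>F. b m * fock_basis \<alpha> m (z::complex^'n)))\<^sup>2 * gaussian \<alpha> z)
    = (\<alpha> * pi) ^ CARD('n) * (\<Sum>m\<in>F. (norm (b m))\<^sup>2)"
proof -
  have e: "fock_L2 \<alpha> (fock_basis \<alpha> m :: complex^'n \<Rightarrow> complex)" for m by (rule fock_L2_basis[OF \<alpha>])
  let ?P = "\<lambda>z::complex^'n. \<Sum>m\<in>F. b m * fock_basis \<alpha> m z"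
  have P: "fock_L2 \<alpha> ?P" by (intro fock_L2_sum fock_L2_cmult e F)
  have i1: "ph_inner \<alpha> ?P (fock_basis \<alpha> m) = b m" if "m \<in> F" for m
  proof -
    have "ph_inner \<alpha> ?P (fock_basis \<alpha> m) = (\<Sum>k\<in>F. if k = m then b k else 0)"
      unfolding ph_inner_sum[OF F e e] by (intro sum.cong) (auto simp: ph_inner_fock_basis[OF \<alpha>])
    also have "\<dots> = b m" using that F by simp
    finally show ?thesis .
  qed
  have "ph_inner \<alpha> ?P ?P = (\<Sum>m\<in>F. b m * cnj (b m))"
    unfolding ph_inner_sum[OF F e P] by (intro sum.cong refl) (simp add: ph_inner_cnj[of \<alpha> "fock_basis \<alpha> _" ?P] i1)
  also have "\<dots> = of_real (\<Sum>m\<in>F. (norm (b m))\<^sup>2)"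
    by (simp add: complex_norm_square del: of_real_power)
  finally have "(LINT z|lborel. (norm (?P z))\<^sup>2 * gaussian \<alpha> z) / (\<alpha> * pi) ^ CARD('n) = (\<Sum>m\<in>F. (norm (b m))\<^sup>2)"
    unfolding ph_inner_self of_real_eq_iff .
  then show ?thesis using \<alpha> by (simp add: field_simps)
qed

text \<open>Fatou's lemma: the partial sums converge pointwise and their norms are known exactly
  from their coefficients. This yields integrability of the limit as well as the norm bound, and
  serves both for boundedness and for the remainders of the Schmidt form.\<close>

lemma fock_series_norm_le:
  fixes b :: "nat \<Rightarrow> complex" and u :: "complex^'n \<Rightarrow> complex"
  assumes \<alpha>: "\<alpha> > 0" and u: "\<And>z. (\<lambda>m. b m * fock_basis \<alpha> m z) sums u z"
    and B: "\<And>k. (\<Sum>m<k. (norm (b m))\<^sup>2) \<le> B"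
  shows "integrable lborel (\<lambda>z. (norm (u z))\<^sup>2 * gaussian \<alpha> z)"
    and "(ip_norm (ph_inner \<alpha>) u)\<^sup>2 \<le> B"
proof -
  let ?N = "(\<alpha> * pi) ^ CARD('n)"
  have N: "?N > 0" using \<alpha> by simp
  define P where "P = (\<lambda>k z. \<Sum>m<k. b m * fock_basis \<alpha> m (z::complex^'n))"
  have [measurable]: "P k \<in> borel_measurable borel" for k unfolding P_def by measurable
  have lim: "(\<lambda>k. P k z) \<longlonglongrightarrow> u z" for z using u[of z] by (simp add: sums_def P_def)
  have [measurable]: "u \<in> borel_measurable borel"
    by (rule borel_measurable_LIMSEQ_metric[OF _ lim]) measurable
  have B0: "B \<ge> 0" using B[of 0] by simp
  have nn: "(\<integral>\<^sup>+ z. ennreal ((norm (u z))\<^sup>2 * gaussian \<alpha> z) \<partial>lborel) \<le> ennreal (?N * B)"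
  proof -
    have "ennreal ((norm (u z))\<^sup>2 * gaussian \<alpha> z) = liminf (\<lambda>k. ennreal ((norm (P k z))\<^sup>2 * gaussian \<alpha> z))" for z
      by (rule lim_imp_Liminf[symmetric]) (auto intro!: tendsto_intros lim tendsto_ennrealI)
    then have "(\<integral>\<^sup>+ z. ennreal ((norm (u z))\<^sup>2 * gaussian \<alpha> z) \<partial>lborel)
      = (\<integral>\<^sup>+ z. liminf (\<lambda>k. ennreal ((norm (P k z))\<^sup>2 * gaussian \<alpha> z)) \<partial>lborel)" by simp
    also have "\<dots> \<le> liminf (\<lambda>k. \<integral>\<^sup>+ z. ennreal ((norm (P k z))\<^sup>2 * gaussian \<alpha> z) \<partial>lborel)"
      by (rule nn_integral_liminf) measurable
    also have "\<dots> \<le> liminf (\<lambda>k. ennreal (?N * B))"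
    proof (intro Liminf_mono always_eventually allI)
      fix k
      have "fock_L2 \<alpha> (P k)" unfolding P_def by (intro fock_L2_sum fock_L2_cmult fock_L2_basis \<alpha>) auto
      then have "(\<integral>\<^sup>+ z. ennreal ((norm (P k z))\<^sup>2 * gaussian \<alpha> z) \<partial>lborel) = ennreal (LINT z|lborel. (norm (P k z))\<^sup>2 * gaussian \<alpha> z)"
        by (intro nn_integral_eq_integral) (auto simp: fock_L2_def)
      also have "\<dots> = ennreal (?N * (\<Sum>m<k. (norm (b m))\<^sup>2))"
        unfolding P_def by (subst ph_norm_finite_sum[OF \<alpha>]) auto
      also have "\<dots> \<le> ennreal (?N * B)" using N B by (intro ennreal_leI mult_left_mono) auto
      finally show "(\<integral>\<^sup>+ z. ennreal ((norm (P k z))\<^sup>2 * gaussian \<alpha> z) \<partial>lborel) \<le> ennreal (?N * B)" .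
    qed
    also have "\<dots> = ennreal (?N * B)" by (simp add: Liminf_const)
    finally show ?thesis .
  qed
  show i: "integrable lborel (\<lambda>z. (norm (u z))\<^sup>2 * gaussian \<alpha> z)"
    by (rule integrableI_bounded) (use nn in \<open>auto simp: le_less_trans abs_mult\<close>)
  have "(LINT z|lborel. (norm (u z))\<^sup>2 * gaussian \<alpha> z) \<le> ?N * B"
    using nn N B0 by (subst (asm) nn_integral_eq_integral[OF i]) (auto simp: ennreal_le_iff)
  then show "(ip_norm (ph_inner \<alpha>) u)\<^sup>2 \<le> B"
    unfolding ip_norm_ph_square(1)[OF \<alpha>] using N by (simp add: field_simps)
qed

text \<open>A basis function is the series with a single coefficient 1, so its pluriharmonicity is
  an instance of the statement for series.\<close>

lemma fock_basis_PH2: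
  assumes "\<alpha> > 0"
  shows "(fock_basis \<alpha> k :: complex^'n \<Rightarrow> complex) \<in> PH2 \<alpha>"
proof -
  define b :: "nat \<Rightarrow> complex" where "b = (\<lambda>m. if m = k then 1 else 0)"
  have "(\<lambda>z::complex^'n. \<Sum>m. b m * fock_basis \<alpha> m z) = fock_basis \<alpha> k"
    by (rule ext, subst suminf_finite[of "{k}"]) (auto simp: b_def)
  moreover have "pluriharmonic (\<lambda>z::complex^'n. \<Sum>m. b m * fock_basis \<alpha> m z)"
    by (rule pluriharmonic_fock_series(1)[OF assms, where B=1]) (simp add: b_def)
  ultimately have "pluriharmonic (fock_basis \<alpha> k :: complex^'n \<Rightarrow> complex)" by simp
  then show ?thesis using fock_L2_basis[OF assms, of k] by (simp add: PH2_def fock_L2_def gaussian_def)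
qed

text \<open>Used for Lebesgue measure, where it gives the coefficients of a kernel, and for \<mu>,
  where it shows that the Toeplitz operator is diagonal. The kernel is expanded in v; the integrals
  of the products of two basis functions are bounded by 2 \<Lambda> independently of m, and
  summability comes from the values at w. Orthogonality leaves the term with index k.\<close>

lemma integral_ph_kernel_fock_basis:
  fixes \<nu> :: "(complex^'n) measure"
  assumes \<alpha>: "\<alpha> > 0" and s[measurable_cong]: "sets \<nu> = sets borel"
    and int: "\<And>m. integrable \<nu> (fock_weight \<alpha> (fock_index m))"
    and bd: "\<And>m. (LINT v|\<nu>. fock_weight \<alpha> (fock_index m) v) \<le> \<Lambda>"
    and orth: "\<And>m k. m \<noteq> k \<Longrightarrow> (LINT v|\<nu>. fock_basis \<alpha> m v * cnj (fock_basis \<alpha> k v) * of_real (gaussian \<alpha> v)) = 0"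
  shows "integrable \<nu> (\<lambda>v. ph_kernel \<alpha> v w * cnj (fock_basis \<alpha> k v) * of_real (gaussian \<alpha> v))"
    and "(LINT v|\<nu>. ph_kernel \<alpha> v w * cnj (fock_basis \<alpha> k v) * of_real (gaussian \<alpha> v))
      = of_real (LINT v|\<nu>. fock_weight \<alpha> (fock_index k) v) * cnj (fock_basis \<alpha> k w)"
proof -
  define g where "g = (\<lambda>m (v::complex^'n). fock_basis \<alpha> m v * cnj (fock_basis \<alpha> k v) * of_real (gaussian \<alpha> v))"
  define f where "f = (\<lambda>m v. cnj (fock_basis \<alpha> m w) * g m v)"
  have gle: "norm (g m v) \<le> fock_weight \<alpha> (fock_index m) v + fock_weight \<alpha> (fock_index k) v" for m v
  proof -
    have "norm (g m v) = norm (fock_basis \<alpha> m v * cnj (fock_basis \<alpha> k v)) * gaussian \<alpha> v"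
      by (simp add: g_def norm_mult)
    also have "\<dots> \<le> ((norm (fock_basis \<alpha> m v))\<^sup>2 + (norm (fock_basis \<alpha> k v))\<^sup>2) * gaussian \<alpha> v"
      by (intro mult_right_mono norm_mult_le_squares) simp
    finally show ?thesis by (simp add: fock_weight_basis distrib_right)
  qed
  have [measurable]: "g m \<in> borel_measurable \<nu>" for m unfolding g_def by measurable
  have gi: "integrable \<nu> (g m)" for m
    by (rule Bochner_Integration.integrable_bound[OF Bochner_Integration.integrable_add[OF int[of m] int[of k]]])
      (auto intro!: AE_I2 order_trans[OF gle])
  have fi: "integrable \<nu> (f m)" for m unfolding f_def using gi by simp
  have gn: "(LINT v|\<nu>. norm (g m v)) \<le> 2 * \<Lambda>" for m
  proof -
    have "(LINT v|\<nu>. norm (g m v)) \<le> (LINT v|\<nu>. fock_weight \<alpha> (fock_index m) v + fock_weight \<alpha> (fock_index k) v)"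
      by (rule integral_mono) (use gle gi int in auto)
    also have "\<dots> \<le> 2 * \<Lambda>" using int bd[of m] bd[of k] by simp
    finally show ?thesis .
  qed
  have fsum: "summable (\<lambda>m. LINT v|\<nu>. norm (f m v))"
  proof (rule summable_comparison_test[OF _ summable_mult2[OF summable_norm_fock_basis[OF \<alpha>, of w], of "2 * \<Lambda>"]], intro exI allI impI)
    fix m
    have "(LINT v|\<nu>. norm (f m v)) = norm (fock_basis \<alpha> m w) * (LINT v|\<nu>. norm (g m v))"
      by (simp add: f_def norm_mult)
    also have "\<dots> \<le> norm (fock_basis \<alpha> m w) * (2 * \<Lambda>)" using gn by (intro mult_left_mono) auto
    finally show "norm (LINT v|\<nu>. norm (f m v)) \<le> norm (fock_basis \<alpha> m w) * (2 * \<Lambda>)" by simp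
  qed
  have fs: "summable (\<lambda>m. norm (f m v))" for v
  proof -
    have bw: "norm (fock_basis \<alpha> m w) \<le> (\<Sum>m. norm (fock_basis \<alpha> m w))" for m
      using sum_le_suminf[OF summable_norm_fock_basis[OF \<alpha>, of w], of "{m}"] by simp
    have "summable (\<lambda>m. (\<Sum>m. norm (fock_basis \<alpha> m w)) * norm (fock_basis \<alpha> m v) * (norm (fock_basis \<alpha> k v) * gaussian \<alpha> v))"
      by (intro summable_mult2 summable_mult summable_norm_fock_basis \<alpha>)
    then show ?thesis
      by (rule summable_comparison_test[rotated])
        (auto simp: f_def g_def norm_mult mult.assoc intro!: exI[of _ 0] mult_right_mono bw)
  qed
  have feq: "(\<Sum>m. f m v) = ph_kernel \<alpha> v w * cnj (fock_basis \<alpha> k v) * of_real (gaussian \<alpha> v)" for v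
  proof -
    have "(\<lambda>m. fock_basis \<alpha> m v * cnj (fock_basis \<alpha> m w) * (cnj (fock_basis \<alpha> k v) * of_real (gaussian \<alpha> v)))
      sums (ph_kernel \<alpha> v w * (cnj (fock_basis \<alpha> k v) * of_real (gaussian \<alpha> v)))"
      by (intro sums_mult2 ph_kernel_sums \<alpha>)
    then show ?thesis by (simp add: f_def g_def sums_iff mult_ac)
  qed
  show "integrable \<nu> (\<lambda>v. ph_kernel \<alpha> v w * cnj (fock_basis \<alpha> k v) * of_real (gaussian \<alpha> v))"
    using integrable_suminf[OF fi _ fsum] fs by (simp add: feq)
  have "(LINT v|\<nu>. ph_kernel \<alpha> v w * cnj (fock_basis \<alpha> k v) * of_real (gaussian \<alpha> v)) = (\<Sum>m. LINT v|\<nu>. f m v)"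
    using integral_suminf[OF fi _ fsum] fs by (simp add: feq)
  also have "\<dots> = (\<Sum>m\<in>{k}. LINT v|\<nu>. f m v)"
    by (rule suminf_finite) (auto simp: f_def g_def orth)
  also have "\<dots> = cnj (fock_basis \<alpha> k w) * (LINT v|\<nu>. complex_of_real (fock_weight \<alpha> (fock_index k) v))"
    by (simp add: f_def g_def fock_weight_basis complex_norm_square del: of_real_power)
  finally show "(LINT v|\<nu>. ph_kernel \<alpha> v w * cnj (fock_basis \<alpha> k v) * of_real (gaussian \<alpha> v))
      = of_real (LINT v|\<nu>. fock_weight \<alpha> (fock_index k) v) * cnj (fock_basis \<alpha> k w)"
    by (simp add: mult.commute)
qed

lemma ph_kernel_commute: "ph_kernel \<alpha> z w = ph_kernel \<alpha> w z"
  by (simp add: ph_kernel_def add.commute)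

lemma continuous_on_ph_kernel: "continuous_on S (\<lambda>v. ph_kernel \<alpha> v w)"
  unfolding ph_kernel_def hdot_def divide_inverse by (intro continuous_intros)

section \<open>The diagonal operator\<close>

text \<open>Only the factor K(z,v) is expanded, while K(v,w) stays closed, so each term is an
  integral evaluated by the preceding computation. The square integrability of the kernel against
  \<mu> supplies the bound \<open>C + \<Lambda>\<close> that justifies the interchange.\<close>

lemma toeplitz_ph_kernel:
  fixes \<mu> :: "(complex^'n) measure"
  assumes \<alpha>: "\<alpha> > 0" and s[measurable_cong]: "sets \<mu> = sets borel"
    and int: "\<And>m. integrable \<mu> (fock_weight \<alpha> (fock_index m))"
    and bd: "\<And>m. (LINT v|\<mu>. fock_weight \<alpha> (fock_index m) v) \<le> \<Lambda>"
    and orth: "\<And>m k. m \<noteq> k \<Longrightarrow> (LINT v|\<mu>. fock_basis \<alpha> m v * cnj (fock_basis \<alpha> k v) * of_real (gaussian \<alpha> v)) = 0"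
    and K2: "integrable \<mu> (\<lambda>v. (norm (ph_kernel \<alpha> v w))\<^sup>2 * gaussian \<alpha> v)"
  shows "integrable \<mu> (\<lambda>v. ph_kernel \<alpha> z v * ph_kernel \<alpha> v w * of_real (gaussian \<alpha> v))"
    and "(\<lambda>m. of_real (LINT v|\<mu>. fock_weight \<alpha> (fock_index m) v) * cnj (fock_basis \<alpha> m w) * fock_basis \<alpha> m z)
      sums toeplitz \<alpha> \<mu> (\<lambda>v. ph_kernel \<alpha> v w) z"
proof -
  note I = integral_ph_kernel_fock_basis[OF \<alpha> s int bd orth, of w]
  define g where "g = (\<lambda>m v. ph_kernel \<alpha> v w * cnj (fock_basis \<alpha> m v) * of_real (gaussian \<alpha> v))"
  define f where "f = (\<lambda>m v. fock_basis \<alpha> m z * g m v)"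
  define C where "C = (LINT v|\<mu>. (norm (ph_kernel \<alpha> v w))\<^sup>2 * gaussian \<alpha> v)"
  have gi: "integrable \<mu> (g m)" for m unfolding g_def by (rule I(1))
  have fi: "integrable \<mu> (f m)" for m unfolding f_def using gi by simp
  have gle: "norm (g m v) \<le> (norm (ph_kernel \<alpha> v w))\<^sup>2 * gaussian \<alpha> v + fock_weight \<alpha> (fock_index m) v" for m v
  proof -
    have "norm (g m v) = norm (ph_kernel \<alpha> v w * cnj (fock_basis \<alpha> m v)) * gaussian \<alpha> v"
      by (simp add: g_def norm_mult)
    also have "\<dots> \<le> ((norm (ph_kernel \<alpha> v w))\<^sup>2 + (norm (fock_basis \<alpha> m v))\<^sup>2) * gaussian \<alpha> v"
      by (intro mult_right_mono norm_mult_le_squares) simp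
    finally show ?thesis by (simp add: fock_weight_basis distrib_right)
  qed
  have gn: "(LINT v|\<mu>. norm (g m v)) \<le> C + \<Lambda>" for m
  proof -
    have "(LINT v|\<mu>. norm (g m v)) \<le> (LINT v|\<mu>. (norm (ph_kernel \<alpha> v w))\<^sup>2 * gaussian \<alpha> v + fock_weight \<alpha> (fock_index m) v)"
      by (rule integral_mono) (use gle gi int K2 in auto)
    also have "\<dots> \<le> C + \<Lambda>" using int bd[of m] K2 by (simp add: C_def)
    finally show ?thesis .
  qed
  have fsum: "summable (\<lambda>m. LINT v|\<mu>. norm (f m v))"
  proof (rule summable_comparison_test[OF _ summable_mult2[OF summable_norm_fock_basis[OF \<alpha>, of z], of "C + \<Lambda>"]], intro exI allI impI)
    fix m
    have "(LINT v|\<mu>. norm (f m v)) = norm (fock_basis \<alpha> m z) * (LINT v|\<mu>. norm (g m v))"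
      by (simp add: f_def norm_mult)
    also have "\<dots> \<le> norm (fock_basis \<alpha> m z) * (C + \<Lambda>)" using gn by (intro mult_left_mono) auto
    finally show "norm (LINT v|\<mu>. norm (f m v)) \<le> norm (fock_basis \<alpha> m z) * (C + \<Lambda>)" by simp
  qed
  have fs: "summable (\<lambda>m. norm (f m v))" for v
  proof -
    have bw: "norm (fock_basis \<alpha> m v) \<le> (\<Sum>m. norm (fock_basis \<alpha> m v))" for m
      using sum_le_suminf[OF summable_norm_fock_basis[OF \<alpha>, of v], of "{m}"] by simp
    have "summable (\<lambda>m. norm (fock_basis \<alpha> m z) * ((\<Sum>m. norm (fock_basis \<alpha> m v)) * (norm (ph_kernel \<alpha> v w) * gaussian \<alpha> v)))"
      by (intro summable_mult2 summable_norm_fock_basis \<alpha>)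
    then show ?thesis
    proof (rule summable_comparison_test[rotated], intro exI allI impI)
      fix m
      have "norm (f m v) = norm (fock_basis \<alpha> m z) * (norm (fock_basis \<alpha> m v) * (norm (ph_kernel \<alpha> v w) * gaussian \<alpha> v))"
        by (simp add: f_def g_def norm_mult)
      also have "\<dots> \<le> norm (fock_basis \<alpha> m z) * ((\<Sum>m. norm (fock_basis \<alpha> m v)) * (norm (ph_kernel \<alpha> v w) * gaussian \<alpha> v))"
        by (intro mult_left_mono mult_right_mono bw) auto
      finally show "norm (norm (f m v)) \<le> norm (fock_basis \<alpha> m z) * ((\<Sum>m. norm (fock_basis \<alpha> m v)) * (norm (ph_kernel \<alpha> v w) * gaussian \<alpha> v))"
        by simp
    qed
  qed
  have feq: "(\<Sum>m. f m v) = ph_kernel \<alpha> z v * ph_kernel \<alpha> v w * of_real (gaussian \<alpha> v)" for v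
  proof -
    have "(\<lambda>m. fock_basis \<alpha> m z * cnj (fock_basis \<alpha> m v) * (ph_kernel \<alpha> v w * of_real (gaussian \<alpha> v)))
      sums (ph_kernel \<alpha> z v * (ph_kernel \<alpha> v w * of_real (gaussian \<alpha> v)))"
      by (intro sums_mult2 ph_kernel_sums \<alpha>)
    then show ?thesis by (simp add: f_def g_def sums_iff mult_ac)
  qed
  show "integrable \<mu> (\<lambda>v. ph_kernel \<alpha> z v * ph_kernel \<alpha> v w * of_real (gaussian \<alpha> v))"
    using integrable_suminf[OF fi _ fsum] fs by (simp add: feq)
  have "(\<lambda>m. LINT v|\<mu>. f m v) sums (LINT v|\<mu>. (\<Sum>m. f m v))"
    using sums_integral[OF fi _ fsum] fs by simp
  moreover have "(LINT v|\<mu>. f m v) = of_real (LINT v|\<mu>. fock_weight \<alpha> (fock_index m) v) * cnj (fock_basis \<alpha> m w) * fock_basis \<alpha> m z" for m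
    by (simp add: f_def g_def I(2))
  ultimately show "(\<lambda>m. of_real (LINT v|\<mu>. fock_weight \<alpha> (fock_index m) v) * cnj (fock_basis \<alpha> m w) * fock_basis \<alpha> m z)
      sums toeplitz \<alpha> \<mu> (\<lambda>v. ph_kernel \<alpha> v w) z"
    by (simp add: feq toeplitz_def gaussian_def)
qed

text \<open>The Lebesgue case: all weights have the same mass, which the normalisation of the inner
  product cancels.\<close>

lemma ph_inner_ph_kernel:
  fixes w :: "complex^'n"
  assumes \<alpha>: "\<alpha> > 0"
  shows "integrable lborel (\<lambda>v. ph_kernel \<alpha> v w * cnj (fock_basis \<alpha> k v) * of_real (gaussian \<alpha> v))"
    and "ph_inner \<alpha> (\<lambda>v. ph_kernel \<alpha> v w) (fock_basis \<alpha> k) = cnj (fock_basis \<alpha> k w)"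
proof -
  have I: "(LINT v|lborel. fock_weight \<alpha> (fock_index m :: 'n \<Rightarrow> int) v) = (\<alpha> * pi) ^ CARD('n)" for m
    using nn_integral_fock_weight[OF \<alpha>, of "fock_index m :: 'n \<Rightarrow> int"] \<alpha>
    by (simp add: integral_eq_nn_integral)
  have orth: "(LINT v|lborel. fock_basis \<alpha> m v * cnj (fock_basis \<alpha> k v) * of_real (gaussian \<alpha> (v::complex^'n))) = 0"
    if "m \<noteq> k" for m k
    using fock_monomial_orthogonal_lborel[OF \<alpha>, of "fock_index m :: 'n \<Rightarrow> int" "fock_index k"] that
    by (simp add: fock_basis_def gaussian_def)
  note K = integral_ph_kernel_fock_basis[OF \<alpha> _ integrable_fock_weight[OF \<alpha>] eq_refl[OF I] orth, simplified, of w k]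
  show "integrable lborel (\<lambda>v. ph_kernel \<alpha> v w * cnj (fock_basis \<alpha> k v) * of_real (gaussian \<alpha> v))"
    by (rule K(1))
  show "ph_inner \<alpha> (\<lambda>v. ph_kernel \<alpha> v w) (fock_basis \<alpha> k) = cnj (fock_basis \<alpha> k w)"
    using \<alpha> by (simp add: ph_inner_gaussian K(2) I)
qed

text \<open>The diagonal operator is defined on \<^emph>\<open>all\<close> functions \<open>x\<close>; no completeness of the monomials in
  the pluriharmonic Fock space is needed, because only its values on the kernels have to be identified.\<close>

definition fock_diagonal :: "real \<Rightarrow> (nat \<Rightarrow> real) \<Rightarrow> (complex^'n \<Rightarrow> complex) \<Rightarrow> complex^'n \<Rightarrow> complex" where
  "fock_diagonal \<alpha> l x z = (\<Sum>m. of_real (l m) * ph_inner \<alpha> x (fock_basis \<alpha> m) * fock_basis \<alpha> m z)"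

text \<open>The uniform bound is what pluriharmonicity of the series asks for; the square-summable
  bound feeds the norm estimate. Both come from Bessel's inequality.\<close>

lemma fock_coefficient_bound:
  fixes x :: "complex^'n \<Rightarrow> complex"
  assumes \<alpha>: "\<alpha> > 0" and l: "\<And>m. 0 \<le> l m" "\<And>m. l m \<le> \<Lambda>" and x: "fock_L2 \<alpha> x"
  shows "norm (of_real (l m) * ph_inner \<alpha> x (fock_basis \<alpha> m)) \<le> \<Lambda> * ip_norm (ph_inner \<alpha>) x"
    and "finite F \<Longrightarrow> (\<Sum>m\<in>F. (norm (of_real (l m) * ph_inner \<alpha> x (fock_basis \<alpha> m)))\<^sup>2) \<le> (\<Lambda> * ip_norm (ph_inner \<alpha>) x)\<^sup>2"
proof -
  have L: "\<Lambda> \<ge> 0" using l[of 0] by linarith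
  have *: "(\<Sum>m\<in>F. (norm (of_real (l m) * ph_inner \<alpha> x (fock_basis \<alpha> m)))\<^sup>2) \<le> (\<Lambda> * ip_norm (ph_inner \<alpha>) x)\<^sup>2" if "finite F" for F
  proof -
    have "(\<Sum>m\<in>F. (norm (of_real (l m) * ph_inner \<alpha> x (fock_basis \<alpha> m)))\<^sup>2)
      \<le> (\<Sum>m\<in>F. \<Lambda>\<^sup>2 * (norm (ph_inner \<alpha> x (fock_basis \<alpha> m)))\<^sup>2)"
      using l by (intro sum_mono) (auto simp: norm_mult power_mult_distrib intro!: mult_right_mono power_mono)
    also have "\<dots> \<le> \<Lambda>\<^sup>2 * (ip_norm (ph_inner \<alpha>) x)\<^sup>2"
      unfolding sum_distrib_left[symmetric] by (intro mult_left_mono ph_bessel \<alpha> x that) auto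
    finally show ?thesis by (simp add: power_mult_distrib)
  qed
  show "norm (of_real (l m) * ph_inner \<alpha> x (fock_basis \<alpha> m)) \<le> \<Lambda> * ip_norm (ph_inner \<alpha>) x"
  proof (rule power2_le_imp_le)
    show "(norm (of_real (l m) * ph_inner \<alpha> x (fock_basis \<alpha> m)))\<^sup>2 \<le> (\<Lambda> * ip_norm (ph_inner \<alpha>) x)\<^sup>2"
      using *[of "{m}"] by simp
    show "\<Lambda> * ip_norm (ph_inner \<alpha>) x \<ge> 0"
      by (intro mult_nonneg_nonneg L ip_norm_ph_square(2)[OF \<alpha>])
  qed
  show "finite F \<Longrightarrow> (\<Sum>m\<in>F. (norm (of_real (l m) * ph_inner \<alpha> x (fock_basis \<alpha> m)))\<^sup>2) \<le> (\<Lambda> * ip_norm (ph_inner \<alpha>) x)\<^sup>2"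
    by (rule *)
qed

lemma fock_diagonal_sums:
  fixes x :: "complex^'n \<Rightarrow> complex"
  assumes \<alpha>: "\<alpha> > 0" and l: "\<And>m. 0 \<le> l m" "\<And>m. l m \<le> \<Lambda>" and x: "fock_L2 \<alpha> x"
  shows "(\<lambda>m. of_real (l m) * ph_inner \<alpha> x (fock_basis \<alpha> m) * fock_basis \<alpha> m z) sums fock_diagonal \<alpha> l x z"
  unfolding fock_diagonal_def
  by (rule summable_sums[OF summable_norm_cancel[OF pluriharmonic_fock_series(2)[OF \<alpha> fock_coefficient_bound(1)[OF \<alpha> l x]]]])

lemma fock_diagonal_bounded:
  assumes \<alpha>: "\<alpha> > 0" and l: "\<And>m. 0 \<le> l m" "\<And>m. l m \<le> \<Lambda>"
  shows "bounded_operator_on (PH2 \<alpha>) (ph_inner \<alpha>) (fock_diagonal \<alpha> l :: (complex^'n \<Rightarrow> complex) \<Rightarrow> complex^'n \<Rightarrow> complex)"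
  unfolding bounded_operator_on_def
proof (intro conjI ballI allI)
  note S = fock_diagonal_sums[OF \<alpha> l PH2_imp_fock_L2]
  note N = fock_series_norm_le[OF \<alpha> S fock_coefficient_bound(2)[OF \<alpha> l PH2_imp_fock_L2 finite_lessThan]]
  fix f :: "complex^'n \<Rightarrow> complex" assume f: "f \<in> PH2 \<alpha>"
  have "pluriharmonic (fock_diagonal \<alpha> l f)"
    using pluriharmonic_fock_series(1)[OF \<alpha> fock_coefficient_bound(1)[OF \<alpha> l PH2_imp_fock_L2[OF f]]]
    unfolding fock_diagonal_def[abs_def] .
  then show "fock_diagonal \<alpha> l f \<in> PH2 \<alpha>"
    using N(1)[OF f f] by (simp add: PH2_def gaussian_def)
  fix g :: "complex^'n \<Rightarrow> complex" and a b assume g: "g \<in> PH2 \<alpha>"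
  show "fock_diagonal \<alpha> l (\<lambda>z. a * f z + b * g z) = (\<lambda>z. a * fock_diagonal \<alpha> l f z + b * fock_diagonal \<alpha> l g z)"
  proof
    fix z :: "complex^'n"
    have eq: "of_real (l m) * ph_inner \<alpha> (\<lambda>z. a * f z + b * g z) (fock_basis \<alpha> m) * fock_basis \<alpha> m z
      = a * (of_real (l m) * ph_inner \<alpha> f (fock_basis \<alpha> m) * fock_basis \<alpha> m z)
      + b * (of_real (l m) * ph_inner \<alpha> g (fock_basis \<alpha> m) * fock_basis \<alpha> m z)" for m
      unfolding ph_inner_add[OF PH2_imp_fock_L2[OF f] PH2_imp_fock_L2[OF g] fock_L2_basis[OF \<alpha>]]
      by (simp only: distrib_left distrib_right mult_ac)
    have "(\<lambda>m. of_real (l m) * ph_inner \<alpha> (\<lambda>z. a * f z + b * g z) (fock_basis \<alpha> m) * fock_basis \<alpha> m z)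
      sums (a * fock_diagonal \<alpha> l f z + b * fock_diagonal \<alpha> l g z)"
      unfolding eq by (intro sums_add sums_mult S f g)
    then show "fock_diagonal \<alpha> l (\<lambda>z. a * f z + b * g z) z = a * fock_diagonal \<alpha> l f z + b * fock_diagonal \<alpha> l g z"
      unfolding fock_diagonal_def[of \<alpha> l "\<lambda>z. a * f z + b * g z"] by (rule sums_unique[symmetric])
  qed
next
  have L: "\<Lambda> \<ge> 0" using l[of 0] by linarith
  note S = fock_diagonal_sums[OF \<alpha> l PH2_imp_fock_L2]
  note N = fock_series_norm_le[OF \<alpha> S fock_coefficient_bound(2)[OF \<alpha> l PH2_imp_fock_L2 finite_lessThan]]
  show "\<exists>C. \<forall>f\<in>PH2 \<alpha>. ip_norm (ph_inner \<alpha>) (fock_diagonal \<alpha> l f) \<le> C * ip_norm (ph_inner \<alpha>) (f :: complex^'n \<Rightarrow> complex)"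
  proof (intro exI[of _ \<Lambda>] ballI)
    fix f :: "complex^'n \<Rightarrow> complex" assume f: "f \<in> PH2 \<alpha>"
    show "ip_norm (ph_inner \<alpha>) (fock_diagonal \<alpha> l f) \<le> \<Lambda> * ip_norm (ph_inner \<alpha>) f"
      by (rule power2_le_imp_le[OF N(2)[OF f f]]) (intro mult_nonneg_nonneg L ip_norm_ph_square(2)[OF \<alpha>])
  qed
qed

text \<open>As the eigenvalues are nonnegative, the same orthonormal system serves on both sides.
  Zero eigenvalues are dropped, since the decomposition asks for positive values. The squared
  remainder is at most the part of the convergent series \<open>q\<close> outside F.\<close>

lemma fock_diagonal_svd:
  assumes \<alpha>: "\<alpha> > 0" and l: "\<And>m. 0 \<le> l m" "\<And>m. l m \<le> \<Lambda>"
  shows "singular_value_decomposition (PH2 \<alpha>) (ph_inner \<alpha>) (fock_diagonal \<alpha> l :: (complex^'n \<Rightarrow> complex) \<Rightarrow> complex^'n \<Rightarrow> complex)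
    {m. l m > 0} l (fock_basis \<alpha>) (fock_basis \<alpha>)"
  unfolding singular_value_decomposition_def
proof (intro conjI ballI)
  let ?I = "{m. l m > 0}"
  show "orthonormal_in (PH2 \<alpha>) (ph_inner \<alpha>) ?I (fock_basis \<alpha> :: nat \<Rightarrow> complex^'n \<Rightarrow> complex)"
    by (simp add: orthonormal_in_def fock_basis_PH2[OF \<alpha>] ph_inner_fock_basis[OF \<alpha>])
  then show "orthonormal_in (PH2 \<alpha>) (ph_inner \<alpha>) ?I (fock_basis \<alpha> :: nat \<Rightarrow> complex^'n \<Rightarrow> complex)" .
  fix x :: "complex^'n \<Rightarrow> complex" assume "x \<in> PH2 \<alpha>"
  then have x: "fock_L2 \<alpha> x" by (rule PH2_imp_fock_L2)
  define b where "b = (\<lambda>m. of_real (l m) * ph_inner \<alpha> x (fock_basis \<alpha> m))"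
  define q where "q = (\<lambda>m. (norm (b m))\<^sup>2)"
  have q0: "q m \<ge> 0" for m by (simp add: q_def)
  have "summable q"
    using fock_coefficient_bound(2)[OF \<alpha> l x finite_lessThan]
    by (intro summableI_nonneg_bounded[OF q0]) (simp add: q_def b_def)
  then have "(q has_sum (\<Sum>m. q m)) UNIV"
    using q0 by (intro norm_summable_imp_has_sum) (auto simp: summable_sums)
  \<comment> \<open>Indices with \<open>l m = 0\<close> contribute 0, so the sum over the positive
    eigenvalues is already the full sum.\<close>
  then have qI: "(q has_sum (\<Sum>m. q m)) ?I"
    using l(1) by (subst has_sum_cong_neutral[where T=UNIV and g=q]) (auto simp: q_def b_def not_less intro: antisym)
  define R where "R = (\<lambda>F. ip_norm (ph_inner \<alpha>) (\<lambda>z. fock_diagonal \<alpha> l x z - (\<Sum>i\<in>F. complex_of_real (l i) * ph_inner \<alpha> x (fock_basis \<alpha> i) * fock_basis \<alpha> i z)))"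
  have R: "(R F)\<^sup>2 \<le> (\<Sum>m. q m) - sum q F" if F: "finite F" for F
    unfolding R_def
  \<comment> \<open>The remainder is itself a series in the basis, with the coefficients in F set to
    0.\<close>
  proof (rule fock_series_norm_le(2)[OF \<alpha>, where b="\<lambda>m. if m \<in> F then 0 else b m"])
    fix z
    have "(\<lambda>m. b m * fock_basis \<alpha> m z - (if m \<in> F then b m * fock_basis \<alpha> m z else 0))
      sums (fock_diagonal \<alpha> l x z - (\<Sum>i\<in>F. b i * fock_basis \<alpha> i z))"
      using fock_diagonal_sums[OF \<alpha> l x, where z=z] F unfolding b_def
      by (intro sums_diff sums_If_finite_set)
    also have "(\<lambda>m. b m * fock_basis \<alpha> m z - (if m \<in> F then b m * fock_basis \<alpha> m z else 0))
      = (\<lambda>m. (if m \<in> F then 0 else b m) * fock_basis \<alpha> m z)" by auto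
    finally show "(\<lambda>m. (if m \<in> F then 0 else b m) * fock_basis \<alpha> m z) sums
      (fock_diagonal \<alpha> l x z - (\<Sum>i\<in>F. complex_of_real (l i) * ph_inner \<alpha> x (fock_basis \<alpha> i) * fock_basis \<alpha> i z))"
      by (simp add: b_def)
  next
    fix k
    have "(\<Sum>m<k. (norm (if m \<in> F then 0 else b m))\<^sup>2) + sum q F = sum q ({..<k} - F) + sum q F"
      by (simp add: q_def if_distrib[of norm] if_distrib[of "\<lambda>x. x\<^sup>2"] sum.If_cases Diff_eq cong: if_cong)
    also have "\<dots> = sum q ({..<k} - F \<union> F)" using F by (intro sum.union_disjoint[symmetric]) auto
    also have "\<dots> \<le> (\<Sum>m. q m)" using F by (intro sum_le_suminf \<open>summable q\<close>) (auto simp: q0)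
    finally show "(\<Sum>m<k. (norm (if m \<in> F then 0 else b m))\<^sup>2) \<le> (\<Sum>m. q m) - sum q F" by simp
  qed
  have "((\<lambda>F. (\<Sum>m. q m) - sum q F) \<longlongrightarrow> (\<Sum>m. q m) - (\<Sum>m. q m)) (finite_subsets_at_top ?I)"
    using qI unfolding has_sum_def by (intro tendsto_diff tendsto_const)
  then have "((\<lambda>F. sqrt ((\<Sum>m. q m) - sum q F)) \<longlongrightarrow> sqrt 0) (finite_subsets_at_top ?I)"
    by (intro tendsto_real_sqrt) simp
  then have lim: "((\<lambda>F. sqrt ((\<Sum>m. q m) - sum q F)) \<longlongrightarrow> 0) (finite_subsets_at_top ?I)" by simp
  have "(R \<longlongrightarrow> 0) (finite_subsets_at_top ?I)"
  proof (rule tendsto_sandwich[OF _ _ tendsto_const lim])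
    show "\<forall>\<^sub>F F in finite_subsets_at_top ?I. 0 \<le> R F"
      by (simp add: R_def ip_norm_ph_square(2)[OF \<alpha>])
    show "\<forall>\<^sub>F F in finite_subsets_at_top ?I. R F \<le> sqrt ((\<Sum>m. q m) - sum q F)"
      using eventually_finite_subsets_at_top_weakI[of ?I "\<lambda>F. R F \<le> sqrt ((\<Sum>m. q m) - sum q F)"] R real_le_rsqrt by blast
  qed
  then show "((\<lambda>F. ip_norm (ph_inner \<alpha>) (\<lambda>z. fock_diagonal \<alpha> l x z -
      (\<Sum>i\<in>F. complex_of_real (l i) * ph_inner \<alpha> x (fock_basis \<alpha> i) * fock_basis \<alpha> i z))) \<longlongrightarrow> 0) (finite_subsets_at_top ?I)"
    unfolding R_def .
qed auto

text \<open>A kernel at w has coefficients \<open>cnj (fock_basis \<alpha> m w)\<close>, so both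
  sides are sums of the same series. The integrability in \<open>toeplitz_ph_kernel\<close> is what
  allows the Toeplitz integral of a finite combination of kernels to be split.\<close>

lemma fock_diagonal_eq_toeplitz:
  fixes \<mu> :: "(complex^'n) measure"
  assumes \<alpha>: "\<alpha> > 0" and s: "sets \<mu> = sets borel"
    and int: "\<And>m. integrable \<mu> (fock_weight \<alpha> (fock_index m))"
    and bd: "\<And>m. (LINT v|\<mu>. fock_weight \<alpha> (fock_index m) v) \<le> \<Lambda>"
    and orth: "\<And>m k. m \<noteq> k \<Longrightarrow> (LINT v|\<mu>. fock_basis \<alpha> m v * cnj (fock_basis \<alpha> k v) * of_real (gaussian \<alpha> v)) = 0"
    and K2: "\<And>w. integrable \<mu> (\<lambda>v. (norm (ph_kernel \<alpha> v w))\<^sup>2 * gaussian \<alpha> v)"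
    and f: "f \<in> kernel_span \<alpha>"
  shows "fock_diagonal \<alpha> (\<lambda>m. LINT v|\<mu>. fock_weight \<alpha> (fock_index m) v) f = toeplitz \<alpha> \<mu> f"
proof
  fix z
  define l where "l = (\<lambda>m. LINT v|\<mu>. fock_weight \<alpha> (fock_index m) v)"
  obtain A c where A: "finite A" and f: "f = (\<lambda>z. \<Sum>w\<in>A. c w * ph_kernel \<alpha> z w)"
    using f unfolding kernel_span_def by blast
  note T = toeplitz_ph_kernel[OF \<alpha> s int bd orth K2]
  have ip: "ph_inner \<alpha> f (fock_basis \<alpha> m) = (\<Sum>w\<in>A. c w * cnj (fock_basis \<alpha> m w))" for m
  proof -
    have "(LINT z|lborel. f z * cnj (fock_basis \<alpha> m z) * of_real (gaussian \<alpha> z))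
      = (LINT z|lborel. (\<Sum>w\<in>A. c w * (ph_kernel \<alpha> z w * cnj (fock_basis \<alpha> m z) * of_real (gaussian \<alpha> z))))"
      by (simp add: f sum_distrib_right mult.assoc)
    also have "\<dots> = (\<Sum>w\<in>A. c w * (LINT z|lborel. ph_kernel \<alpha> z w * cnj (fock_basis \<alpha> m z) * of_real (gaussian \<alpha> z)))"
      by (subst Bochner_Integration.integral_sum)
        (auto intro!: integrable_mult_right ph_inner_ph_kernel(1) \<alpha>)
    finally have "ph_inner \<alpha> f (fock_basis \<alpha> m) = (\<Sum>w\<in>A. c w * ph_inner \<alpha> (\<lambda>v. ph_kernel \<alpha> v w) (fock_basis \<alpha> m))"
      by (simp add: ph_inner_gaussian sum_divide_distrib)
    then show ?thesis by (simp add: ph_inner_ph_kernel(2)[OF \<alpha>])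
  qed
  have tf: "toeplitz \<alpha> \<mu> f z = (\<Sum>w\<in>A. c w * toeplitz \<alpha> \<mu> (\<lambda>v. ph_kernel \<alpha> v w) z)"
  proof -
    have "toeplitz \<alpha> \<mu> f z = (LINT v|\<mu>. (\<Sum>w\<in>A. c w * (ph_kernel \<alpha> z v * ph_kernel \<alpha> v w * of_real (gaussian \<alpha> v))))"
      unfolding toeplitz_def gaussian_def
      by (simp add: f sum_distrib_right sum_distrib_left mult_ac)
    also have "\<dots> = (\<Sum>w\<in>A. c w * (LINT v|\<mu>. ph_kernel \<alpha> z v * ph_kernel \<alpha> v w * of_real (gaussian \<alpha> v)))"
      using T(1) by (subst Bochner_Integration.integral_sum) auto
    finally show ?thesis by (simp add: toeplitz_def gaussian_def)
  qed
  have "(\<lambda>m. \<Sum>w\<in>A. c w * (of_real (l m) * cnj (fock_basis \<alpha> m w) * fock_basis \<alpha> m z)) sums toeplitz \<alpha> \<mu> f z"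
    unfolding tf l_def by (intro sums_sum sums_mult T(2))
  also have "(\<lambda>m. \<Sum>w\<in>A. c w * (of_real (l m) * cnj (fock_basis \<alpha> m w) * fock_basis \<alpha> m z))
    = (\<lambda>m. of_real (l m) * ph_inner \<alpha> f (fock_basis \<alpha> m) * fock_basis \<alpha> m z)"
    by (simp add: ip sum_distrib_left sum_distrib_right mult_ac)
  finally show "fock_diagonal \<alpha> (\<lambda>m. LINT v|\<mu>. fock_weight \<alpha> (fock_index m) v) f z = toeplitz \<alpha> \<mu> f z"
    unfolding fock_diagonal_def l_def by (rule sums_unique[symmetric])
qed

theorem mainTheorem5:
  fixes \<alpha> p :: real and \<mu> :: "(complex^'n) measure"
  assumes "\<alpha> > 0" and "p \<ge> 1"
    and "regular_borel_measure \<mu>" and "radial_measure \<mu>"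
    and "\<And>z. (\<integral>\<^sup>+ w. ennreal ((cmod (ph_kernel \<alpha> z w))\<^sup>2 * exp (- (norm w)\<^sup>2 / \<alpha>)) \<partial>\<mu>) < \<infinity>"
    and "\<And>r. r > 0 \<Longrightarrow> integrable lborel (\<lambda>z. measure \<mu> (ball z r) powr p)"
  shows "toeplitz_in_schatten \<alpha> p \<mu>"
proof -
  note \<alpha> = \<open>\<alpha> > 0\<close> and p = \<open>p \<ge> 1\<close>
  have s: "sets \<mu> = sets borel" using assms(3) by (simp add: regular_borel_measure_def)
  note [measurable_cong] = s
  have fin: "emeasure \<mu> (ball z r) < \<infinity>" for z r
  proof -
    have "compact K \<Longrightarrow> K \<in> sets borel \<Longrightarrow> emeasure \<mu> K < \<infinity>" for K
      using assms(3) unfolding regular_borel_measure_def by blast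
    then have "emeasure \<mu> (cball z r) < \<infinity>" by simp
    then show ?thesis using s by (intro le_less_trans[OF emeasure_mono[of "ball z r" "cball z r" \<mu>]]) auto
  qed
  define l where "l = (\<lambda>m. LINT v|\<mu>. fock_weight \<alpha> (fock_index m) v)"
  have "integrable lborel (\<lambda>z. measure \<mu> (ball z CARD('n)) powr p)" by (rule assms(6)) simp
  note E = fock_weight_integrable_powr_summable[OF \<alpha> p s fin this]
  have l0: "l m \<ge> 0" for m unfolding l_def by (intro integral_nonneg_AE AE_I2) simp
  have lsum: "summable (\<lambda>m. l m powr p)" unfolding l_def by (rule E(2))
  \<comment> \<open>An explicit uniform bound: a nonnegative number is at most 1 or at most its p-th
    power, and each p-th power is at most the whole sum.\<close>
  define \<Lambda> where "\<Lambda> = 1 + (\<Sum>m. l m powr p)"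
  have l\<Lambda>: "l m \<le> \<Lambda>" for m
  proof -
    have "l m \<le> 1 + l m powr p"
    proof (cases "l m \<le> 1")
      case False
      then have "l m powr 1 \<le> l m powr p" using p by (intro powr_mono) auto
      then show ?thesis using False by simp
    qed (simp add: add_increasing2)
    also have "l m powr p \<le> (\<Sum>m. l m powr p)"
      using sum_le_suminf[OF lsum, of "{m}"] by simp
    finally show ?thesis by (simp add: \<Lambda>_def)
  qed
  have orth: "(LINT v|\<mu>. fock_basis \<alpha> m v * cnj (fock_basis \<alpha> k v) * of_real (gaussian \<alpha> v)) = 0" if "m \<noteq> k" for m k
    using fock_monomial_orthogonal_radial[OF assms(4) s, of "fock_index m" "fock_index k" \<alpha>] that
    by (simp add: fock_basis_def gaussian_def)
  \<comment> \<open>The hypothesis integrates over the second argument of the kernel; symmetry of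
    the kernel moves the integration variable to the first.\<close>
  have K2: "integrable \<mu> (\<lambda>v. (norm (ph_kernel \<alpha> v w))\<^sup>2 * gaussian \<alpha> v)" for w
  proof (rule integrableI_bounded)
    have "(\<lambda>v. ph_kernel \<alpha> v w) \<in> borel_measurable borel"
      by (rule borel_measurable_continuous_onI[OF continuous_on_ph_kernel])
    then show "(\<lambda>v. (norm (ph_kernel \<alpha> v w))\<^sup>2 * gaussian \<alpha> v) \<in> borel_measurable \<mu>" by measurable
    show "(\<integral>\<^sup>+ v. ennreal (norm ((norm (ph_kernel \<alpha> v w))\<^sup>2 * gaussian \<alpha> v)) \<partial>\<mu>) < \<infinity>"
      using assms(5)[of w] by (simp add: ph_kernel_commute[of \<alpha> w] gaussian_def abs_mult)
  qed
  have "fock_diagonal \<alpha> l \<in> schatten_class (PH2 \<alpha>) (ph_inner \<alpha> :: (complex^'n \<Rightarrow> complex) \<Rightarrow> _) p"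
    unfolding schatten_class_def
  proof (intro CollectI conjI exI)
    show "bounded_operator_on (PH2 \<alpha>) (ph_inner \<alpha>) (fock_diagonal \<alpha> l :: (complex^'n \<Rightarrow> complex) \<Rightarrow> _)"
      by (rule fock_diagonal_bounded[OF \<alpha> l0 l\<Lambda>])
    show "singular_value_decomposition (PH2 \<alpha>) (ph_inner \<alpha>) (fock_diagonal \<alpha> l :: (complex^'n \<Rightarrow> complex) \<Rightarrow> _)
      {m. l m > 0} l (fock_basis \<alpha>) (fock_basis \<alpha>)"
      by (rule fock_diagonal_svd[OF \<alpha> l0 l\<Lambda>])
    have "(\<lambda>m. l m powr p) summable_on UNIV" using lsum by (simp add: summable_on_UNIV_nonneg_real_iff)
    then show "(\<lambda>m. l m powr p) summable_on {m. l m > 0}" by (rule summable_on_subset) simp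
  qed
  moreover have "fock_diagonal \<alpha> l f = toeplitz \<alpha> \<mu> f" if "f \<in> kernel_span \<alpha>" for f
    unfolding l_def
    by (rule fock_diagonal_eq_toeplitz[OF \<alpha> s E(1) l\<Lambda>[unfolded l_def] orth K2 that])
  ultimately show ?thesis unfolding toeplitz_in_schatten_def by blast
qed

end
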